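(* Suppose $E$ is an interior weight on $\Omega$, $E=\gamma\ge0$ on $\partial\Omega$ ($\gamma$ a constant), $0\le f\in C^\infty(\gamma,\infty)$, and $\Omega_t:=\{x\in\Omega:\gamma+\frac1t<E(x)<t\}$ is connected for sufficiently large $t$. Then the following are equivalent: (i) For all $u\in H_0^1(\Omega)$, $$\int_\Omega|\nabla u|_A^2\,dx-\frac14\int_\Omega\frac{|\nabla E|_A^2}{E^2}u^2\,dx\ \ge\ \int_\Omega f(E)|\nabla E|_A^2u^2\,dx.$$ (ii) There exists some $0<h\in C^2(\gamma,\infty)$ such that $$h''(t)+\left(f(t)+\frac1{4t^2}\right)h(t)\le0\qquad\text{in }(\gamma,\infty).$$
   Context: $\Omega\subset\mathbb{R}^n$ is a bounded connected domain with smooth boundary. $A(x)=(a^{i,j}(x))$ is an $n\times n$ symmetric, uniformly positive definite matrix with $a^{i,j}\in C^\infty(\overline\Omega)$. For $\xi\in\mathbb{R}^n$, $|\xi|_A^2:=A(x)\xi\cdot\xi$, and $\mathcal L_A(E):=-\mathrm{div}(A\nabla E)$ (in the distributional sense). $E$ is called an interior weight on $\Omega$ if $E>0$ in $\Omega$; $\mathcal L_A(E)$ is a nonnegative nonzero finite measure in $\Omega$, denoted $\mu$; and, with $K\subset\Omega$ denoting the (compact) support of $\mu$, $E\in C^\infty(\overline\Omega\setminus K)$, $E=\infty$ on $K$, and $\dim_{box}(K)<n-2$. For compact $K\subset\mathbb{R}^n$, $\dim_{box}(K):=n-\lim_{r\searrow0}\frac{\log(\mathcal H^n(K_r))}{\log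 r}$ provided the limit exists, where $K_r:=\{x\in\Omega:\mathrm{dist}(x,K)<r\}$ and $\mathcal H^n$ is $n$-dimensional Hausdorff measure. *)

theory Defs
  imports "HOL-Analysis.Analysis"
begin

section \<open>Smooth functions\<close>

text \<open>
  For open \<open>U\<close> and \<open>U \<subseteq> S \<subseteq> closure U\<close>, \<open>Ck_ext k U S f\<close> says that \<open>f\<close> is \<open>k\<close> times continuously
  differentiable in \<open>U\<close> and that its partial derivatives of order at most \<open>k\<close> extend
  continuously to \<open>S\<close>. For \<open>S = U\<close> this is plain \<open>C\<^sup>k(U)\<close>.
\<close>

primrec Ck_ext :: "nat \<Rightarrow> 'a::euclidean_space set \<Rightarrow> 'a set \<Rightarrow> ('a \<Rightarrow> real) \<Rightarrow> bool" where
  "Ck_ext 0 U S f \<longleftrightarrow> (\<exists>g. continuous_on S g \<and> (\<forall>x\<in>U. g x = f x))"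
| "Ck_ext (Suc k) U S f \<longleftrightarrow>
     (\<exists>g. continuous_on S g \<and> (\<forall>x\<in>U. g x = f x)) \<and>
     (\<forall>x\<in>U. f differentiable (at x)) \<and>
     (\<forall>b\<in>Basis. Ck_ext k U S (\<lambda>x. frechet_derivative f (at x) b))"

definition Ck_on :: "nat \<Rightarrow> 'a::euclidean_space set \<Rightarrow> ('a \<Rightarrow> real) \<Rightarrow> bool" where
  "Ck_on k U f \<longleftrightarrow> Ck_ext k U U f"

definition smooth_on :: "'a::euclidean_space set \<Rightarrow> ('a \<Rightarrow> real) \<Rightarrow> bool" where
  "smooth_on U f \<longleftrightarrow> (\<forall>k. Ck_on k U f)"

text \<open>\<open>C\<^sup>\<infinity>(S)\<close> for a set \<open>S\<close> such as \<open>closure \<Omega>\<close> or \<open>closure \<Omega> - K\<close>, where \<open>U\<close> is the part of \<open>S\<close>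
  lying in the open set \<open>\<Omega>\<close>. The values of \<open>f\<close> on \<open>S - U\<close> are the continuous extension.\<close>

definition smooth_upto :: "'a::euclidean_space set \<Rightarrow> 'a set \<Rightarrow> ('a \<Rightarrow> real) \<Rightarrow> bool" where
  "smooth_upto U S f \<longleftrightarrow> continuous_on S f \<and> (\<forall>k. Ck_ext k U S f)"

definition grad :: "(real^'n \<Rightarrow> real) \<Rightarrow> real^'n \<Rightarrow> real^'n" where
  "grad f x = (\<chi> i. frechet_derivative f (at x) (axis i 1))"

definition divergence :: "(real^'n \<Rightarrow> real^'n) \<Rightarrow> real^'n \<Rightarrow> real" where
  "divergence F x = (\<Sum>i\<in>UNIV. frechet_derivative (\<lambda>y. F y $ i) (at x) (axis i 1))"


section \<open>The domain and the coefficient matrix\<close>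

text \<open>Smoothness of the boundary is expressed by local defining functions; since their gradients do
  not vanish, the frontier is locally \<open>{\<rho> = 0}\<close>.\<close>

definition smooth_boundary :: "(real^'n) set \<Rightarrow> bool" where
  "smooth_boundary \<Omega> \<longleftrightarrow>
     (\<forall>p\<in>frontier \<Omega>. \<exists>V \<rho>. open V \<and> p \<in> V \<and> smooth_on V \<rho> \<and> (\<forall>x\<in>V. grad \<rho> x \<noteq> 0) \<and>
        \<Omega> \<inter> V = {x\<in>V. \<rho> x < 0})"

definition smooth_bounded_domain :: "(real^'n) set \<Rightarrow> bool" where
  "smooth_bounded_domain \<Omega> \<longleftrightarrow>
     open \<Omega> \<and> connected \<Omega> \<and> \<Omega> \<noteq> {} \<and> bounded \<Omega> \<and> smooth_boundary \<Omega>"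

definition elliptic_matrix :: "(real^'n) set \<Rightarrow> (real^'n \<Rightarrow> real^'n^'n) \<Rightarrow> bool" where
  "elliptic_matrix \<Omega> A \<longleftrightarrow>
     (\<forall>i j. smooth_upto \<Omega> (closure \<Omega>) (\<lambda>x. A x $ i $ j)) \<and>
     (\<forall>x\<in>closure \<Omega>. transpose (A x) = A x) \<and>
     (\<exists>\<theta>>0. \<forall>x\<in>closure \<Omega>. \<forall>\<xi>. (A x *v \<xi>) \<bullet> \<xi> \<ge> \<theta> * (norm \<xi>)\<^sup>2)"

text \<open>\<open>normsq_A A x \<xi>\<close> is \<open>|\<xi>|\<^sub>A\<^sup>2\<close> at the point \<open>x\<close>.\<close>

definition normsq_A :: "(real^'n \<Rightarrow> real^'n^'n) \<Rightarrow> real^'n \<Rightarrow> real^'n \<Rightarrow> real" where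
  "normsq_A A x \<xi> = (A x *v \<xi>) \<bullet> \<xi>"

definition L_op :: "(real^'n \<Rightarrow> real^'n^'n) \<Rightarrow> (real^'n \<Rightarrow> real) \<Rightarrow> real^'n \<Rightarrow> real" where
  "L_op A \<phi> x = - divergence (\<lambda>y. A y *v grad \<phi> y) x"


section \<open>Test functions, weak gradients and Sobolev spaces\<close>

definition test_fun :: "(real^'n) set \<Rightarrow> (real^'n \<Rightarrow> real) \<Rightarrow> bool" where
  "test_fun \<Omega> \<phi> \<longleftrightarrow>
     smooth_on UNIV \<phi> \<and> compact (closure {x. \<phi> x \<noteq> 0}) \<and> closure {x. \<phi> x \<noteq> 0} \<subseteq> \<Omega>"

definition loc_integrable :: "(real^'n) set \<Rightarrow> (real^'n \<Rightarrow> real) \<Rightarrow> bool" where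
  "loc_integrable \<Omega> u \<longleftrightarrow> (\<forall>C. compact C \<and> C \<subseteq> \<Omega> \<longrightarrow> integrable (lebesgue_on C) u)"

definition weak_grad :: "(real^'n) set \<Rightarrow> (real^'n \<Rightarrow> real) \<Rightarrow> (real^'n \<Rightarrow> real^'n) \<Rightarrow> bool" where
  "weak_grad \<Omega> u G \<longleftrightarrow>
     loc_integrable \<Omega> u \<and> (\<forall>i. loc_integrable \<Omega> (\<lambda>x. G x $ i)) \<and>
     (\<forall>\<phi> i. test_fun \<Omega> \<phi> \<longrightarrow>
        (LINT x|lebesgue_on \<Omega>. u x * grad \<phi> x $ i) = - (LINT x|lebesgue_on \<Omega>. G x $ i * \<phi> x))"

definition L2 :: "(real^'n) set \<Rightarrow> (real^'n \<Rightarrow> real) \<Rightarrow> bool" where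
  "L2 \<Omega> u \<longleftrightarrow>
     u \<in> borel_measurable (lebesgue_on \<Omega>) \<and> integrable (lebesgue_on \<Omega>) (\<lambda>x. (u x)\<^sup>2)"

text \<open>\<open>H\<^sup>1\<^sub>0(\<Omega>)\<close> is the closure of the test functions in \<open>H\<^sup>1(\<Omega>)\<close>.\<close>

definition H1_0 :: "(real^'n) set \<Rightarrow> (real^'n \<Rightarrow> real) set" where
  "H1_0 \<Omega> = {u. L2 \<Omega> u \<and> (\<exists>G. weak_grad \<Omega> u G \<and> (\<forall>i. L2 \<Omega> (\<lambda>x. G x $ i)) \<and>
     (\<exists>\<phi>. (\<forall>k::nat. test_fun \<Omega> (\<phi> k)) \<and>
        (\<lambda>k. LINT x|lebesgue_on \<Omega>. (\<phi> k x - u x)\<^sup>2 + (norm (grad (\<phi> k) x - G x))\<^sup>2)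
          \<longlonglongrightarrow> 0))}"


section \<open>Interior weights\<close>

text \<open>On \<open>real^'n\<close> the \<open>n\<close>-dimensional Hausdorff measure is Lebesgue measure.\<close>

definition has_box_dim :: "(real^'n) set \<Rightarrow> (real^'n) set \<Rightarrow> real \<Rightarrow> bool" where
  "has_box_dim \<Omega> K d \<longleftrightarrow>
     (\<exists>l. ((\<lambda>r. ln (measure lebesgue {x\<in>\<Omega>. infdist x K < r}) / ln r) \<longlongrightarrow> l) (at_right 0) \<and>
          d = real CARD('n) - l)"

definition supp_in :: "'a::topological_space set \<Rightarrow> 'a measure \<Rightarrow> 'a set" where
  "supp_in \<Omega> \<mu> = {x\<in>\<Omega>. \<forall>V. open V \<and> x \<in> V \<longrightarrow> emeasure \<mu> (V \<inter> \<Omega>) > 0}"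

text \<open>\<open>\<L>\<^sub>A(E) = \<mu>\<close> in the sense of distributions; both derivatives are moved to the test function,
  which uses that \<open>A\<close> is symmetric.\<close>

definition distr_L_eq ::
  "(real^'n) set \<Rightarrow> (real^'n \<Rightarrow> real^'n^'n) \<Rightarrow> (real^'n \<Rightarrow> real) \<Rightarrow> (real^'n) measure \<Rightarrow> bool" where
  "distr_L_eq \<Omega> A u \<mu> \<longleftrightarrow> loc_integrable \<Omega> u \<and>
     (\<forall>\<phi>. test_fun \<Omega> \<phi> \<longrightarrow> (LINT x|lebesgue_on \<Omega>. u x * L_op A \<phi> x) = (LINT x|\<mu>. \<phi> x))"

text \<open>
  The weight takes values in the extended reals. The set \<open>K\<close> is Lebesgue null, so mere
  pointwise values on it would carry no information about the distribution \<open>E\<close>; as usual for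
  superharmonic functions, \<open>E = \<infinity>\<close> on \<open>K\<close> includes \<open>E(x) \<rightarrow> \<infinity>\<close> as \<open>x\<close> approaches \<open>K\<close>.
  On the null set \<open>K\<close> the real-valued function \<open>real_of_ereal \<circ> E\<close> has the irrelevant value \<open>0\<close>.
\<close>

definition interior_weight ::
  "(real^'n) set \<Rightarrow> (real^'n \<Rightarrow> real^'n^'n) \<Rightarrow> (real^'n \<Rightarrow> ereal) \<Rightarrow> bool" where
  "interior_weight \<Omega> A E \<longleftrightarrow>
     (\<forall>x\<in>\<Omega>. E x > 0) \<and>
     (\<exists>\<mu> K. sets \<mu> = sets (restrict_space borel \<Omega>) \<and> finite_measure \<mu> \<and> emeasure \<mu> \<Omega> \<noteq> 0 \<and>
        distr_L_eq \<Omega> A (real_of_ereal \<circ> E) \<mu> \<and>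
        K = supp_in \<Omega> \<mu> \<and> compact K \<and>
        (\<forall>x\<in>closure \<Omega> - K. \<bar>E x\<bar> \<noteq> \<infinity>) \<and>
        smooth_upto (\<Omega> - K) (closure \<Omega> - K) (real_of_ereal \<circ> E) \<and>
        (\<forall>x\<in>K. E x = \<infinity> \<and> (E \<longlongrightarrow> \<infinity>) (at x)) \<and>
        (\<exists>d. has_box_dim \<Omega> K d \<and> d < real CARD('n) - 2))"

end

theory Submission
  imports Defs
begin


text \<open>
  Testing \<open>\<L>\<^sub>A(E) = \<mu>\<close> with \<open>T \<circ> E\<close>, where \<open>T' = g\<close> has compact support in \<open>(\<gamma>, \<infinity>)\<close>, gives
  \<open>\<integral> g(E) |\<nabla>E|\<^sub>A\<^sup>2 = \<mu>(\<Omega>) \<integral> g\<close>, since \<open>T \<circ> E\<close> is constant on the support of \<open>\<mu>\<close>. Inserting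
  \<open>u = g \<circ> E\<close> into (i) therefore yields \<open>\<integral> g'\<^sup>2 \<ge> \<integral> V g\<^sup>2\<close> with \<open>V(t) = f(t) + 1/(4t\<^sup>2)\<close>, for all test
  functions \<open>g\<close> on \<open>(\<gamma>, \<infinity>)\<close>. By Jacobi's argument solutions of \<open>y'' = - V y\<close> starting at \<open>p > \<gamma>\<close> with
  \<open>y(p) = 0\<close> have no further zero, and normalised they converge as \<open>p \<rightarrow> \<gamma>\<close> to a positive solution.

  Conversely, with \<open>r = h'/h\<close> the field \<open>\<psi>\<^sup>2 r(E + \<epsilon>) A\<nabla>E\<close> has divergence at most
  \<open>|\<nabla>\<psi>|\<^sub>A\<^sup>2 - V(E + \<epsilon>) |\<nabla>E|\<^sub>A\<^sup>2 \<psi>\<^sup>2\<close>, because \<open>div(A\<nabla>E) = 0\<close> off \<open>K\<close>. This proves (i) for \<open>\<psi>\<close>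
  vanishing near \<open>K\<close>; cutoffs \<open>\<theta>(E/k)\<close> have energy of order \<open>1/k\<close> by the same identity, so \<open>K\<close> is removable.
  The shift \<open>\<epsilon>\<close> makes it unnecessary to know that \<open>E > \<gamma>\<close> inside \<open>\<Omega>\<close>.
\<close>

section \<open>Calculus of \<open>C\<^sup>k\<close> functions\<close>

text \<open>The vector field comes from a completed square. If h'' + V h \<le> 0, then r = h'/h
  satisfies r' + r^2 + V \<le> 0, and |\<nabla>\<psi> - \<psi> r(E) \<nabla>E|^2 \<ge> 0 trades the
  cross term of the divergence for exactly the r^2 that this inequality absorbs. In the other
  direction two obstacles shape the proof. The functions g \<circ> E enter as test functions, so g
  is smooth at first, whereas Jacobi's comparison function has corners; approximation on the line
  bridges the gap. And the solutions starting at p must not degenerate as p \<rightarrow> \<gamma>: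
  the Hardy term 1/(4t^2) makes V strictly positive, so positive solutions are concave, their slopes
  at a fixed point are nonnegative, and Wronskians show that these slopes decrease along the
  sequence. The box dimension enters through \<open>K\<close> being a Lebesgue null set. Integrals
  are extended nonnegative, because the weighted integrals of u^2 are not known to be finite in
  advance; the subtraction becomes legitimate once the gradient energy is known to be
  finite.\<close>

lemma Ck_on_0: "Ck_on 0 U f \<longleftrightarrow> continuous_on U f"
  unfolding Ck_on_def by (auto cong: continuous_on_cong)

lemma Ck_on_Suc:
  "Ck_on (Suc k) U f \<longleftrightarrow> continuous_on U f \<and> (\<forall>x\<in>U. f differentiable (at x)) \<and>
     (\<forall>b\<in>Basis. Ck_on k U (\<lambda>x. frechet_derivative f (at x) b))"
  unfolding Ck_on_def by (auto cong: continuous_on_cong)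

lemma Ck_on_imp_continuous_on: "Ck_on k U f \<Longrightarrow> continuous_on U f"
  by (cases k) (auto simp: Ck_on_0 Ck_on_Suc)

lemma Ck_on_SucI:
  assumes "\<And>x. x \<in> U \<Longrightarrow> f differentiable (at x)"
    and "\<And>b. b \<in> Basis \<Longrightarrow> Ck_on k U (\<lambda>x. frechet_derivative f (at x) b)"
  shows "Ck_on (Suc k) U f"
  using assms unfolding Ck_on_Suc
  by (meson continuous_at_imp_continuous_on differentiable_imp_continuous_within)

text \<open>\<open>frechet_derivative\<close> is a choice operator, so it is enough that both
  functions admit the same derivatives at \<open>x\<close>; this also covers points where neither is
  differentiable.\<close>

lemma frechet_derivative_cong_open:
  assumes "open U" "\<And>x. x \<in> U \<Longrightarrow> f x = g x" "x \<in> U"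
  shows "frechet_derivative f (at x) = frechet_derivative g (at x)"
    and "f differentiable (at x) \<longleftrightarrow> g differentiable (at x)"
proof -
  have "(f has_derivative D) (at x) \<longleftrightarrow> (g has_derivative D) (at x)" for D
    using assms has_derivative_transform_within_open[of f D x UNIV U g]
      has_derivative_transform_within_open[of g D x UNIV U f] by auto
  then show "frechet_derivative f (at x) = frechet_derivative g (at x)"
    "f differentiable (at x) \<longleftrightarrow> g differentiable (at x)"
    unfolding frechet_derivative_def differentiable_def by auto
qed

lemma Ck_on_cong:
  assumes "open U" "\<And>x. x \<in> U \<Longrightarrow> f x = g x" "Ck_on k U f"
  shows "Ck_on k U g"
  using assms(2,3)
proof (induction k arbitrary: f g)
  case 0
  then show ?case by (auto simp: Ck_on_0 cong: continuous_on_cong)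
next
  case (Suc k)
  have fd: "frechet_derivative f (at x) = frechet_derivative g (at x)"
    "f differentiable (at x) \<longleftrightarrow> g differentiable (at x)" if "x \<in> U" for x
    using frechet_derivative_cong_open[of U f g x] assms(1) Suc.prems(1) that by auto
  show ?case
  proof (rule Ck_on_SucI)
    show "g differentiable (at x)" if "x \<in> U" for x
      using fd(2)[OF that] Suc.prems(2) that by (simp add: Ck_on_Suc)
    show "Ck_on k U (\<lambda>x. frechet_derivative g (at x) b)" if "b \<in> Basis" for b
      by (rule Suc.IH[where f = "\<lambda>x. frechet_derivative f (at x) b"])
        (use fd(1) Suc.prems(2) that in \<open>auto simp: Ck_on_Suc\<close>)
  qed
qed

lemma Ck_on_subset: "Ck_on k U f \<Longrightarrow> V \<subseteq> U \<Longrightarrow> Ck_on k V f"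
proof (induction k arbitrary: f)
  case 0
  then show ?case by (auto simp: Ck_on_0 intro: continuous_on_subset)
next
  case (Suc k)
  then show ?case by (auto simp: Ck_on_Suc intro: continuous_on_subset)
qed

lemma Ck_on_Un: "open U \<Longrightarrow> open V \<Longrightarrow> Ck_on k U f \<Longrightarrow> Ck_on k V f \<Longrightarrow> Ck_on k (U \<union> V) f"
proof (induction k arbitrary: f)
  case 0
  then show ?case by (auto simp: Ck_on_0 intro: continuous_on_open_Un)
next
  case (Suc k)
  then show ?case by (auto simp: Ck_on_Suc intro: continuous_on_open_Un)
qed

lemma Ck_on_Suc_imp: "Ck_on (Suc k) U f \<Longrightarrow> Ck_on k U f"
proof (induction k arbitrary: f)
  case 0
  then show ?case by (auto simp: Ck_on_0 Ck_on_Suc)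
next
  case (Suc k)
  show ?case
    by (rule Ck_on_SucI) (use Suc in \<open>auto simp: Ck_on_Suc[of "Suc k"]\<close>)
qed

lemma Ck_on_le: "Ck_on m U f \<Longrightarrow> k \<le> m \<Longrightarrow> Ck_on k U f"
  by (induction m) (auto simp: le_Suc_eq dest: Ck_on_Suc_imp)

lemma Ck_on_const [simp]: "Ck_on k U (\<lambda>x. c)"
proof (induction k arbitrary: c)
  case 0
  then show ?case by (auto simp: Ck_on_0)
next
  case (Suc k)
  show ?case by (rule Ck_on_SucI) (auto simp: Suc)
qed

lemma frechet_derivative_add:
  assumes "f differentiable (at x)" "g differentiable (at x)"
  shows "frechet_derivative (\<lambda>x. f x + g x) (at x) b =
    frechet_derivative f (at x) b + frechet_derivative g (at x) b"
  by (subst frechet_derivative_at[OF has_derivative_add[OF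
      assms[unfolded frechet_derivative_works]], symmetric]) (rule refl)

lemma frechet_derivative_mult:
  fixes f g :: "'a::real_normed_vector \<Rightarrow> real"
  assumes "f differentiable (at x)" "g differentiable (at x)"
  shows "frechet_derivative (\<lambda>x. f x * g x) (at x) b =
    f x * frechet_derivative g (at x) b + frechet_derivative f (at x) b * g x"
  by (subst frechet_derivative_at[OF has_derivative_mult[OF
      assms[unfolded frechet_derivative_works]], symmetric]) (rule refl)

lemma Ck_on_add: "open U \<Longrightarrow> Ck_on k U f \<Longrightarrow> Ck_on k U g \<Longrightarrow> Ck_on k U (\<lambda>x. f x + g x)"
proof (induction k arbitrary: f g)
  case 0
  then show ?case by (auto simp: Ck_on_0 intro: continuous_intros)
next
  case (Suc k)
  show ?case
  proof (rule Ck_on_SucI)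
    fix b :: 'a assume b: "b \<in> Basis"
    show "Ck_on k U (\<lambda>x. frechet_derivative (\<lambda>x. f x + g x) (at x) b)"
      by (rule Ck_on_cong[OF Suc.prems(1) _ Suc.IH])
        (use Suc.prems b in \<open>auto simp: Ck_on_Suc frechet_derivative_add\<close>)
  qed (use Suc.prems in \<open>auto simp: Ck_on_Suc\<close>)
qed

lemma Ck_on_mult: "open U \<Longrightarrow> Ck_on k U f \<Longrightarrow> Ck_on k U g \<Longrightarrow> Ck_on k U (\<lambda>x. f x * g x)"
proof (induction k arbitrary: f g)
  case 0
  then show ?case by (auto simp: Ck_on_0 intro: continuous_intros)
next
  case (Suc k)
  have k: "Ck_on k U f" "Ck_on k U g" using Suc.prems Ck_on_Suc_imp by auto
  show ?case
  proof (rule Ck_on_SucI)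
    fix b :: 'a assume b: "b \<in> Basis"
    show "Ck_on k U (\<lambda>x. frechet_derivative (\<lambda>x. f x * g x) (at x) b)"
    proof (rule Ck_on_cong[OF Suc.prems(1)])
      show "Ck_on k U (\<lambda>x. f x * frechet_derivative g (at x) b + frechet_derivative f (at x) b * g x)"
        by (intro Ck_on_add Suc.IH) (use Suc.prems b k in \<open>auto simp: Ck_on_Suc\<close>)
    qed (use Suc.prems in \<open>auto simp: Ck_on_Suc frechet_derivative_mult\<close>)
  qed (use Suc.prems in \<open>auto simp: Ck_on_Suc\<close>)
qed

lemma Ck_on_minus: "open U \<Longrightarrow> Ck_on k U f \<Longrightarrow> Ck_on k U (\<lambda>x. - f x)"
  using Ck_on_mult[of U k "\<lambda>x. -1" f] by simp

lemma Ck_on_diff: "open U \<Longrightarrow> Ck_on k U f \<Longrightarrow> Ck_on k U g \<Longrightarrow> Ck_on k U (\<lambda>x. f x - g x)"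
  using Ck_on_add[of U k f "\<lambda>x. - g x"] Ck_on_minus by auto

lemma Ck_on_power: "open U \<Longrightarrow> Ck_on k U f \<Longrightarrow> Ck_on k U (\<lambda>x. f x ^ m)"
  by (induction m) (auto intro: Ck_on_mult)

lemma Ck_on_sum: "open U \<Longrightarrow> (\<And>i. i \<in> I \<Longrightarrow> Ck_on k U (f i)) \<Longrightarrow> Ck_on k U (\<lambda>x. \<Sum>i\<in>I. f i x)"
  by (induction I rule: infinite_finite_induct) (auto intro: Ck_on_add)

lemma Ck_on_prod: "open U \<Longrightarrow> (\<And>i. i \<in> I \<Longrightarrow> Ck_on k U (f i)) \<Longrightarrow> Ck_on k U (\<lambda>x. \<Prod>i\<in>I. f i x)"
  by (induction I rule: infinite_finite_induct) (auto intro: Ck_on_mult)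

lemma Ck_on_bounded_linear: "bounded_linear f \<Longrightarrow> Ck_on k U f"
proof (cases k)
  case 0
  assume "bounded_linear f"
  then show ?thesis using 0 by (auto simp: Ck_on_0 linear_continuous_on)
next
  case (Suc m)
  assume f: "bounded_linear f"
  have "frechet_derivative f (at x) = f" for x
    using frechet_derivative_at bounded_linear_imp_has_derivative[OF f] by metis
  then show ?thesis unfolding Suc
    by (intro Ck_on_SucI) (use f bounded_linear_imp_differentiable in auto)
qed

lemma Ck_on_vec_nth: "Ck_on k U (\<lambda>x::real^'n. x $ i)"
  by (rule Ck_on_bounded_linear) (rule bounded_linear_vec_nth)

lemma Ck_on_id: "Ck_on k U (\<lambda>x::real. x)"
  by (rule Ck_on_bounded_linear) (rule bounded_linear_ident)

lemma frechet_derivative_compose_real: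
  fixes g :: "'a::real_normed_vector \<Rightarrow> real" and f :: "real \<Rightarrow> real"
  assumes "f differentiable (at (g x))" "g differentiable (at x)"
  shows "frechet_derivative (\<lambda>x. f (g x)) (at x) b =
    frechet_derivative f (at (g x)) 1 * frechet_derivative g (at x) b"
    and "(\<lambda>x. f (g x)) differentiable (at x)"
proof -
  let ?F = "frechet_derivative f (at (g x))" and ?G = "frechet_derivative g (at x)"
  have d: "((\<lambda>x. f (g x)) has_derivative (?F \<circ> ?G)) (at x)"
    using diff_chain_at[of g ?G x f ?F] assms unfolding frechet_derivative_works o_def by auto
  have "?F (?G b *\<^sub>R 1) = ?G b *\<^sub>R ?F 1"
    by (rule linear_cmul[OF linear_frechet_derivative[OF assms(1)]])
  then show "frechet_derivative (\<lambda>x. f (g x)) (at x) b = ?F 1 * ?G b"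
    by (simp add: mult.commute flip: frechet_derivative_at[OF d])
  show "(\<lambda>x. f (g x)) differentiable (at x)" using d by (rule differentiableI)
qed

lemma Ck_on_compose:
  fixes f :: "real \<Rightarrow> real"
  shows "open U \<Longrightarrow> Ck_on k V f \<Longrightarrow> Ck_on k U g \<Longrightarrow> (\<And>x. x \<in> U \<Longrightarrow> g x \<in> V) \<Longrightarrow>
    Ck_on k U (\<lambda>x. f (g x))"
proof (induction k arbitrary: f g)
  case 0
  then show ?case
    by (auto simp: Ck_on_0 image_subset_iff intro: continuous_on_compose2[of V f U g])
next
  case (Suc k)
  have k: "Ck_on k U g" using Suc.prems Ck_on_Suc_imp by auto
  have d: "f differentiable (at (g x))" "g differentiable (at x)" if "x \<in> U" for x
    using Suc.prems that by (auto simp: Ck_on_Suc)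
  show ?case
  proof (rule Ck_on_SucI)
    fix b :: 'a assume b: "b \<in> Basis"
    show "Ck_on k U (\<lambda>x. frechet_derivative (\<lambda>x. f (g x)) (at x) b)"
    proof (rule Ck_on_cong[OF Suc.prems(1)])
      show "Ck_on k U (\<lambda>x. frechet_derivative f (at (g x)) 1 * frechet_derivative g (at x) b)"
        by (intro Ck_on_mult Suc.IH[where f = "\<lambda>t. frechet_derivative f (at t) 1"])
          (use Suc.prems k b in \<open>auto simp: Ck_on_Suc\<close>)
    qed (simp add: frechet_derivative_compose_real d)
  qed (simp add: frechet_derivative_compose_real d)
qed

lemma frechet_derivative_real:
  "(f has_real_derivative D) (at x) \<Longrightarrow> frechet_derivative f (at x) = (\<lambda>h. D * h)"
  using frechet_derivative_at has_field_derivative_def by metis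

lemma deriv_eq_frechet_derivative:
  fixes f :: "real \<Rightarrow> real"
  assumes "f differentiable (at x)"
  shows "deriv f x = frechet_derivative f (at x) 1"
    and "(f has_real_derivative deriv f x) (at x)"
proof -
  obtain D where D: "(f has_real_derivative D) (at x)"
    using assms real_differentiable_def by blast
  then show "deriv f x = frechet_derivative f (at x) 1"
    by (simp add: DERIV_imp_deriv frechet_derivative_real)
  show "(f has_real_derivative deriv f x) (at x)"
    using D by (simp add: DERIV_imp_deriv)
qed

lemma Ck_on_SucI_real:
  fixes f :: "real \<Rightarrow> real"
  assumes "open U" "\<And>x. x \<in> U \<Longrightarrow> (f has_real_derivative f' x) (at x)" "Ck_on k U f'"
  shows "Ck_on (Suc k) U f"
proof (rule Ck_on_SucI)
  fix b :: real assume "b \<in> Basis"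
  then show "Ck_on k U (\<lambda>x. frechet_derivative f (at x) b)"
    by (intro Ck_on_cong[OF assms(1) _ assms(3)]) (simp add: frechet_derivative_real[OF assms(2)])
qed (use assms(2) real_differentiable_def in blast)

lemma Ck_on_SucD_real:
  fixes f :: "real \<Rightarrow> real"
  assumes "open U" "Ck_on (Suc k) U f"
  shows "\<And>x. x \<in> U \<Longrightarrow> (f has_real_derivative deriv f x) (at x)" "Ck_on k U (deriv f)"
proof -
  have d: "f differentiable (at x)" if "x \<in> U" for x using assms that by (auto simp: Ck_on_Suc)
  show "\<And>x. x \<in> U \<Longrightarrow> (f has_real_derivative deriv f x) (at x)"
    using deriv_eq_frechet_derivative(2) d by blast
  show "Ck_on k U (deriv f)"
    by (rule Ck_on_cong[of _ "\<lambda>x. frechet_derivative f (at x) 1"])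
      (use assms deriv_eq_frechet_derivative(1) d in \<open>auto simp: Ck_on_Suc\<close>)
qed

lemma deriv_eq_0_outside:
  fixes g :: "real \<Rightarrow> real"
  assumes "closed L" "\<And>s. s \<notin> L \<Longrightarrow> g s = 0" "s \<notin> L"
  shows "deriv g s = 0"
proof -
  have "((\<lambda>_. 0) has_real_derivative 0) (at s)" by simp
  then have "(g has_real_derivative 0) (at s)"
    by (rule has_field_derivative_transform_within_open[of _ _ _ "- L"]) (use assms in auto)
  then show ?thesis by (rule DERIV_imp_deriv)
qed

text \<open>The derivative is a polynomial in \<open>inverse\<close> itself, which closes the
  induction on \<open>k\<close>.\<close>

lemma Ck_on_inverse: "Ck_on k (- {0::real}) inverse"
proof (induction k)
  case 0
  then show ?case by (auto simp: Ck_on_0 intro!: continuous_intros)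
next
  case (Suc k)
  show ?case
  proof (rule Ck_on_SucI_real)
    show "Ck_on k (- {0::real}) (\<lambda>x. - (inverse x * inverse x))"
      by (intro Ck_on_minus Ck_on_mult Suc) auto
    show "(inverse has_real_derivative - (inverse x * inverse x)) (at x)" if "x \<in> - {0}" for x :: real
      using DERIV_inverse[of x UNIV] that by (auto simp: power2_eq_square)
  qed auto
qed

lemma Ck_on_divide:
  "open U \<Longrightarrow> Ck_on k U f \<Longrightarrow> Ck_on k U g \<Longrightarrow> (\<And>x. x \<in> U \<Longrightarrow> g x \<noteq> 0) \<Longrightarrow> Ck_on k U (\<lambda>x. f x / g x)"
  unfolding divide_inverse by (intro Ck_on_mult Ck_on_compose[OF _ Ck_on_inverse]) auto

lemma Ck_on_exp: "Ck_on k UNIV (exp :: real \<Rightarrow> real)"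
proof (induction k)
  case (Suc k)
  show ?case by (rule Ck_on_SucI_real[OF _ _ Suc]) (auto intro: DERIV_exp)
qed (auto simp: Ck_on_0 intro: continuous_intros)

lemma Ck_on_real_polynomial_function:
  fixes p :: "real \<Rightarrow> real"
  assumes "real_polynomial_function p"
  shows "Ck_on k UNIV p"
  using assms by induction (auto intro: Ck_on_bounded_linear Ck_on_add Ck_on_mult)

section \<open>Smooth bumps\<close>

text \<open>For m = 0 this is the classical flat function exp(-1/x). The extra powers of 1/x make
  the span of the family closed under differentiation, so that C^k is proved for all members at
  once.\<close>

definition flat_fun :: "nat \<Rightarrow> real \<Rightarrow> real" where
  "flat_fun m x = (if x \<le> 0 then 0 else (1 / x) ^ m * exp (- (1 / x)))"

lemma flat_fun_tendsto_0: "(flat_fun m \<longlongrightarrow> 0) (at 0)"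
proof -
  have "((\<lambda>x. (1 / x) ^ m / exp (1 / x)) \<longlongrightarrow> (0::real)) (at_right 0)"
    using tendsto_power_div_exp_0[of m] filterlim_compose filterlim_inverse_at_top_right
    by (simp add: filterlim_compose[OF tendsto_power_div_exp_0 filterlim_inverse_at_top_right] divide_inverse)
  then have r: "(flat_fun m \<longlongrightarrow> 0) (at_right 0)"
    by (rule Lim_transform_eventually)
      (auto simp: flat_fun_def exp_minus field_simps eventually_at intro: exI[of _ 1])
  have l: "(flat_fun m \<longlongrightarrow> 0) (at_left 0)"
    by (rule Lim_transform_eventually[OF tendsto_const])
      (auto simp: flat_fun_def eventually_at intro: exI[of _ 1])
  show ?thesis using filterlim_split_at[OF l r] .
qed

lemma flat_fun_deriv:
  "(flat_fun m has_real_derivative flat_fun (m + 2) x - real m * flat_fun (m + 1) x) (at x)"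
proof -
  consider "x < 0" | "x = 0" | "x > 0" by linarith
  then show ?thesis
  proof cases
    case 1
    have "((\<lambda>x. 0) has_real_derivative 0) (at x)" by simp
    then have "(flat_fun m has_real_derivative 0) (at x)"
      by (rule has_field_derivative_transform_within_open[of _ _ _ "{..<0}"])
        (use 1 in \<open>auto simp: flat_fun_def\<close>)
    then show ?thesis using 1 by (simp add: flat_fun_def)
  next
    case 2
    \<comment> \<open>At 0 the difference quotient is the next member of the family, whose limit is
      already known.\<close>
    have "flat_fun m h / h = flat_fun (Suc m) h" if "h \<noteq> 0" for h
      using that by (auto simp: flat_fun_def)
    then have "((\<lambda>h. flat_fun m h / h) \<longlongrightarrow> 0) (at 0)"
      by (intro Lim_transform_eventually[OF flat_fun_tendsto_0[of "Suc m"]])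
        (auto simp: eventually_at intro!: exI[of _ 1])
    then show ?thesis using 2 by (simp add: DERIV_def flat_fun_def)
  next
    case 3
    have "((\<lambda>x. (1 / x) ^ m * exp (- (1 / x))) has_real_derivative
        flat_fun (m + 2) x - real m * flat_fun (m + 1) x) (at x)"
    proof -
      have i: "((\<lambda>x. 1 / x) has_real_derivative - ((1 / x) ^ 2)) (at x)"
        using DERIV_inverse[of x UNIV] 3 by (simp add: divide_inverse power2_eq_square)
      define y where "y = 1 / x"
      have f: "flat_fun k x = y ^ k * exp (- y)" for k using 3 by (simp add: flat_fun_def y_def)
      show ?thesis unfolding f
        using DERIV_mult[OF DERIV_power[OF i, of m] DERIV_fun_exp[OF DERIV_minus[OF i]]]
        by (rule DERIV_cong) (fold y_def, cases m, auto simp: algebra_simps power2_eq_square)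
    qed
    then show ?thesis
      by (rule has_field_derivative_transform_within_open[of _ _ _ "{0<..}"])
        (use 3 in \<open>auto simp: flat_fun_def\<close>)
  qed
qed

lemma Ck_on_flat_fun: "Ck_on k UNIV (flat_fun m)"
proof (induction k arbitrary: m)
  case 0
  have "continuous_on UNIV (flat_fun m)"
    by (rule DERIV_continuous_on[OF flat_fun_deriv])
  then show ?case by (simp add: Ck_on_0)
next
  case (Suc k)
  show ?case
    by (rule Ck_on_SucI_real[OF _ flat_fun_deriv]) (auto intro!: Ck_on_diff Ck_on_mult Suc)
qed

definition bump :: "real \<Rightarrow> real \<Rightarrow> real \<Rightarrow> real" where
  "bump a b x = flat_fun 0 (x - a) * flat_fun 0 (b - x)"

lemma Ck_on_bump: "Ck_on k UNIV (bump a b)"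
  unfolding bump_def
  by (intro Ck_on_mult Ck_on_compose[OF _ Ck_on_flat_fun] Ck_on_diff Ck_on_id) auto

lemma bump_pos_iff: "bump a b x > 0 \<longleftrightarrow> a < x \<and> x < b"
  and bump_nonneg: "bump a b x \<ge> 0"
  by (auto simp: bump_def flat_fun_def)

text \<open>The two summands of the denominator never vanish together. Dividing by their sum makes
  the values exactly 0 left of 0 and exactly 1 right of 1.\<close>

definition smooth_step :: "real \<Rightarrow> real" where
  "smooth_step x = flat_fun 0 x / (flat_fun 0 x + flat_fun 0 (1 - x))"

lemma Ck_on_smooth_step: "Ck_on k UNIV smooth_step"
proof -
  have "flat_fun 0 x + flat_fun 0 (1 - x) \<noteq> 0" for x
    using add_pos_pos[OF exp_gt_zero exp_gt_zero, of "- (1 / x)" "- (1 / (1 - x))"]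
    by (auto simp: flat_fun_def)
  then show ?thesis unfolding smooth_step_def
    by (intro Ck_on_divide Ck_on_add Ck_on_flat_fun Ck_on_compose[OF _ Ck_on_flat_fun] Ck_on_diff Ck_on_id) auto
qed

lemma smooth_step_simps: "x \<le> 0 \<Longrightarrow> smooth_step x = 0" "x \<ge> 1 \<Longrightarrow> smooth_step x = 1"
  by (auto simp: smooth_step_def flat_fun_def)

lemma smooth_step_bounds: "0 \<le> smooth_step x" "smooth_step x \<le> 1"
proof -
  have *: "0 \<le> a / (a + b) \<and> a / (a + b) \<le> 1" if "0 \<le> a" "0 \<le> b" for a b :: real
    using that by (simp add: divide_le_eq_1) linarith
  show "0 \<le> smooth_step x" "smooth_step x \<le> 1"
    unfolding smooth_step_def by (simp_all add: * flat_fun_def)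
qed

lemma smooth_plateau:
  fixes a b c d :: real
  assumes "a < b" "b \<le> c" "c < d"
  obtains \<phi> where "\<And>k. Ck_on k UNIV \<phi>" "\<And>x. 0 \<le> \<phi> x" "\<And>x. \<phi> x \<le> 1"
    "\<And>x. x \<in> {b..c} \<Longrightarrow> \<phi> x = 1" "\<And>x. x \<notin> {a..d} \<Longrightarrow> \<phi> x = 0"
proof
  let ?\<phi> = "\<lambda>x. smooth_step ((x - a) / (b - a)) * smooth_step ((d - x) / (d - c))"
  show "Ck_on k UNIV ?\<phi>" for k
    by (intro Ck_on_mult Ck_on_compose[OF _ Ck_on_smooth_step] Ck_on_divide Ck_on_diff Ck_on_id)
      (use assms in auto)
  show "0 \<le> ?\<phi> x" "?\<phi> x \<le> 1" for x
    by (auto intro!: mult_nonneg_nonneg mult_le_one smooth_step_bounds)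
  show "?\<phi> x = 1" if "x \<in> {b..c}" for x
    using that assms by (auto simp: smooth_step_simps)
  show "?\<phi> x = 0" if "x \<notin> {a..d}" for x
    using that assms by (auto simp: smooth_step_simps divide_nonpos_pos)
qed

section \<open>Integration by parts and the fundamental lemma\<close>

lemma integrable_compact_support:
  fixes f :: "'a::euclidean_space \<Rightarrow> real"
  assumes "continuous_on UNIV f" "compact L" "\<And>x. x \<notin> L \<Longrightarrow> f x = 0"
  shows "integrable lborel f"
proof -
  have "integrable lborel (\<lambda>x. indicator L x *\<^sub>R f x)"
    by (rule borel_integrable_compact[OF assms(2) continuous_on_subset[OF assms(1)]]) simp
  moreover have "(\<lambda>x. indicator L x *\<^sub>R f x) = f" using assms(3) by (auto simp: indicator_def fun_eq_iff)
  ultimately show ?thesis by simp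
qed

lemma bounded_compact_support:
  fixes f :: "'a::euclidean_space \<Rightarrow> real"
  assumes "continuous_on UNIV f" "compact L" "\<And>x. x \<notin> L \<Longrightarrow> f x = 0"
  obtains M where "M \<ge> 0" "\<And>x. \<bar>f x\<bar> \<le> M"
proof -
  have "bounded (f ` L)"
    using assms compact_continuous_image continuous_on_subset compact_imp_bounded by blast
  then obtain M where "M > 0" "\<And>x. x \<in> L \<Longrightarrow> \<bar>f x\<bar> \<le> M"
    unfolding bounded_pos by auto
  then show ?thesis using that[of M] assms(3) by (metis abs_zero less_le_not_le)
qed

lemma frechet_derivative_eq_0_outside:
  assumes "closed L" "\<And>x. x \<notin> L \<Longrightarrow> f x = 0" "x \<notin> L"
  shows "frechet_derivative f (at x) = (\<lambda>h. 0)"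
  using frechet_derivative_cong_open(1)[of "- L" f "\<lambda>x. 0" x] assms by auto

lemma partial_derivative_line:
  fixes g :: "'a::euclidean_space \<Rightarrow> real"
  assumes "Ck_on 1 UNIV g"
  shows "((\<lambda>s. g (x + s *\<^sub>R b)) has_real_derivative frechet_derivative g (at (x + s *\<^sub>R b)) b) (at s)"
proof -
  have d: "(g has_derivative frechet_derivative g (at y)) (at y)" for y
    using assms by (simp add: Ck_on_Suc frechet_derivative_works)
  have "((\<lambda>s. x + s *\<^sub>R b) has_derivative (\<lambda>h. h *\<^sub>R b)) (at s)"
    by (auto intro!: derivative_eq_intros)
  from diff_chain_at[OF this d]
  have "((\<lambda>s. g (x + s *\<^sub>R b)) has_derivative
      (\<lambda>h. frechet_derivative g (at (x + s *\<^sub>R b)) (h *\<^sub>R b))) (at s)"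
    by (simp add: o_def)
  moreover have "frechet_derivative g (at (x + s *\<^sub>R b)) (h *\<^sub>R b) =
      frechet_derivative g (at (x + s *\<^sub>R b)) b * h" for h
    using linear_cmul[OF has_derivative_linear[OF d]] by simp
  ultimately show ?thesis by (simp add: has_field_derivative_def)
qed

text \<open>Difference quotients of \<open>g\<close> integrate to zero by translation invariance of
  \<open>lborel\<close>. The mean value theorem bounds them by the maximum of the partial
  derivative, to which they converge, so dominated convergence applies.\<close>

lemma integral_partial_derivative_eq_0:
  fixes g :: "'a::euclidean_space \<Rightarrow> real"
  assumes g: "Ck_on 1 UNIV g" and L: "compact L" "\<And>x. x \<notin> L \<Longrightarrow> g x = 0" and b: "b \<in> Basis"
  shows "integrable lborel (\<lambda>x. frechet_derivative g (at x) b)"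
    and "(LINT x|lborel. frechet_derivative g (at x) b) = 0"
proof -
  let ?p = "\<lambda>x. frechet_derivative g (at x) b"
  have cp: "continuous_on UNIV ?p" using g b by (simp add: Ck_on_Suc Ck_on_0)
  have cg: "continuous_on UNIV g" using g Ck_on_imp_continuous_on by blast
  have p0: "?p x = 0" if "x \<notin> L" for x
    using frechet_derivative_eq_0_outside[OF compact_imp_closed[OF L(1)] L(2) that] by simp
  show "integrable lborel ?p" by (rule integrable_compact_support[OF cp L(1) p0])
  obtain M where M: "M \<ge> 0" "\<And>x. \<bar>?p x\<bar> \<le> M"
    using bounded_compact_support[OF cp L(1) p0] by blast
  define e where "e n = 1 / real (Suc n)" for n
  have e: "0 < e n" "e n \<le> 1" for n by (auto simp: e_def)
  define D where "D n x = (g (x + e n *\<^sub>R b) - g x) / e n" for n x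
  \<comment> \<open>All increments have length at most 1, so this closed unit neighbourhood of
    \<open>L\<close> contains the supports of all quotients and carries the dominating
    function.\<close>
  define L' where "L' = {x + y | x y. x \<in> L \<and> y \<in> cball 0 (1::real)}"
  have L': "compact L'" unfolding L'_def by (rule compact_sums) (use L in auto)
  have D0: "D n x = 0" if "x \<notin> L'" for n x
  proof -
    have "x \<notin> L" using that unfolding L'_def by force
    moreover have "x + e n *\<^sub>R b \<notin> L"
    proof
      assume "x + e n *\<^sub>R b \<in> L"
      then have "(x + e n *\<^sub>R b) + (- (e n *\<^sub>R b)) \<in> L'"
        unfolding L'_def using e[of n] b by (intro CollectI exI[of _ "x + e n *\<^sub>R b"] exI[of _ "- (e n *\<^sub>R b)"] conjI) auto
      then show False using that by simp
    qed
    ultimately show ?thesis using L(2) by (simp add: D_def)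
  qed
  have DM: "\<bar>D n x\<bar> \<le> M" for n x
  proof -
    obtain z where "0 < z" "z < e n" "g (x + e n *\<^sub>R b) - g (x + 0 *\<^sub>R b) = (e n - 0) * ?p (x + z *\<^sub>R b)"
      using MVT2[OF e(1)[of n] partial_derivative_line[OF g, of x b]] by blast
    then have "D n x = ?p (x + z *\<^sub>R b)" using e(1)[of n] by (simp add: D_def)
    then show ?thesis using M(2) by simp
  qed
  have lim: "(\<lambda>n. D n x) \<longlonglongrightarrow> ?p x" for x
  proof -
    have "((\<lambda>h. (g (x + h *\<^sub>R b) - g x) / h) \<longlongrightarrow> ?p x) (at 0)"
      using partial_derivative_line[OF g, of x b 0] by (simp add: DERIV_def)
    moreover have "filterlim e (at 0) sequentially"
      unfolding filterlim_at using LIMSEQ_inverse_real_of_nat e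
      by (auto simp: e_def[abs_def] inverse_eq_divide)
    ultimately show ?thesis unfolding D_def by (rule filterlim_compose)
  qed
  have ig: "integrable lborel g" by (rule integrable_compact_support[OF cg L])
  have Dint: "integrable lborel (D n)" "(LINT x|lborel. D n x) = 0" for n
  proof -
    have [measurable]: "g \<in> borel_measurable borel" using cg by (rule borel_measurable_continuous_onI)
    have t: "(LINT x|lborel. g (e n *\<^sub>R b + x)) = (LINT x|lborel. g x)"
      by (subst (2) lborel_distr_plus[of "e n *\<^sub>R b", symmetric], subst integral_distr) auto
    have "integrable (distr lborel borel ((+) (e n *\<^sub>R b))) g"
      using ig by (simp add: lborel_distr_plus)
    then have i: "integrable lborel (\<lambda>x. g (e n *\<^sub>R b + x))"
      by (subst (asm) integrable_distr_eq) auto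
    show "integrable lborel (D n)" unfolding D_def using ig i by (auto simp: add.commute)
    show "(LINT x|lborel. D n x) = 0"
      unfolding D_def using ig i t by (simp add: add.commute)
  qed
  have "(\<lambda>n. LINT x|lborel. D n x) \<longlonglongrightarrow> (LINT x|lborel. ?p x)"
  proof (rule integral_dominated_convergence)
    show "integrable lborel (\<lambda>x. M * indicator L' x)"
      using emeasure_compact_finite[OF L'] borel_compact[OF L']
      by (intro integrable_mult_right integrable_real_indicator) auto
    show "AE x in lborel. norm (D n x) \<le> M * indicator L' x" for n
      using D0 DM by (auto simp: indicator_def)
  qed (use Dint lim cp in \<open>auto intro: borel_measurable_continuous_onI\<close>)
  then show "(LINT x|lborel. ?p x) = 0" by (simp add: Dint(2) LIMSEQ_const_iff)
qed

text \<open>The definitions integrate over \<open>lebesgue_on\<close>, while translation invariance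
  was exploited on \<open>lborel\<close>; for Borel integrands one may pass freely between the
  two.\<close>

lemma integral_lebesgue_on_eq_lborel:
  fixes f :: "'a::euclidean_space \<Rightarrow> real"
  assumes "f \<in> borel_measurable borel" "S \<in> sets lebesgue" "\<And>x. x \<notin> S \<Longrightarrow> f x = 0"
  shows "(LINT x|lebesgue_on S. f x) = (LINT x|lborel. f x)"
    and "integrable (lebesgue_on S) f \<longleftrightarrow> integrable lborel f"
proof -
  have e: "(\<lambda>x. indicator S x *\<^sub>R f x) = f" using assms(3) by (auto simp: indicator_def fun_eq_iff)
  have "(LINT x|lebesgue_on S. f x) = (LINT x|lebesgue. f x)"
    using assms(2) using integral_restrict_space[of S lebesgue f] by (simp add: e[simplified])
  then show "(LINT x|lebesgue_on S. f x) = (LINT x|lborel. f x)"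
    using assms(1) by (simp add: integral_completion)
  have "integrable (lebesgue_on S) f \<longleftrightarrow> integrable lebesgue f"
    using assms(2) integrable_restrict_space[of S lebesgue f] by (simp add: e[simplified])
  then show "integrable (lebesgue_on S) f \<longleftrightarrow> integrable lborel f"
    using assms(1) by (simp add: integrable_completion)
qed

lemma test_fun_compact_support:
  assumes "\<And>k. Ck_on k UNIV \<phi>" "compact L" "L \<subseteq> U" "\<And>x. x \<notin> L \<Longrightarrow> \<phi> x = 0"
  shows "test_fun U \<phi>"
proof -
  have "closure {x. \<phi> x \<noteq> 0} \<subseteq> L"
    by (rule closure_minimal) (use assms compact_imp_closed in auto)
  then show ?thesis unfolding test_fun_def smooth_on_def
    using assms by (auto simp: compact_eq_bounded_closed intro: bounded_subset)
qed

text \<open>Bumps \<open>1 - exp (- n \<Phi>)\<close>, with \<open>\<Phi>\<close> positive exactly on the box, increase to its indicator.\<close>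

lemma box_indicator_limit:
  fixes a b :: "real^'n"
  obtains \<phi> where "\<And>n k. Ck_on k UNIV (\<phi> n)" "\<And>n x. x \<notin> cbox a b \<Longrightarrow> \<phi> n x = 0"
    "\<And>n x. 0 \<le> \<phi> n x" "\<And>n x. \<phi> n x \<le> (1::real)"
    "\<And>x. (\<lambda>n. \<phi> n x) \<longlonglongrightarrow> indicator (box a b) x"
proof
  define \<Phi> where "\<Phi> x = (\<Prod>i\<in>UNIV. bump (a $ i) (b $ i) (x $ i))" for x :: "real^'n"
  define \<phi> where "\<phi> n x = 1 - exp (- real n * \<Phi> x)" for n :: nat and x :: "real^'n"
  have \<Phi>: "Ck_on k UNIV \<Phi>" for k
    unfolding \<Phi>_def by (intro Ck_on_prod Ck_on_compose[OF _ Ck_on_bump] Ck_on_vec_nth) auto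
  have nn: "\<Phi> x \<ge> 0" for x unfolding \<Phi>_def by (intro prod_nonneg) (auto intro: bump_nonneg)
  have in_box: "x \<in> box a b \<longleftrightarrow> \<Phi> x > 0" for x
  proof
    assume "x \<in> box a b"
    then show "\<Phi> x > 0" unfolding \<Phi>_def by (intro prod_pos) (auto simp: mem_box_cart bump_pos_iff)
  next
    assume "\<Phi> x > 0"
    then have "bump (a $ i) (b $ i) (x $ i) \<noteq> 0" for i
      unfolding \<Phi>_def using prod_zero[of UNIV] by (metis UNIV_I finite less_irrefl)
    then show "x \<in> box a b" unfolding mem_box_cart
      using bump_pos_iff bump_nonneg by (metis less_eq_real_def)
  qed
  show "Ck_on k UNIV (\<phi> n)" for n k
    unfolding \<phi>_def by (intro Ck_on_diff Ck_on_compose[OF _ Ck_on_exp] Ck_on_mult \<Phi>) auto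
  show "\<phi> n x = 0" if "x \<notin> cbox a b" for n x
    using that in_box[of x] nn[of x] box_subset_cbox[of a b] by (auto simp: \<phi>_def)
  show "0 \<le> \<phi> n x" "\<phi> n x \<le> 1" for n x
    using nn[of x] by (auto simp: \<phi>_def)
  show "(\<lambda>n. \<phi> n x) \<longlonglongrightarrow> indicator (box a b) x" for x
  proof (cases "x \<in> box a b")
    case True
    have "(\<lambda>n. exp (- \<Phi> x) ^ n) \<longlonglongrightarrow> 0"
      using True in_box[of x] by (intro LIMSEQ_power_zero) simp
    then have "(\<lambda>n. exp (- real n * \<Phi> x)) \<longlonglongrightarrow> 0"
      by (simp flip: exp_of_nat_mult)
    then have "(\<lambda>n. \<phi> n x) \<longlonglongrightarrow> 1 - 0" unfolding \<phi>_def by (intro tendsto_diff tendsto_const)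
    then show ?thesis using True by simp
  next
    case False
    then have "\<Phi> x = 0" using in_box[of x] nn[of x] by linarith
    then show ?thesis using False by (simp add: \<phi>_def)
  qed
qed

text \<open>Boxes are an intersection-stable generator of the Borel sets, and the sets over which
  \<open>f\<close> integrates to zero are closed under complements and countable disjoint
  unions.\<close>

lemma AE_0_of_box_integrals:
  fixes f :: "'a::euclidean_space \<Rightarrow> real"
  assumes f: "integrable lborel f" and box: "\<And>a b. (LINT x|lborel. indicator (box a b) x * f x) = 0"
  shows "AE x in lborel. f x = 0"
proof (rule sigma_finite_measure.density_zero[OF sigma_finite_lborel f])
  fix A :: "'a set" assume "A \<in> sets lborel"
  then have A: "A \<in> sigma_sets UNIV (range (\<lambda>(a, b). box a b))" by (simp add: borel_eq_box)
  \<comment> \<open>The complement step needs the integral over the whole space, which is no box but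
    is exhausted by growing cubes.\<close>
  have U: "(LINT x|lborel. f x) = 0"
  proof -
    have "(\<lambda>n. LINT x|lborel. indicator (box (- (real n *\<^sub>R One)) (real n *\<^sub>R One)) x * f x)
        \<longlonglongrightarrow> (LINT x|lborel. f x)"
    proof (rule integral_dominated_convergence[where w = "\<lambda>x. \<bar>f x\<bar>"])
      have "\<forall>\<^sub>F n in sequentially. indicator (box (- (real n *\<^sub>R One)) (real n *\<^sub>R One)) x * f x = f x" for x
      proof -
        obtain N :: nat where N: "real N > norm x" using reals_Archimedean2 by blast
        have "x \<in> box (- (real n *\<^sub>R One)) (real n *\<^sub>R One)" if "n \<ge> N" for n
          unfolding mem_box
        proof (intro ballI)
          fix i :: 'a assume i: "i \<in> Basis"
          have "\<bar>x \<bullet> i\<bar> < real n" using Basis_le_norm[OF i, of x] N that by linarith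
          then show "- (real n *\<^sub>R One) \<bullet> i < x \<bullet> i \<and> x \<bullet> i < real n *\<^sub>R One \<bullet> i" using i by auto
        qed
        then show ?thesis by (auto simp: eventually_sequentially intro!: exI[of _ N])
      qed
      then show "AE x in lborel. (\<lambda>n. indicator (box (- (real n *\<^sub>R One)) (real n *\<^sub>R One)) x * f x) \<longlonglongrightarrow> f x"
        by (intro AE_I2 tendsto_eventually)
      show "AE x in lborel. norm (indicator (box (- (real n *\<^sub>R One)) (real n *\<^sub>R One)) x * f x) \<le> \<bar>f x\<bar>" for n
        by (auto simp: indicator_def)
    qed (use f in \<open>auto intro!: borel_measurable_times\<close>)
    then show ?thesis using box by (simp add: LIMSEQ_const_iff)
  qed
  have "Int_stable (range (\<lambda>(a, b). box a b :: 'a set))"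
    by (auto simp: Int_stable_def box_Int_box)
  moreover have "range (\<lambda>(a, b). box a b :: 'a set) \<subseteq> Pow UNIV" by auto
  ultimately show "set_lebesgue_integral lborel A f = 0" using A
  proof (induction rule: sigma_sets_induct_disjoint)
    case (basic A)
    then show ?case using box by (auto simp: set_lebesgue_integral_def)
  next
    case (compl A)
    then have "A \<in> sets lborel" by (simp add: borel_eq_box)
    then have "set_lebesgue_integral lborel UNIV f =
        set_lebesgue_integral lborel A f + set_lebesgue_integral lborel (UNIV - A) f"
      using f by (subst set_integral_Un[symmetric])
        (auto simp: set_integrable_def intro!: integrable_mult_indicator[where f=f, simplified])
    then show ?case using compl U by (simp add: set_lebesgue_integral_def)
  next
    case (union F)
    then have F: "F i \<in> sets lborel" for i by (auto simp: borel_eq_box)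
    have "set_lebesgue_integral lborel (\<Union>i. F i) f = (\<Sum>i. set_lebesgue_integral lborel (F i) f)"
      using union(1) F f
      by (intro lebesgue_integral_countable_add)
        (auto simp: disjoint_family_on_def set_integrable_def intro!: integrable_mult_indicator[where f=f, simplified])
    then show ?case using union by simp
  qed (auto simp: set_lebesgue_integral_def)
qed

lemma continuous_on_imp_loc_integrable:
  assumes "continuous_on U g"
  shows "loc_integrable U g"
  unfolding loc_integrable_def
proof (intro allI impI)
  fix C assume C: "compact C \<and> C \<subseteq> U"
  have "continuous_on C g" using assms C continuous_on_subset by blast
  then have "integrable lborel (\<lambda>x. indicator C x *\<^sub>R g x)"
    using C by (intro borel_integrable_compact) auto
  then have "integrable lebesgue (\<lambda>x. indicator C x *\<^sub>R g x)"
    by (simp add: integrable_completion borel_measurable_integrable[unfolded measurable_lborel1])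
  moreover have "C \<in> sets lebesgue" using C lmeasurable_compact by auto
  ultimately show "integrable (lebesgue_on C) g" by (simp add: integrable_restrict_space)
qed

lemma loc_integrable_times_bounded:
  fixes D :: "real^'n \<Rightarrow> real"
  assumes D: "loc_integrable U D" and L: "compact L" "L \<subseteq> U"
    and g: "g \<in> borel_measurable borel" "\<And>x. \<bar>g x\<bar> \<le> M" "\<And>x. x \<notin> L \<Longrightarrow> g x = 0"
  shows "integrable lebesgue (\<lambda>x. D x * g x)"
proof -
  have "integrable (lebesgue_on L) D" using D L by (auto simp: loc_integrable_def)
  moreover have [measurable]: "L \<in> sets lebesgue" using L(1) lmeasurable_compact by auto
  ultimately have i: "integrable lebesgue (\<lambda>x. indicator L x * D x)"
    by (simp add: integrable_restrict_space)
  have [measurable]: "g \<in> borel_measurable lebesgue" using g(1) by (intro measurable_completion) simp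
  have "integrable lebesgue (\<lambda>x. (indicator L x * D x) * g x)"
  proof (rule Bochner_Integration.integrable_bound)
    show "integrable lebesgue (\<lambda>x. M * (indicator L x * D x))" using i by simp
    show "AE x in lebesgue. norm (indicator L x * D x * g x) \<le> norm (M * (indicator L x * D x))"
    proof (rule AE_I2)
      fix x
      have "\<bar>g x\<bar> \<le> \<bar>M\<bar>" using g(2)[of x] by linarith
      then show "norm (indicator L x * D x * g x) \<le> norm (M * (indicator L x * D x))"
        by (simp add: abs_mult mult.commute mult_right_mono)
    qed
  qed (use i in simp)
  moreover have "(\<lambda>x. (indicator L x * D x) * g x) = (\<lambda>x. D x * g x)"
    using g(3) by (auto simp: indicator_def fun_eq_iff)
  ultimately show ?thesis by simp
qed

text \<open>Fundamental lemma of the calculus of variations. Test functions approximating box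
  indicators show that \<open>D\<close> integrates to zero over boxes lying compactly in
  \<open>U\<close>; hence \<open>D\<close> vanishes almost everywhere on each closed box, and
  \<open>U\<close> is a countable union of those.\<close>

lemma AE_0_of_test_integrals:
  fixes D :: "real^'n \<Rightarrow> real"
  assumes U: "open U" and D: "loc_integrable U D"
    and test: "\<And>\<phi>. test_fun U \<phi> \<Longrightarrow> (LINT x|lebesgue_on U. D x * \<phi> x) = 0"
  shows "AE x in lebesgue_on U. D x = 0"
proof -
  have Ul: "U \<in> sets lebesgue" using U by auto
  have box0: "(LINT x|lebesgue. D x * indicator (box a b) x) = 0" if ab: "cbox a b \<subseteq> U" for a b :: "real^'n"
  proof -
    obtain \<phi> where \<phi>: "\<And>n k. Ck_on k UNIV (\<phi> n)" "\<And>n x. x \<notin> cbox a b \<Longrightarrow> \<phi> n x = 0"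
      "\<And>n x. 0 \<le> \<phi> n x" "\<And>n x. \<phi> n x \<le> (1::real)"
      "\<And>x. (\<lambda>n. \<phi> n x) \<longlonglongrightarrow> indicator (box a b) x"
      using box_indicator_limit[of a b] by blast
    have [measurable]: "\<phi> n \<in> borel_measurable borel" for n
      using \<phi>(1)[of 0] by (intro borel_measurable_continuous_onI) (simp add: Ck_on_0)
    have i: "integrable lebesgue (\<lambda>x. D x * \<phi> n x)" for n
      by (rule loc_integrable_times_bounded[OF D compact_cbox ab, where M = 1])
        (use \<phi>(2-4) in \<open>auto simp: abs_le_iff intro: order_trans[of _ 0]\<close>)
    have ic: "integrable lebesgue (\<lambda>x. D x * indicator (cbox a b) x)"
      by (rule loc_integrable_times_bounded[OF D compact_cbox ab, where M = 1]) auto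
    have ib: "integrable lebesgue (\<lambda>x. D x * indicator (box a b) x)"
      by (rule loc_integrable_times_bounded[OF D compact_cbox ab, where M = 1])
        (use box_subset_cbox in \<open>auto simp: indicator_def\<close>)
    have "test_fun U (\<phi> n)" for n
      by (rule test_fun_compact_support[OF \<phi>(1) compact_cbox ab \<phi>(2)])
    then have "(LINT x|lebesgue_on U. D x * \<phi> n x) = 0" for n by (rule test)
    moreover have "(\<lambda>x. indicator U x * (D x * \<phi> n x)) = (\<lambda>x. D x * \<phi> n x)" for n
      using \<phi>(2) ab by (auto simp: indicator_def fun_eq_iff)
    ultimately have z: "(LINT x|lebesgue. D x * \<phi> n x) = 0" for n
      using integral_restrict_space[of U lebesgue "\<lambda>x. D x * \<phi> n x"] Ul by simp
    have "(\<lambda>n. LINT x|lebesgue. D x * \<phi> n x) \<longlonglongrightarrow> (LINT x|lebesgue. D x * indicator (box a b) x)"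
    proof (rule integral_dominated_convergence)
      show "integrable lebesgue (\<lambda>x. \<bar>D x * indicator (cbox a b) x\<bar>)" using ic by simp
      show "AE x in lebesgue. (\<lambda>n. D x * \<phi> n x) \<longlonglongrightarrow> D x * indicator (box a b) x"
        by (intro AE_I2 tendsto_mult tendsto_const \<phi>(5))
      show "AE x in lebesgue. norm (D x * \<phi> n x) \<le> \<bar>D x * indicator (cbox a b) x\<bar>" for n
        using \<phi>(2-4)[where n=n] by (intro AE_I2) (auto simp: indicator_def abs_mult mult_left_le)
    qed (use i ib in auto)
    then show ?thesis using z by (simp add: LIMSEQ_const_iff)
  qed
  have AEbox: "AE x in lebesgue. x \<in> cbox c d \<longrightarrow> D x = 0" if cd: "cbox c d \<subseteq> U" for c d :: "real^'n"
  proof -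
    let ?f = "\<lambda>x. D x * indicator (box c d) x"
    have i: "integrable lebesgue ?f"
      by (rule loc_integrable_times_bounded[OF D compact_cbox cd, where M = 1])
        (use box_subset_cbox in \<open>auto simp: indicator_def\<close>)
    \<comment> \<open>\<open>D\<close> is only Lebesgue measurable; the argument with generators on
      \<open>lborel\<close> needs a Borel representative.\<close>
    obtain g where g: "g \<in> borel_measurable lborel" "AE x in lborel. ?f x = g x"
      using completion_ex_borel_measurable_real[of ?f lborel] i by auto
    have gl: "AE x in lebesgue. ?f x = g x" using g(2) by (rule AE_completion)
    have gm: "g \<in> borel_measurable borel" "g \<in> borel_measurable lebesgue"
      using g(1) by (auto intro: measurable_completion)
    have "integrable lebesgue g"
      using i integrable_cong_AE[OF _ gm(2) gl] by auto
    then have gi: "integrable lborel g" using integrable_completion[of g lborel] gm by simp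
    have "AE x in lborel. g x = 0"
    proof (rule AE_0_of_box_integrals[OF gi])
      fix a b :: "real^'n"
      \<comment> \<open>An arbitrary box is replaced by its intersection with
        \<open>box c d\<close>, again a box, whose closed version lies in \<open>U\<close>.\<close>
      define a' b' where "a' = (\<Sum>i\<in>Basis. max (a \<bullet> i) (c \<bullet> i) *\<^sub>R i)"
        and "b' = (\<Sum>i\<in>Basis. min (b \<bullet> i) (d \<bullet> i) *\<^sub>R i)"
      have bi: "box a b \<inter> box c d = box a' b'" unfolding a'_def b'_def by (rule box_Int_box)
      have "cbox a b \<inter> cbox c d = cbox a' b'" unfolding a'_def b'_def by (rule Int_interval)
      then have sub: "cbox a' b' \<subseteq> U" using cd by auto
      have "(LINT x|lborel. indicator (box a b) x * g x) = (LINT x|lebesgue. indicator (box a b) x * g x)"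
        by (rule integral_completion[symmetric]) (use gm in auto)
      also have "\<dots> = (LINT x|lebesgue. indicator (box a b) x * ?f x)"
      proof (rule integral_cong_AE)
        have b: "indicator (box a b) \<in> borel_measurable lebesgue" by (rule borel_measurable_indicator) simp
        show "(\<lambda>x. indicator (box a b) x * g x) \<in> borel_measurable lebesgue"
          by (rule borel_measurable_times[OF b gm(2)])
        show "(\<lambda>x. indicator (box a b) x * ?f x) \<in> borel_measurable lebesgue"
          by (rule borel_measurable_times[OF b borel_measurable_integrable[OF i]])
        show "AE x in lebesgue. indicator (box a b) x * g x = indicator (box a b) x * ?f x"
          using gl by eventually_elim simp
      qed
      also have "\<dots> = (LINT x|lebesgue. D x * indicator (box a' b') x)"
        unfolding bi[symmetric] by (rule Bochner_Integration.integral_cong) (auto simp: indicator_def)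
      also have "\<dots> = 0" by (rule box0[OF sub])
      finally show "(LINT x|lborel. indicator (box a b) x * g x) = 0" .
    qed
    then have "AE x in lebesgue. g x = 0" by (rule AE_completion)
    moreover have "AE x in lebesgue. x \<notin> cbox c d - box c d"
      by (rule AE_not_in) (use negligible_frontier_interval[of c d] in \<open>simp add: negligible_iff_null_sets\<close>)
    ultimately show ?thesis using gl
      by eventually_elim (auto simp: indicator_def)
  qed
  obtain \<D> where \<D>: "countable \<D>" "\<D> \<subseteq> Pow U" "\<And>X. X \<in> \<D> \<Longrightarrow> \<exists>a b. X = cbox a b" "\<Union>\<D> = U"
    using open_countable_Union_open_cbox[OF U] by blast
  have "\<forall>X\<in>\<D>. AE x in lebesgue. x \<in> X \<longrightarrow> D x = 0"
  proof
    fix X assume X: "X \<in> \<D>"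
    then obtain a b where "X = cbox a b" using \<D>(3) by blast
    then show "AE x in lebesgue. x \<in> X \<longrightarrow> D x = 0" using AEbox[of a b] X \<D>(2) by auto
  qed
  then have "AE x in lebesgue. \<forall>X\<in>\<D>. x \<in> X \<longrightarrow> D x = 0"
    unfolding AE_ball_countable[OF \<D>(1)] .
  then have "AE x in lebesgue. x \<in> U \<longrightarrow> D x = 0"
  proof eventually_elim
    case (elim x)
    then show ?case using \<D>(4) by (metis UnionE)
  qed
  then show ?thesis using Ul by (simp add: AE_restrict_space_iff)
qed

section \<open>Compactly supported vector fields and their divergence\<close>

lemma Ck_ext_imp_Ck_on: "U \<subseteq> S \<Longrightarrow> Ck_ext k U S f \<Longrightarrow> Ck_on k U f"
proof (induction k arbitrary: f)
  case 0
  then show ?case by (auto simp: Ck_on_0) (metis continuous_on_cong continuous_on_subset)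
next
  case (Suc k)
  have "continuous_on U f"
    using Suc.prems by auto (metis continuous_on_cong continuous_on_subset)
  then show ?case using Suc by (auto simp: Ck_on_Suc)
qed

text \<open>The open sets \<open>U\<close> and \<open>- L\<close> cover the space, and on the second
  one the function is identically zero.\<close>

lemma Ck_on_extend_zero:
  assumes "open U" "Ck_on k U f" "closed L" "L \<subseteq> U" "\<And>x. x \<notin> L \<Longrightarrow> f x = 0"
  shows "Ck_on k UNIV f"
proof -
  have "Ck_on k (- L) f"
    by (rule Ck_on_cong[of _ "\<lambda>x. 0"]) (use assms in auto)
  then have "Ck_on k (U \<union> - L) f" using assms by (intro Ck_on_Un) auto
  moreover have "U \<union> - L = UNIV" using assms by auto
  ultimately show ?thesis by simp
qed

lemma Ck_on_grad: "Ck_on (Suc k) U f \<Longrightarrow> Ck_on k U (\<lambda>x. grad f x $ i)"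
  by (simp add: Ck_on_Suc grad_def Basis_vec_def)

lemma Ck_on_matrix_vector:
  assumes "open U" "\<And>i j. Ck_on k U (\<lambda>x. A x $ i $ j)" "\<And>j. Ck_on k U (\<lambda>x. v x $ j)"
  shows "Ck_on k U (\<lambda>x. ((A x :: real^'n^'n) *v v x) $ i)"
  unfolding matrix_vector_mult_def by (simp add: Ck_on_sum Ck_on_mult assms)

lemma divergence_scaleR:
  fixes u :: "real^'n \<Rightarrow> real" and X :: "real^'n \<Rightarrow> real^'n"
  assumes "open U" "Ck_on 1 U u" "\<And>i. Ck_on 1 U (\<lambda>x. X x $ i)" "x \<in> U"
  shows "divergence (\<lambda>y. u y *\<^sub>R X y) x = grad u x \<bullet> X x + u x * divergence X x"
proof -
  have d: "u differentiable (at x)" "(\<lambda>x. X x $ i) differentiable (at x)" for i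
    using assms by (auto simp: Ck_on_Suc)
  have "frechet_derivative (\<lambda>y. (u y *\<^sub>R X y) $ i) (at x) (axis i 1) =
      u x * frechet_derivative (\<lambda>y. X y $ i) (at x) (axis i 1) + grad u x $ i * X x $ i" for i
    using frechet_derivative_mult[OF d(1) d(2), of i "axis i 1"] by (simp add: grad_def)
  then show ?thesis
    unfolding divergence_def by (simp add: sum.distrib inner_vec_def sum_distrib_left)
qed

lemma divergence_eq_0_outside:
  assumes "closed L" "\<And>x. x \<notin> L \<Longrightarrow> X x = 0" "x \<notin> L"
  shows "divergence X x = 0"
  unfolding divergence_def
  using frechet_derivative_eq_0_outside[OF assms(1) _ assms(3), of "\<lambda>y. X y $ _"] assms(2)
  by (simp cong: sum.cong)

text \<open>Extended by zero, each component of \<open>X\<close> is C^1 with compact support on the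
  whole space, so each summand of the divergence integrates to zero without a boundary term.\<close>

lemma integral_divergence_eq_0:
  fixes X :: "real^'n \<Rightarrow> real^'n"
  assumes U: "open U" and X: "\<And>i. Ck_on 1 U (\<lambda>x. X x $ i)"
    and L: "compact L" "L \<subseteq> U" "\<And>x. x \<notin> L \<Longrightarrow> X x = 0" and S: "S \<in> sets lebesgue" "L \<subseteq> S"
  shows "integrable (lebesgue_on S) (divergence X)" "(LINT x|lebesgue_on S. divergence X x) = 0"
proof -
  have c: "Ck_on 1 UNIV (\<lambda>x. X x $ i)" for i
    by (rule Ck_on_extend_zero[OF U X compact_imp_closed[OF L(1)] L(2)]) (use L(3) in auto)
  have i: "integrable lborel (\<lambda>x. frechet_derivative (\<lambda>y. X y $ i) (at x) (axis i 1))"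
    "(LINT x|lborel. frechet_derivative (\<lambda>y. X y $ i) (at x) (axis i 1)) = 0" for i
    using integral_partial_derivative_eq_0[OF c L(1), of i "axis i 1"] L(3)
    by (auto simp: Basis_vec_def)
  have I: "integrable lborel (divergence X)" "(LINT x|lborel. divergence X x) = 0"
    unfolding divergence_def[abs_def] using i by auto
  have m: "divergence X \<in> borel_measurable borel" using I(1) by auto
  have z: "divergence X x = 0" if "x \<notin> S" for x
    by (rule divergence_eq_0_outside[OF compact_imp_closed[OF L(1)] L(3)]) (use that S in auto)
  show "integrable (lebesgue_on S) (divergence X)" "(LINT x|lebesgue_on S. divergence X x) = 0"
    using integral_lebesgue_on_eq_lborel[OF m S(1) z] I by auto
qed

section \<open>Antiderivatives on the line, and gradients\<close>

lemma continuous_antiderivative: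
  fixes g :: "real \<Rightarrow> real"
  assumes gc: "continuous_on UNIV g" and supp: "\<And>s. s \<notin> {a..M} \<Longrightarrow> g s = 0"
  obtains T where "\<And>s. (T has_real_derivative g s) (at s)"
    "\<And>s. s \<le> a \<Longrightarrow> T s = 0" "\<And>s. s \<ge> M \<Longrightarrow> T s = (LINT s|lborel. g s)"
proof
  \<comment> \<open>Starting at a - 1 instead of a makes every s \<ge> a an interior point of
    \<open>{a - 1..s + 1}\<close>, which yields a two-sided derivative.\<close>
  define T where "T s = integral {a - 1..s} g" for s
  have T0: "T s = 0" if "s \<le> a" for s
  proof -
    have g0: "g t = 0" if "t < a" for t using supp[of t] that by auto
    have "(g has_integral 0) {a - 1..s}"
    proof (rule has_integral_spike[of "{a}"])
      show "((\<lambda>_. 0::real) has_integral 0) {a - 1..s}" by simp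
      show "g t = 0" if "t \<in> {a - 1..s} - {a}" for t
        using g0[of t] that \<open>s \<le> a\<close> by auto
    qed simp
    then show ?thesis unfolding T_def by (rule integral_unique)
  qed
  show "(T has_real_derivative g s) (at s)" for s
  proof (cases "s < a")
    case True
    have "((\<lambda>_. 0) has_real_derivative 0) (at s)" by simp
    then have "(T has_real_derivative 0) (at s)"
      by (rule has_field_derivative_transform_within_open[of _ _ _ "{..<a}"]) (use True T0 in auto)
    then show ?thesis using supp[of s] True by auto
  next
    case False
    have "(T has_real_derivative g s) (at s within {a - 1..s + 1})"
      unfolding T_def by (rule integral_has_real_derivative)
        (use False gc in \<open>auto intro: continuous_on_subset\<close>)
    moreover have "at s within {a - 1..s + 1} = at s"
      by (rule at_within_interior) (use False in auto)
    ultimately show ?thesis by simp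
  qed
  show "T s = 0" if "s \<le> a" for s by (rule T0[OF that])
  show "T s = (LINT s|lborel. g s)" if "s \<ge> M" for s
  proof -
    have "g t = 0" if "t \<notin> {a - 1..s}" for t by (rule supp) (use that \<open>M \<le> s\<close> in auto)
    then have "(LINT s|lborel. g s) = (LINT x:{a - 1..s}|lborel. g x)"
      unfolding set_lebesgue_integral_def
      by (intro Bochner_Integration.integral_cong) (auto simp: indicator_def)
    also have "\<dots> = integral {a - 1..s} g"
      by (rule set_borel_integral_eq_integral(2))
        (use borel_integrable_compact[of "{a - 1..s}" g] gc in \<open>auto simp: set_integrable_def intro: continuous_on_subset\<close>)
    finally show ?thesis unfolding T_def by simp
  qed
qed

text \<open>Composed with \<open>E\<close>, such a \<open>T\<close> vanishes where E \<le> a and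
  equals the total integral of \<open>g\<close> where E \<ge> M; in particular it is constant near
  \<open>K\<close>.\<close>

lemma smooth_antiderivative:
  fixes g :: "real \<Rightarrow> real"
  assumes g: "\<And>k. Ck_on k UNIV g" and supp: "\<And>s. s \<notin> {a..M} \<Longrightarrow> g s = 0"
  obtains T where "\<And>k. Ck_on k UNIV T" "\<And>s. (T has_real_derivative g s) (at s)"
    "\<And>s. s \<le> a \<Longrightarrow> T s = 0" "\<And>s. s \<ge> M \<Longrightarrow> T s = (LINT s|lborel. g s)"
proof -
  have "continuous_on UNIV g" using g[of 0] by (simp add: Ck_on_0)
  then obtain T where T: "\<And>s. (T has_real_derivative g s) (at s)"
    "\<And>s. s \<le> a \<Longrightarrow> T s = 0" "\<And>s. s \<ge> M \<Longrightarrow> T s = (LINT s|lborel. g s)"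
    using continuous_antiderivative[of g a M] supp by metis
  have "Ck_on k UNIV T" for k
    by (rule Ck_on_Suc_imp[OF Ck_on_SucI_real[OF open_UNIV T(1) g]])
  from that[OF this T] show ?thesis .
qed

lemma frechet_derivative_eq_grad:
  fixes f :: "real^'n \<Rightarrow> real"
  assumes "f differentiable (at x)"
  shows "frechet_derivative f (at x) v = grad f x \<bullet> v"
proof -
  have l: "linear (frechet_derivative f (at x))" by (rule linear_frechet_derivative[OF assms])
  have "frechet_derivative f (at x) v = frechet_derivative f (at x) (\<Sum>i\<in>UNIV. v $ i *\<^sub>R axis i 1)"
    using basis_expansion[of v] by (simp add: scalar_mult_eq_scaleR)
  also have "\<dots> = (\<Sum>i\<in>UNIV. v $ i *\<^sub>R frechet_derivative f (at x) (axis i 1))"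
    by (simp add: linear_sum[OF l] linear_cmul[OF l])
  also have "\<dots> = grad f x \<bullet> v" by (simp add: grad_def inner_vec_def mult.commute)
  finally show ?thesis .
qed

lemma grad_cong_open:
  assumes "open V" "\<And>y. y \<in> V \<Longrightarrow> f y = g y" "x \<in> V"
  shows "grad f x = grad g x"
  unfolding grad_def using frechet_derivative_cong_open(1)[OF assms] by simp

lemma grad_const [simp]: "grad (\<lambda>x. k) x = 0"
  by (simp add: grad_def vec_eq_iff)

lemma grad_compose_real:
  assumes "(T has_real_derivative T') (at (g x))" "g differentiable (at x)"
  shows "grad (\<lambda>y. T (g y)) x = T' *\<^sub>R grad g x"
  using frechet_derivative_compose_real(1)[of T g x] assms frechet_derivative_real[OF assms(1)]
  by (auto simp: grad_def vec_eq_iff real_differentiable_def)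

lemma grad_mult:
  assumes "f differentiable (at x)" "g differentiable (at x)"
  shows "grad (\<lambda>y. f y * g y) x = f x *\<^sub>R grad g x + g x *\<^sub>R grad f x"
  using frechet_derivative_mult[OF assms] by (simp add: grad_def vec_eq_iff mult.commute)

lemma open_AE_eq_0:
  fixes Z :: "'a::euclidean_space \<Rightarrow> real"
  assumes "continuous_on UNIV Z" "AE x in lborel. Z x = 0"
  shows "Z x = 0"
proof (rule ccontr)
  assume "Z x \<noteq> 0"
  have "open {x. Z x \<noteq> 0}" using assms(1) by (intro open_Collect_neq) auto
  moreover have "negligible {x. Z x \<noteq> 0}"
  proof -
    have m: "{x. Z x \<noteq> 0} \<in> sets lebesgue" using \<open>open {x. Z x \<noteq> 0}\<close> by auto
    have "AE x in lebesgue. x \<notin> {x. Z x \<noteq> 0}" using AE_completion[OF assms(2)] by simp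
    then show ?thesis using AE_iff_null_sets[OF m] by (simp add: negligible_iff_null_sets)
  qed
  ultimately show False using open_not_negligible \<open>Z x \<noteq> 0\<close> by blast
qed

text \<open>The whole space is connected, so the function is constant; it is also unbounded, so the
  constant is a value taken outside \<open>L\<close>.\<close>

lemma compact_support_differentiable_const:
  fixes \<phi> :: "real^'n \<Rightarrow> real"
  assumes "Ck_on 1 UNIV \<phi>" "\<And>x. grad \<phi> x = 0" "bounded L" "\<And>x. x \<notin> L \<Longrightarrow> \<phi> x = 0"
  shows "\<phi> x = 0"
proof -
  have d: "\<phi> differentiable (at x)" for x using assms(1) by (simp add: Ck_on_Suc)
  have "(\<phi> has_derivative (\<lambda>h. 0)) (at x within UNIV)" for x
  proof -
    have "frechet_derivative \<phi> (at x) = (\<lambda>h. 0)"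
      using frechet_derivative_eq_grad[OF d, of x] assms(2) by (simp add: fun_eq_iff)
    then show ?thesis using d[of x] by (simp add: frechet_derivative_works)
  qed
  then obtain k where k: "\<And>x. \<phi> x = k"
    using has_derivative_zero_constant[of UNIV \<phi>] by auto
  obtain y where "y \<notin> L" using assms(3) not_bounded_UNIV[where 'a = "real^'n"] by (metis UNIV_eq_I)
  then show ?thesis using k[of y] k[of x] assms(4) by simp
qed

section \<open>The weight and the coarea identity\<close>

text \<open>The measure and its support are existentially bound in \<open>interior_weight\<close>;
  they are fixed here so that all level-set arguments refer to the same pair.\<close>

locale weighted_domain =
  fixes \<Omega> :: "(real^'n) set" and A :: "real^'n \<Rightarrow> real^'n^'n" and E :: "real^'n \<Rightarrow> ereal"
    and \<gamma> :: real and \<mu> :: "(real^'n) measure" and K :: "(real^'n) set"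
  assumes dom: "smooth_bounded_domain \<Omega>" and ell: "elliptic_matrix \<Omega> A"
    and sets_mu: "sets \<mu> = sets (restrict_space borel \<Omega>)"
    and fin_mu: "finite_measure \<mu>" and mu_nz: "emeasure \<mu> \<Omega> \<noteq> 0"
    and distr: "distr_L_eq \<Omega> A (real_of_ereal \<circ> E) \<mu>"
    and K_supp: "K = supp_in \<Omega> \<mu>" and compact_K: "compact K"
    and E_fin: "\<forall>x\<in>closure \<Omega> - K. \<bar>E x\<bar> \<noteq> \<infinity>"
    and E_smooth: "smooth_upto (\<Omega> - K) (closure \<Omega> - K) (real_of_ereal \<circ> E)"
    and E_K: "\<forall>x\<in>K. E x = \<infinity> \<and> (E \<longlongrightarrow> \<infinity>) (at x)"
    and dim: "\<exists>d. has_box_dim \<Omega> K d \<and> d < real CARD('n) - 2"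
    and bdry: "\<forall>x\<in>frontier \<Omega>. E x = ereal \<gamma>"
begin

definition e :: "real^'n \<Rightarrow> real" where "e = real_of_ereal \<circ> E"
definition U :: "(real^'n) set" where "U = \<Omega> - K"
definition Q :: "real^'n \<Rightarrow> real" where "Q x = normsq_A A x (grad e x)"
definition c :: real where "c = measure \<mu> \<Omega>"

lemma open_\<Omega>: "open \<Omega>" and bounded_\<Omega>: "bounded \<Omega>"
  using dom by (auto simp: smooth_bounded_domain_def)

lemma meas_\<Omega>: "\<Omega> \<in> sets lebesgue" using open_\<Omega> by auto

lemma K_sub: "K \<subseteq> \<Omega>" using K_supp by (auto simp: supp_in_def)

lemma open_U: "open U" unfolding U_def using open_\<Omega> compact_K by (simp add: compact_imp_closed open_Diff)

lemma U_sub: "U \<subseteq> \<Omega>" and U_K: "U \<inter> K = {}" and \<Omega>_eq: "\<Omega> = U \<union> K"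
  using K_sub by (auto simp: U_def)

lemma E_eq: "x \<in> closure \<Omega> - K \<Longrightarrow> E x = ereal (e x)"
  using E_fin by (auto simp: e_def ereal_real)

lemma E_eq_U: "x \<in> U \<Longrightarrow> E x = ereal (e x)"
  using E_eq[of x] U_sub U_K closure_subset by auto

lemma Ck_e: "Ck_on k U e"
  unfolding U_def e_def
  by (rule Ck_ext_imp_Ck_on[of _ "closure \<Omega> - K"])
    (use E_smooth closure_subset in \<open>auto simp: smooth_upto_def\<close>)

lemma Ck_A: "Ck_on k \<Omega> (\<lambda>x. A x $ i $ j)"
  by (rule Ck_ext_imp_Ck_on[OF closure_subset])
    (use ell in \<open>auto simp: elliptic_matrix_def smooth_upto_def\<close>)

lemma Ck_A_U: "Ck_on k U (\<lambda>x. A x $ i $ j)"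
  using Ck_A U_sub Ck_on_subset by blast

lemma A_sym: "x \<in> \<Omega> \<Longrightarrow> (A x *v v) \<bullet> w = (A x *v w) \<bullet> v"
proof -
  assume "x \<in> \<Omega>"
  then have "transpose (A x) = A x"
    using ell closure_subset[of \<Omega>] unfolding elliptic_matrix_def by blast
  then show ?thesis by (metis dot_lmul_matrix inner_commute transpose_matrix_vector)
qed

lemma normsq_nonneg: "x \<in> \<Omega> \<Longrightarrow> normsq_A A x v \<ge> 0"
proof -
  assume x: "x \<in> \<Omega>"
  obtain \<theta> where "\<theta> > 0" "(A x *v v) \<bullet> v \<ge> \<theta> * (norm v)\<^sup>2"
    using ell closure_subset[of \<Omega>] x unfolding elliptic_matrix_def by blast
  then show ?thesis unfolding normsq_A_def by (smt (verit) mult_nonneg_nonneg zero_le_power2)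
qed

lemma normsq_pos: "x \<in> \<Omega> \<Longrightarrow> v \<noteq> 0 \<Longrightarrow> normsq_A A x v > 0"
proof -
  assume x: "x \<in> \<Omega>" and v: "v \<noteq> 0"
  obtain \<theta> where "\<theta> > 0" "(A x *v v) \<bullet> v \<ge> \<theta> * (norm v)\<^sup>2"
    using ell closure_subset[of \<Omega>] x unfolding elliptic_matrix_def by blast
  moreover have "\<theta> * (norm v)\<^sup>2 > 0" using \<open>\<theta> > 0\<close> v by simp
  ultimately show ?thesis unfolding normsq_A_def by linarith
qed

text \<open>At points of \<open>K\<close> the limit clause of the weight is precisely continuity
  with value \<infinity>. Elsewhere \<open>K\<close> is closed, so limits within closure \<Omega>
  and within closure \<Omega> minus \<open>K\<close> agree.\<close>

lemma cont_E: "continuous_on (closure \<Omega>) E"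
proof -
  have 1: "continuous_on (closure \<Omega> - K) E"
  proof -
    have "continuous_on (closure \<Omega> - K) e"
      using E_smooth by (simp add: smooth_upto_def e_def)
    then have "continuous_on (closure \<Omega> - K) (\<lambda>x. ereal (e x))"
      by (rule continuous_on_ereal)
    then show ?thesis by (rule continuous_on_eq) (use E_eq in auto)
  qed
  show ?thesis unfolding continuous_on_eq_continuous_within
  proof
    fix x assume x: "x \<in> closure \<Omega>"
    show "continuous (at x within closure \<Omega>) E"
    proof (cases "x \<in> K")
      case True
      then have "(E \<longlongrightarrow> E x) (at x)" using E_K by auto
      then show ?thesis unfolding continuous_within by (rule tendsto_within_subset) auto
    next
      case False
      then have "continuous (at x within closure \<Omega> - K) E"
        using 1 x by (simp add: continuous_on_eq_continuous_within)
      moreover have "at x within closure \<Omega> - K = at x within closure \<Omega>"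
        by (rule at_within_nhd[of _ "- K"]) (use False compact_K compact_imp_closed in auto)
      ultimately show ?thesis by simp
    qed
  qed
qed

lemma open_superlevel: "open {x\<in>\<Omega>. ereal M < E x}"
proof -
  have "continuous_on \<Omega> E" using cont_E closure_subset continuous_on_subset by blast
  then have "open (E -` {ereal M<..} \<inter> \<Omega>)"
    using continuous_on_open_vimage[OF open_\<Omega>, of E] open_greaterThan[of "ereal M"] by blast
  then show ?thesis by (simp add: vimage_def Collect_conj_eq Int_commute)
qed

text \<open>\<open>E\<close> takes only the value \<gamma> on the frontier, so the preimage of a
  closed set of values missing \<gamma> cannot touch the frontier and is closed in the compact set
  closure \<Omega>.\<close>

lemma compact_level:
  assumes "closed S" "ereal \<gamma> \<notin> S"
  shows "compact {x\<in>\<Omega>. E x \<in> S}"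
proof -
  have "closed (closure \<Omega> \<inter> E -` S)"
    by (rule continuous_closed_preimage) (use cont_E assms in auto)
  moreover have "closure \<Omega> \<inter> E -` S = {x\<in>\<Omega>. E x \<in> S}"
  proof -
    have "x \<in> \<Omega>" if "x \<in> closure \<Omega>" "E x \<in> S" for x
    proof (rule ccontr)
      assume "x \<notin> \<Omega>"
      then have "x \<in> frontier \<Omega>" using that open_\<Omega> by (simp add: frontier_def interior_open)
      then show False using bdry assms(2) that(2) by auto
    qed
    then show ?thesis using closure_subset[of \<Omega>] by auto
  qed
  moreover have "bounded {x\<in>\<Omega>. E x \<in> S}" by (rule bounded_subset[OF bounded_\<Omega>]) auto
  ultimately show ?thesis by (simp add: compact_eq_bounded_closed)
qed

text \<open>The complement of the support is a union of open null sets, possibly uncountable; by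
  Lindelof countably many of them have the same union.\<close>

lemma mu_K: "AE x in \<mu>. x \<in> K"
proof -
  define F where "F = {V. open V \<and> emeasure \<mu> (V \<inter> \<Omega>) = 0}"
  have sp: "space \<mu> = \<Omega>" using sets_eq_imp_space_eq[OF sets_mu] by (simp add: space_restrict_space)
  obtain F' where F': "F' \<subseteq> F" "countable F'" "\<Union>F' = \<Union>F"
    using Lindelof[of F] unfolding F_def by blast
  have m: "V \<inter> \<Omega> \<in> sets \<mu>" if "V \<in> F" for V
    unfolding sets_mu sets_restrict_space
    using that by (intro image_eqI[of _ _ V]) (auto simp: F_def)
  have "AE x in \<mu>. \<forall>V\<in>F'. x \<notin> V \<inter> \<Omega>"
    unfolding AE_ball_countable[OF F'(2)]
  proof
    fix V assume "V \<in> F'"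
    then have "V \<in> F" using F'(1) by blast
    then show "AE x in \<mu>. x \<notin> V \<inter> \<Omega>"
      using m[of V] by (intro AE_not_in null_setsI) (auto simp: F_def)
  qed
  moreover have "AE x in \<mu>. x \<in> \<Omega>" using AE_space[of \<mu>] unfolding sp .
  ultimately show ?thesis
  proof eventually_elim
    case (elim x)
    then have nF: "x \<notin> \<Union>F" unfolding F'(3)[symmetric] by blast
    have "emeasure \<mu> (V \<inter> \<Omega>) > 0" if "open V" "x \<in> V" for V
    proof (rule ccontr)
      assume "\<not> emeasure \<mu> (V \<inter> \<Omega>) > 0"
      then have "V \<in> F" using that by (simp add: F_def zero_less_iff_neq_zero)
      then show False using nF that by blast
    qed
    then show "x \<in> K" using elim(2) unfolding K_supp supp_in_def by blast
  qed
qed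

lemma integral_mu:
  assumes "\<And>x. x \<in> K \<Longrightarrow> \<phi> x = (\<tau>::real)" "\<phi> \<in> borel_measurable borel"
  shows "(LINT x|\<mu>. \<phi> x) = \<tau> * c"
proof -
  have sp: "space \<mu> = \<Omega>" using sets_eq_imp_space_eq[OF sets_mu] by (simp add: space_restrict_space)
  have "\<phi> \<in> borel_measurable \<mu>"
    using measurable_restrict_space1[OF assms(2), of \<Omega>] sets_mu
    by (simp cong: measurable_cong_sets)
  then have "(LINT x|\<mu>. \<phi> x) = (LINT x|\<mu>. \<tau>)"
    by (intro integral_cong_AE) (use mu_K assms(1) in auto)
  then show ?thesis by (simp add: c_def sp)
qed

lemma c_pos: "c > 0"
proof -
  interpret finite_measure \<mu> by (rule fin_mu)
  have "measure \<mu> \<Omega> \<noteq> 0" using mu_nz by (simp add: emeasure_eq_measure)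
  then show ?thesis unfolding c_def using measure_nonneg[of \<mu> \<Omega>] by linarith
qed

end

section \<open>Null set property of \<open>K\<close>, level-set identities and harmonicity off
  \<open>K\<close>\<close>

context weighted_domain
begin

text \<open>If \<open>K\<close> had positive measure, the volumes of its neighbourhoods would stay
  between two positive constants, and dividing their logarithms by ln r would give the limit 0. The
  dimension bound forces a limit above 2.\<close>

lemma K_null: "K \<in> null_sets lebesgue"
proof -
  obtain l where l: "((\<lambda>r. ln (measure lebesgue {x\<in>\<Omega>. infdist x K < r}) / ln r) \<longlongrightarrow> l) (at_right 0)"
    and l2: "l > 2" using dim unfolding has_box_dim_def by force
  have K: "K \<in> lmeasurable" using compact_K by (rule lmeasurable_compact)
  have \<Omega>: "\<Omega> \<in> lmeasurable" using open_\<Omega> bounded_\<Omega> by (simp add: lmeasurable_open)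
  define m0 where "m0 = measure lebesgue K"
  define M where "M = measure lebesgue \<Omega>"
  have "m0 = 0"
  proof (rule ccontr)
    assume "m0 \<noteq> 0"
    then have m0: "m0 > 0" unfolding m0_def using measure_nonneg[of lebesgue K] by linarith
    define C where "C = \<bar>ln m0\<bar> + \<bar>ln M\<bar>"
    have b: "\<bar>ln (measure lebesgue {x\<in>\<Omega>. infdist x K < r})\<bar> \<le> C" if "r > 0" for r
    proof -
      let ?S = "{x\<in>\<Omega>. infdist x K < r}"
      have "?S = \<Omega> \<inter> {x. infdist x K < r}" by auto
      moreover have "open {x. infdist x K < r}"
        by (intro open_Collect_less continuous_intros)
      ultimately have "open ?S" using open_\<Omega> by (simp add: open_Int)
      moreover have "bounded ?S" by (rule bounded_subset[OF bounded_\<Omega>]) auto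
      ultimately have S: "?S \<in> lmeasurable" by (simp add: lmeasurable_open)
      have "m0 \<le> measure lebesgue ?S" unfolding m0_def
        by (rule measure_mono_fmeasurable[OF _ _ S]) (use K K_sub that in auto)
      moreover have "measure lebesgue ?S \<le> M" unfolding M_def
        by (rule measure_mono_fmeasurable[OF _ _ \<Omega>]) (use S in auto)
      ultimately have "ln m0 \<le> ln (measure lebesgue ?S)" "ln (measure lebesgue ?S) \<le> ln M"
        using m0 by auto
      then show ?thesis unfolding C_def by linarith
    qed
    have "((\<lambda>r. ln (measure lebesgue {x\<in>\<Omega>. infdist x K < r}) / ln r) \<longlongrightarrow> 0) (at_right 0)"
    proof (rule Lim_null_comparison[where g = "\<lambda>r. C * \<bar>1 / ln r\<bar>"])
      show "\<forall>\<^sub>F r in at_right 0. norm (ln (measure lebesgue {x\<in>\<Omega>. infdist x K < r}) / ln r) \<le> C * \<bar>1 / ln r\<bar>"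
        unfolding eventually_at_right_field
      proof (intro exI[of _ 1] conjI allI impI)
        fix y :: real assume "0 < y" "y < 1"
        then show "norm (ln (measure lebesgue {x\<in>\<Omega>. infdist x K < y}) / ln y) \<le> C * \<bar>1 / ln y\<bar>"
          using divide_right_mono[OF b[of y], of "\<bar>ln y\<bar>"] by (simp add: abs_divide)
      qed simp
      have "((\<lambda>r::real. 1 / ln r) \<longlongrightarrow> 0) (at_right 0)"
        by (rule tendsto_divide_0[OF tendsto_const filterlim_at_bot_imp_at_infinity[OF ln_at_0]])
      then show "((\<lambda>r. C * \<bar>1 / ln r\<bar>) \<longlongrightarrow> 0) (at_right 0)"
        by (intro tendsto_mult_right_zero tendsto_rabs_zero)
    qed
    then have "l = 0" using tendsto_unique[OF _ l] by simp
    then show False using l2 by simp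
  qed
  then show ?thesis using K unfolding m0_def
    by (metis ennreal_0 emeasure_eq_measure2 fmeasurableD null_setsI)
qed

lemma differentiable_e: "x \<in> U \<Longrightarrow> e differentiable (at x)"
  using Ck_e[of 1] by (simp add: Ck_on_Suc)

lemma Ck_Q: "Ck_on k U Q"
  unfolding Q_def[abs_def] normsq_A_def inner_vec_def
  by (simp, intro Ck_on_sum Ck_on_mult Ck_on_matrix_vector Ck_on_grad Ck_A_U Ck_e open_U)

lemma Q_nonneg: "x \<in> U \<Longrightarrow> Q x \<ge> 0"
  unfolding Q_def using normsq_nonneg U_sub by blast

lemma matrix_vector_scaleR: "(A x :: real^'n^'n) *v (r *\<^sub>R v) = r *\<^sub>R (A x *v v)"
  by (simp add: matrix_vector_mult_scaleR)

text \<open>The equation for \<open>E\<close> is tested with T(E), extended by \<tau> on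
  \<open>K\<close> and by 0 outside \<Omega>. One derivative is moved back to \<open>E\<close>,
  which leaves the integral of g(E)|\<nabla>E|^2 on one side and \<tau> times the mass of \<mu> on
  the other. The sets \<open>L\<close> and \<open>R\<close>, which contain the supports of T(E) and
  g(E), are kept abstract because the lemma serves two purposes: functions \<open>T\<close> rising
  from 0 near the boundary value, and functions \<open>T\<close> living only below it.\<close>

lemma energy_identity:
  assumes T: "\<And>k. Ck_on k UNIV T" and T': "\<And>s. (T has_real_derivative g s) (at s)"
    and L: "compact L" "L \<subseteq> \<Omega>" "\<forall>x\<in>U - L. T (e x) = 0"
    and M: "\<forall>s\<ge>M. T s = \<tau>"
    and R: "compact R" "R \<subseteq> U" "\<forall>x\<in>U - R. g (e x) = 0"
  shows "test_fun \<Omega> (\<lambda>x. if x \<in> K then \<tau> else if x \<in> \<Omega> then T (e x) else 0)"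
    and "x \<in> U \<Longrightarrow> grad (\<lambda>x. if x \<in> K then \<tau> else if x \<in> \<Omega> then T (e x) else 0) x = g (e x) *\<^sub>R grad e x"
    and "x \<notin> U \<Longrightarrow> grad (\<lambda>x. if x \<in> K then \<tau> else if x \<in> \<Omega> then T (e x) else 0) x = 0"
    and "continuous_on UNIV (\<lambda>x. if x \<in> U then g (e x) * Q x else 0)"
    and "integrable (lebesgue_on \<Omega>) (\<lambda>x. if x \<in> U then g (e x) * Q x else 0)"
    and "(LINT x|lebesgue_on \<Omega>. (if x \<in> U then g (e x) * Q x else 0)) = \<tau> * c"
proof -
  let ?\<phi> = "\<lambda>x. if x \<in> K then \<tau> else if x \<in> \<Omega> then T (e x) else 0"
  let ?N = "{x\<in>\<Omega>. ereal M < E x}"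
  let ?C = "- (L \<union> K)"
  have C: "open ?C" using L(1) compact_K by (intro open_Compl closed_Un compact_imp_closed)
  have \<phi>N: "?\<phi> x = \<tau>" if "x \<in> ?N" for x
  proof -
    have "x \<in> K \<or> (x \<in> \<Omega> \<and> x \<in> U)" using that \<Omega>_eq by blast
    then show ?thesis using that E_eq_U[of x] M[rule_format, of "e x"] by auto
  qed
  have \<phi>C: "?\<phi> x = 0" if "x \<in> ?C" for x
    using that L(3) \<Omega>_eq by auto
  have \<phi>U: "?\<phi> x = T (e x)" if "x \<in> U" for x using that U_K U_sub by auto
  have KN: "K \<subseteq> ?N" using E_K K_sub by auto
  have Cg: "Ck_on k UNIV g" for k
  proof -
    have "deriv T = g" using T' DERIV_imp_deriv by blast
    then show ?thesis using Ck_on_SucD_real(2)[OF open_UNIV T[of "Suc k"]] by simp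
  qed
  have C\<phi>: "Ck_on k UNIV ?\<phi>" for k
  proof -
    have "Ck_on k U ?\<phi>"
      by (rule Ck_on_cong[OF open_U _ Ck_on_compose[OF open_U T Ck_e]]) (use \<phi>U in auto)
    moreover have "Ck_on k ?N ?\<phi>"
      by (rule Ck_on_cong[OF open_superlevel, of M "\<lambda>x. \<tau>"]) (use \<phi>N in auto)
    moreover have "Ck_on k ?C ?\<phi>"
      by (rule Ck_on_cong[OF C, of "\<lambda>x. 0"]) (use \<phi>C in auto)
    \<comment> \<open>\<open>?N\<close> is an open neighbourhood of \<open>K\<close> on which the
      function is the constant \<tau>, and on \<open>?C\<close> it is zero. Together with
      \<open>U\<close> they cover the space, so the definition by cases is smooth across
      \<open>K\<close> and across the frontier.\<close>
    ultimately have "Ck_on k (U \<union> ?N \<union> ?C) ?\<phi>"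
      using open_U open_superlevel C by (intro Ck_on_Un) auto
    moreover have "U \<union> ?N \<union> ?C = UNIV" using KN L(2) \<Omega>_eq by auto
    ultimately show ?thesis by simp
  qed
  show tf: "test_fun \<Omega> ?\<phi>"
    by (rule test_fun_compact_support[OF C\<phi>, of "L \<union> K"]) (use L K_sub compact_K \<phi>C in auto)
  show gU: "grad ?\<phi> x = g (e x) *\<^sub>R grad e x" if "x \<in> U" for x
  proof -
    have "grad ?\<phi> x = grad (\<lambda>x. T (e x)) x" by (rule grad_cong_open[OF open_U \<phi>U that])
    then show ?thesis using grad_compose_real[OF T' differentiable_e[OF that]] by simp
  qed
  show g0: "grad ?\<phi> x = 0" if "x \<notin> U" for x
  proof (cases "x \<in> K")
    case True
    then have "x \<in> ?N" using KN by blast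
    from grad_cong_open[OF open_superlevel \<phi>N this] show ?thesis by simp
  next
    case False
    then have "x \<in> ?C" using that L(2) \<Omega>_eq by auto
    from grad_cong_open[OF C \<phi>C this] show ?thesis by simp
  qed
  define Z where "Z = (\<lambda>x. if x \<in> U then g (e x) * Q x else 0)"
  have Z0: "Z x = 0" if "x \<notin> R" for x using R(3) that by (auto simp: Z_def)
  have CZ: "Ck_on 0 UNIV Z"
  proof (rule Ck_on_extend_zero[OF open_U _ compact_imp_closed[OF R(1)] R(2) Z0])
    show "Ck_on 0 U Z"
      by (rule Ck_on_cong[OF open_U _ Ck_on_mult[OF open_U Ck_on_compose[OF open_U Cg Ck_e] Ck_Q]])
        (auto simp: Z_def)
  qed
  then show "continuous_on UNIV (\<lambda>x. if x \<in> U then g (e x) * Q x else 0)"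
    unfolding Z_def[symmetric] by (simp add: Ck_on_0)
  then have cZ: "continuous_on UNIV Z" unfolding Z_def .
  have iZ: "integrable (lebesgue_on \<Omega>) Z"
    using integral_lebesgue_on_eq_lborel(2)[OF borel_measurable_continuous_onI[OF cZ] meas_\<Omega>]
      integrable_compact_support[OF cZ R(1) Z0] by (auto simp: Z_def U_def)
  then show "integrable (lebesgue_on \<Omega>) (\<lambda>x. if x \<in> U then g (e x) * Q x else 0)"
    unfolding Z_def .
  \<comment> \<open>\<open>X0\<close> is supported in \<open>R\<close>, away from \<open>K\<close>,
    so multiplying it by \<open>e\<close> gives a field with compact support in \<open>U\<close>
    although \<open>E\<close> blows up at \<open>K\<close>.\<close>
  define X0 where "X0 = (\<lambda>y. A y *v grad ?\<phi> y)"
  define X where "X = (\<lambda>y. e y *\<^sub>R X0 y)"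
  have X00: "X0 x = 0" if "x \<notin> R" for x
    using that gU[of x] g0[of x] R(3) by (cases "x \<in> U") (auto simp: X0_def)
  have X0: "X x = 0" if "x \<notin> R" for x using X00[OF that] by (simp add: X_def)
  have CX0: "Ck_on k U (\<lambda>x. X0 x $ i)" for i k unfolding X0_def
    by (intro Ck_on_matrix_vector open_U Ck_A_U Ck_on_grad Ck_on_subset[OF C\<phi>]) auto
  have CX: "Ck_on k U (\<lambda>x. X x $ i)" for i k unfolding X_def
    by (simp, intro Ck_on_mult open_U Ck_e CX0)
  have R\<Omega>: "R \<subseteq> \<Omega>" using R(2) U_sub by blast
  have div: "integrable (lebesgue_on \<Omega>) (divergence X)" "(LINT x|lebesgue_on \<Omega>. divergence X x) = 0"
    using integral_divergence_eq_0[OF open_U CX R(1,2) X0 meas_\<Omega> R\<Omega>] by auto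
  have pt: "e x * L_op A ?\<phi> x = Z x - divergence X x" for x
  proof (cases "x \<in> U")
    case True
    have "divergence X x = grad e x \<bullet> X0 x + e x * divergence X0 x"
      unfolding X_def by (rule divergence_scaleR[OF open_U Ck_e CX0 True])
    moreover have "grad e x \<bullet> X0 x = Z x"
      using True gU[OF True] by (simp add: X0_def Z_def Q_def normsq_A_def matrix_vector_scaleR inner_commute)
    ultimately show ?thesis unfolding L_op_def X0_def by simp
  next
    case False
    then have n: "x \<notin> R" using R(2) by blast
    have "divergence X x = 0" "divergence X0 x = 0"
      using divergence_eq_0_outside[OF compact_imp_closed[OF R(1)] _ n] X0 X00 by auto
    then show ?thesis using Z0[OF n] unfolding L_op_def X0_def by simp
  qed
  have "(LINT x|lebesgue_on \<Omega>. e x * L_op A ?\<phi> x) = (LINT x|\<mu>. ?\<phi> x)"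
    using distr tf unfolding distr_L_eq_def e_def by blast
  also have "\<dots> = \<tau> * c"
    by (rule integral_mu) (use Ck_on_imp_continuous_on[OF C\<phi>[of 0]] in \<open>auto intro!: borel_measurable_continuous_onI\<close>)
  finally have "(LINT x|lebesgue_on \<Omega>. Z x - divergence X x) = \<tau> * c" by (simp only: pt)
  then show "(LINT x|lebesgue_on \<Omega>. (if x \<in> U then g (e x) * Q x else 0)) = \<tau> * c"
    using iZ div unfolding Z_def[symmetric] by simp
qed

lemma E_ge_level_compact:
  assumes "a > \<gamma>"
  shows "compact {x\<in>\<Omega>. E x \<in> {ereal a..}}" "compact {x\<in>\<Omega>. E x \<in> {ereal a..ereal M}}"
    "{x\<in>\<Omega>. E x \<in> {ereal a..ereal M}} \<subseteq> U"
proof -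
  show "compact {x\<in>\<Omega>. E x \<in> {ereal a..}}" "compact {x\<in>\<Omega>. E x \<in> {ereal a..ereal M}}"
    by (rule compact_level; use assms in simp)+
  show "{x\<in>\<Omega>. E x \<in> {ereal a..ereal M}} \<subseteq> U" using E_K by (auto simp: U_def)
qed

text \<open>The pushforward of \<open>|\<nabla>E|\<^sub>A\<^sup>2 dx\<close> under \<open>E\<close> is \<open>\<mu>(\<Omega>)\<close> times Lebesgue measure on \<open>(\<gamma>, \<infinity>)\<close>,
  because \<open>\<mu>\<close> only sees the value of \<open>T \<circ> E\<close> at infinity.\<close>

lemma coarea_identity:
  assumes g: "\<And>k. Ck_on k UNIV g" and supp: "\<And>s. s \<notin> {a..M} \<Longrightarrow> g s = 0" and a: "a > \<gamma>"
  shows "integrable (lebesgue_on \<Omega>) (\<lambda>x. if x \<in> U then g (e x) * Q x else 0)"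
    and "(LINT x|lebesgue_on \<Omega>. (if x \<in> U then g (e x) * Q x else 0)) = c * (LINT s|lborel. g s)"
proof -
  obtain T where T: "\<And>k. Ck_on k UNIV T" "\<And>s. (T has_real_derivative g s) (at s)"
    "\<And>s. s \<le> a \<Longrightarrow> T s = 0" "\<And>s. s \<ge> M \<Longrightarrow> T s = (LINT s|lborel. g s)"
    using smooth_antiderivative[OF g supp] by blast
  let ?L = "{x\<in>\<Omega>. E x \<in> {ereal a..}}" and ?R = "{x\<in>\<Omega>. E x \<in> {ereal a..ereal M}}"
  have L: "\<forall>x\<in>U - ?L. T (e x) = 0"
    using E_eq_U U_sub by (auto intro!: T(3))
  have R: "\<forall>x\<in>U - ?R. g (e x) = 0"
    using E_eq_U U_sub by (auto intro!: supp)
  have M: "\<forall>s\<ge>M. T s = (LINT s|lborel. g s)" using T(4) by blast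
  have L\<Omega>: "?L \<subseteq> \<Omega>" by auto
  note * = energy_identity[OF T(1,2) E_ge_level_compact(1)[OF a] L\<Omega> L M
      E_ge_level_compact(2,3)[OF a, of M] R]
  show "integrable (lebesgue_on \<Omega>) (\<lambda>x. if x \<in> U then g (e x) * Q x else 0)"
    "(LINT x|lebesgue_on \<Omega>. (if x \<in> U then g (e x) * Q x else 0)) = c * (LINT s|lborel. g s)"
    using * by (auto simp: mult.commute)
qed

text \<open>A minimum principle by testing. For b < \<gamma> a decreasing \<open>T\<close> that is
  positive exactly below b gives a test function vanishing on \<open>K\<close>, so
  g(E)|\<nabla>E|^2, which has one sign, integrates to zero. Hence T(E) has zero gradient
  everywhere, and its compact support makes it vanish: \<open>E\<close> is nowhere below b.\<close>

lemma E_ge_boundary: "x \<in> U \<Longrightarrow> e x \<ge> \<gamma>"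
proof (rule ccontr)
  assume x: "x \<in> U" and "\<not> e x \<ge> \<gamma>"
  then obtain b where b: "e x < b" "b < \<gamma>" using dense[of "e x" \<gamma>] by auto
  define T where "T s = flat_fun 0 (b - s)" for s
  \<comment> \<open>This is T'; in the derivative formula of \<open>flat_fun 0\<close> the second
    term has coefficient 0.\<close>
  define g where "g s = - flat_fun 2 (b - s)" for s
  have T: "Ck_on k UNIV T" for k
    unfolding T_def by (intro Ck_on_compose[OF _ Ck_on_flat_fun] Ck_on_diff Ck_on_id) auto
  have T': "(T has_real_derivative g s) (at s)" for s
  proof -
    have "((\<lambda>s. b - s) has_real_derivative - 1) (at s)" by (auto intro!: derivative_eq_intros)
    from DERIV_chain2[OF flat_fun_deriv[of 0 "b - s"] this]
    show ?thesis by (simp add: T_def[abs_def] g_def flip: numeral_2_eq_2)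
  qed
  let ?L = "{x\<in>\<Omega>. E x \<in> {..ereal b}}"
  have cL: "compact ?L" by (rule compact_level) (use b in auto)
  have LU: "?L \<subseteq> U" using E_K by (auto simp: U_def)
  have out: "\<forall>x\<in>U - ?L. T (e x) = 0" "\<forall>x\<in>U - ?L. g (e x) = 0"
    using E_eq_U U_sub by (auto simp: T_def g_def flat_fun_def)
  have T0: "\<forall>s\<ge>b. T s = 0" by (simp add: T_def flat_fun_def)
  have L\<Omega>: "?L \<subseteq> \<Omega>" by auto
  note * = energy_identity[OF T T' cL L\<Omega> out(1) T0 cL LU out(2)]
  let ?\<phi> = "\<lambda>x. if x \<in> K then 0 else if x \<in> \<Omega> then T (e x) else 0"
  let ?Z = "\<lambda>x. if x \<in> U then g (e x) * Q x else 0"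
  have cZ: "continuous_on UNIV ?Z" and iZ: "integrable (lebesgue_on \<Omega>) ?Z"
    and Z0: "(LINT x|lebesgue_on \<Omega>. ?Z x) = 0"
    using *(4-6) by auto
  have neg: "?Z x \<le> 0" for x
    using Q_nonneg[of x] by (auto simp: g_def flat_fun_def intro!: mult_nonpos_nonneg)
  have b0: "?Z x = 0" if "x \<notin> \<Omega>" for x using that U_sub by auto
  note lb = integral_lebesgue_on_eq_lborel[OF borel_measurable_continuous_onI[OF cZ] meas_\<Omega> b0]
  have i: "integrable lborel (\<lambda>x. - ?Z x)" and z: "(LINT x|lborel. - ?Z x) = 0"
    using lb iZ Z0 by (simp_all del: if_not_P)
  have "AE x in lborel. - ?Z x = 0"
    using integral_nonneg_eq_0_iff_AE[OF i] neg z by auto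
  then have "AE x in lborel. ?Z x = 0" by eventually_elim (simp only: neg_equal_0_iff_equal)
  then have Zx: "?Z x = 0" for x by (rule open_AE_eq_0[OF cZ])
  have gr: "grad ?\<phi> x = 0" for x
  proof (cases "x \<in> U")
    case True
    have "g (e x) = 0 \<or> grad e x = 0"
      using Zx[of x] True normsq_pos[of x "grad e x"] U_sub by (auto simp: Q_def)
    then show ?thesis using *(2)[OF True] by auto
  next
    case False
    then show ?thesis using *(3) by auto
  qed
  have "Ck_on 1 UNIV ?\<phi>"
    using *(1) unfolding test_fun_def smooth_on_def by blast
  then have "?\<phi> x = 0"
    by (rule compact_support_differentiable_const[OF _ gr bounded_\<Omega>]) (use K_sub in auto)
  then show False using x b U_K U_sub by (auto simp: T_def flat_fun_def split: if_splits)
qed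

text \<open>A test function supported in \<open>U\<close> vanishes on \<open>K\<close>, where \<mu>
  is concentrated. Green's identity then turns the distributional equation into vanishing integrals
  of the classical divergence against all such functions.\<close>

lemma divergence_E_0: "AE x in lebesgue_on U. divergence (\<lambda>y. A y *v grad e y) x = 0"
proof (rule AE_0_of_test_integrals[OF open_U])
  let ?D = "divergence (\<lambda>y. A y *v grad e y)"
  have CAe: "Ck_on k U (\<lambda>x. (A x *v grad e x) $ i)" for k i
    by (intro Ck_on_matrix_vector open_U Ck_A_U Ck_on_grad Ck_e)
  have CD: "Ck_on 0 U ?D"
    unfolding divergence_def[abs_def]
    by (intro Ck_on_sum open_U) (use CAe[of 1] in \<open>auto simp: Ck_on_Suc Basis_vec_def\<close>)
  show "loc_integrable U ?D"
    using CD by (simp add: Ck_on_0 continuous_on_imp_loc_integrable)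
  fix \<phi> assume tU: "test_fun U \<phi>"
  define S where "S = closure {x. \<phi> x \<noteq> 0}"
  have S: "compact S" "S \<subseteq> U" and \<phi>0: "\<And>x. x \<notin> S \<Longrightarrow> \<phi> x = 0" and C\<phi>: "\<And>k. Ck_on k UNIV \<phi>"
    using tU closure_subset[of "{x. \<phi> x \<noteq> 0}"] by (auto simp: test_fun_def S_def smooth_on_def)
  have t\<Omega>: "test_fun \<Omega> \<phi>" using tU U_sub by (auto simp: test_fun_def)
  have C\<phi>U: "Ck_on k U \<phi>" for k using C\<phi> Ck_on_subset by blast
  have S\<Omega>: "S \<subseteq> \<Omega>" using S(2) U_sub by blast
  have gr0: "grad \<phi> x = 0" if "x \<notin> S" for x
    using frechet_derivative_eq_0_outside[OF compact_imp_closed[OF S(1)] \<phi>0 that]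
    by (simp add: grad_def vec_eq_iff)
  \<comment> \<open>The divergences of \<open>X1\<close> and \<open>X2\<close> share the term
    A\<nabla>E \<bullet> \<nabla>\<phi> by symmetry of \<open>A\<close>; their difference is the
    integrand of Green's identity.\<close>
  define X1 where "X1 = (\<lambda>y. \<phi> y *\<^sub>R (A y *v grad e y))"
  define X2 where "X2 = (\<lambda>y. e y *\<^sub>R (A y *v grad \<phi> y))"
  have CA\<phi>: "Ck_on k U (\<lambda>x. (A x *v grad \<phi> x) $ i)" for k i
    by (intro Ck_on_matrix_vector open_U Ck_A_U Ck_on_grad C\<phi>U)
  have C1: "Ck_on k U (\<lambda>x. X1 x $ i)" for k i
    unfolding X1_def by (simp, intro Ck_on_mult open_U C\<phi>U CAe)
  have C2: "Ck_on k U (\<lambda>x. X2 x $ i)" for k i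
    unfolding X2_def by (simp, intro Ck_on_mult open_U Ck_e CA\<phi>)
  have 1: "X1 x = 0" "X2 x = 0" "A x *v grad \<phi> x = 0" if "x \<notin> S" for x
    using that \<phi>0 gr0 by (auto simp: X1_def X2_def)
  note i1 = integral_divergence_eq_0[OF open_U C1 S 1(1) meas_\<Omega> S\<Omega>]
  note i2 = integral_divergence_eq_0[OF open_U C2 S 1(2) meas_\<Omega> S\<Omega>]
  have pt: "?D x * \<phi> x = divergence X1 x - divergence X2 x - e x * L_op A \<phi> x" if "x \<in> \<Omega>" for x
  proof (cases "x \<in> U")
    case True
    have "divergence X1 x = grad \<phi> x \<bullet> (A x *v grad e x) + \<phi> x * ?D x"
      unfolding X1_def by (rule divergence_scaleR[OF open_U C\<phi>U CAe True])
    moreover have "divergence X2 x = grad e x \<bullet> (A x *v grad \<phi> x) + e x * divergence (\<lambda>y. A y *v grad \<phi> y) x"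
      unfolding X2_def by (rule divergence_scaleR[OF open_U Ck_e CA\<phi> True])
    ultimately show ?thesis
      using A_sym[OF that, of "grad e x" "grad \<phi> x"] by (simp add: L_op_def inner_commute mult.commute)
  next
    case False
    then have n: "x \<notin> S" using S(2) by blast
    note o = divergence_eq_0_outside[OF compact_imp_closed[OF S(1)] _ n]
    show ?thesis using o[of X1] o[of X2] o[of "\<lambda>y. A y *v grad \<phi> y"] 1 \<phi>0[OF n]
      by (simp add: L_op_def)
  qed
  define P where "P = (\<lambda>x. ?D x * \<phi> x)"
  have P0: "P x = 0" if "x \<notin> S" for x using \<phi>0[OF that] by (simp add: P_def)
  have "Ck_on 0 UNIV P"
    by (rule Ck_on_extend_zero[OF open_U _ compact_imp_closed[OF S(1)] S(2) P0])
      (auto simp: P_def intro!: Ck_on_mult open_U CD C\<phi>U)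
  then have cP: "continuous_on UNIV P" by (simp add: Ck_on_0)
  have PU: "P x = 0" if "x \<notin> U" for x using P0 that S(2) by blast
  have P\<Omega>: "P x = 0" if "x \<notin> \<Omega>" for x using P0 that S\<Omega> by blast
  have Um: "U \<in> sets lebesgue" using open_U by auto
  note bm = borel_measurable_continuous_onI[OF cP]
  have iP: "integrable (lebesgue_on \<Omega>) P"
    using integral_lebesgue_on_eq_lborel(2)[OF bm meas_\<Omega> P\<Omega>] integrable_compact_support[OF cP S(1) P0] by simp
  have "(LINT x|lebesgue_on U. ?D x * \<phi> x) = (LINT x|lebesgue_on \<Omega>. P x)"
    using integral_lebesgue_on_eq_lborel(1)[OF bm Um PU] integral_lebesgue_on_eq_lborel(1)[OF bm meas_\<Omega> P\<Omega>]
    by (simp add: P_def)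
  also have "\<dots> = - (LINT x|lebesgue_on \<Omega>. e x * L_op A \<phi> x)"
  proof -
    have "(LINT x|lebesgue_on \<Omega>. e x * L_op A \<phi> x) =
        (LINT x|lebesgue_on \<Omega>. divergence X1 x - divergence X2 x - P x)"
      by (rule Bochner_Integration.integral_cong) (use pt meas_\<Omega> in \<open>auto simp: P_def\<close>)
    then show ?thesis using i1 i2 iP by simp
  qed
  also have "(LINT x|lebesgue_on \<Omega>. e x * L_op A \<phi> x) = (LINT x|\<mu>. \<phi> x)"
    using distr t\<Omega> unfolding distr_L_eq_def e_def by blast
  also have "\<dots> = 0 * c"
    by (rule integral_mu)
      (use \<phi>0 S(2) U_K Ck_on_imp_continuous_on[OF C\<phi>[of 0]] in \<open>auto intro!: borel_measurable_continuous_onI\<close>)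
  finally show "(LINT x|lebesgue_on U. ?D x * \<phi> x) = 0" by simp
qed

end

section \<open>The Hardy inequality from a supersolution\<close>

lemma nn_integral_fatou_bound:
  assumes "\<And>n::nat. f n \<in> borel_measurable M" "AE x in M. (\<lambda>n. f n x) \<longlonglongrightarrow> (g x :: ennreal)"
    and "\<And>n. (\<integral>\<^sup>+x. f n x \<partial>M) \<le> B"
  shows "(\<integral>\<^sup>+x. g x \<partial>M) \<le> B"
proof -
  have "(\<integral>\<^sup>+x. g x \<partial>M) = (\<integral>\<^sup>+x. liminf (\<lambda>n. f n x) \<partial>M)"
  proof (rule nn_integral_cong_AE, use assms(2) in eventually_elim)
    case (elim x)
    then show ?case using lim_imp_Liminf[OF sequentially_bot elim] by simp
  qed
  also have "\<dots> \<le> liminf (\<lambda>n. \<integral>\<^sup>+x. f n x \<partial>M)" by (rule nn_integral_liminf[OF assms(1)])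
  also have "\<dots> \<le> limsup (\<lambda>n. \<integral>\<^sup>+x. f n x \<partial>M)" by (rule Liminf_le_Limsup) simp
  also have "\<dots> \<le> B" by (rule Limsup_bounded) (simp add: assms(3))
  finally show ?thesis .
qed

lemma ennreal_le_of_vanishing_error:
  fixes x a :: ennreal
  assumes "\<And>k::nat. x \<le> a + ennreal C * d k" "d \<longlonglongrightarrow> 0"
  shows "x \<le> a"
proof -
  have "(\<lambda>k. a + ennreal C * d k) \<longlonglongrightarrow> a + ennreal C * 0"
    by (intro tendsto_add tendsto_const ennreal_tendsto_cmult assms(2)) simp
  then show ?thesis using LIMSEQ_le_const[of _ _ x] assms(1) by fastforce
qed

lemma ennreal_le_of_factor:
  fixes x B :: ennreal
  assumes "\<And>\<delta>::real. \<delta> > 0 \<Longrightarrow> x \<le> ennreal ((1 + \<delta>)\<^sup>2) * B"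
  shows "x \<le> B"
proof (cases B)
  case top
  then show ?thesis by simp
next
  case (real b)
  have "(\<lambda>n. ennreal ((1 + 1 / real (Suc n))\<^sup>2 * b)) \<longlonglongrightarrow> ennreal ((1 + 0)\<^sup>2 * b)"
    by (intro tendsto_ennrealI tendsto_intros LIMSEQ_Suc lim_1_over_n)
  moreover have "x \<le> ennreal ((1 + 1 / real (Suc n))\<^sup>2 * b)" for n
    using assms[of "1 / real (Suc n)"] real by (simp add: ennreal_mult del: of_nat_Suc)
  ultimately have "x \<le> ennreal ((1 + 0)\<^sup>2 * b)" by (intro LIMSEQ_le_const) auto
  then show ?thesis using real by simp
qed

lemma ennreal_combine:
  assumes "p \<ge> 0" "q \<ge> 0" "s \<ge> 0"
  shows "ennreal p * (ennreal p * B + ennreal q * d) + ennreal s * d =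
    ennreal (p\<^sup>2) * B + ennreal (s + p * q) * d"
proof -
  have "ennreal (p\<^sup>2) = ennreal p * ennreal p" "ennreal (s + p * q) = ennreal s + ennreal p * ennreal q"
    using assms by (simp_all add: power2_eq_square ennreal_mult)
  then show ?thesis by (simp only: distrib_left distrib_right mult.assoc) (simp only: add_ac)
qed

lemma square_young:
  fixes a b :: real
  assumes "\<delta> > 0"
  shows "a\<^sup>2 \<le> (1 + \<delta>) * b\<^sup>2 + (1 + 1 / \<delta>) * (b - a)\<^sup>2"
proof -
  have "0 \<le> (\<delta> * b + (b - a))\<^sup>2 / \<delta>" using assms by simp
  then show ?thesis using assms by (simp add: field_simps power2_eq_square)
qed

context weighted_domain
begin

lemma normsq_expand:
  assumes "x \<in> \<Omega>"
  shows "normsq_A A x (a + b) = normsq_A A x a + normsq_A A x b + 2 * ((A x *v a) \<bullet> b)"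
  using A_sym[OF assms, of a b]
  by (simp add: normsq_A_def matrix_vector_right_distrib inner_add_left inner_add_right)

lemma normsq_scale: "normsq_A A x (r *\<^sub>R a) = r\<^sup>2 * normsq_A A x a"
  by (simp add: normsq_A_def matrix_vector_scaleR power2_eq_square)

lemma normsq_young:
  assumes "x \<in> \<Omega>" "\<delta> > 0"
  shows "2 * ((A x *v a) \<bullet> b) \<le> \<delta> * normsq_A A x a + normsq_A A x b / \<delta>"
proof -
  have "0 \<le> normsq_A A x (\<delta> *\<^sub>R a + (-1) *\<^sub>R b)" by (rule normsq_nonneg[OF assms(1)])
  also have "\<dots> = \<delta>\<^sup>2 * normsq_A A x a + normsq_A A x b - 2 * \<delta> * ((A x *v a) \<bullet> b)"
    unfolding normsq_expand[OF assms(1)] normsq_scale by (simp add: matrix_vector_scaleR)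
  finally show ?thesis using assms(2) by (simp add: field_simps power2_eq_square)
qed

lemma normsq_add_le:
  assumes "x \<in> \<Omega>" "\<delta> > 0"
  shows "normsq_A A x a \<le> (1 + \<delta>) * normsq_A A x b + (1 + 1 / \<delta>) * normsq_A A x (a - b)"
  using normsq_young[OF assms, of b "a - b"] normsq_expand[OF assms(1), of b "a - b"]
  by (simp add: field_simps)

lemma normsq_bounds:
  obtains \<Lambda> \<theta> where "\<Lambda> > 0" "\<theta> > 0" "\<And>x v. x \<in> \<Omega> \<Longrightarrow> normsq_A A x v \<le> \<Lambda> * (norm v)\<^sup>2"
    "\<And>x v. x \<in> \<Omega> \<Longrightarrow> \<theta> * (norm v)\<^sup>2 \<le> normsq_A A x v"
proof -
  obtain \<theta> where \<theta>: "\<theta> > 0" "\<forall>x\<in>closure \<Omega>. \<forall>\<xi>. (A x *v \<xi>) \<bullet> \<xi> \<ge> \<theta> * (norm \<xi>)\<^sup>2"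
    using ell unfolding elliptic_matrix_def by blast
  have "\<forall>i j. \<exists>B. \<forall>x\<in>\<Omega>. \<bar>A x $ i $ j\<bar> \<le> B"
  proof (intro allI)
    fix i j
    have "continuous_on (closure \<Omega>) (\<lambda>x. A x $ i $ j)"
      using ell by (auto simp: elliptic_matrix_def smooth_upto_def)
    then have "bounded ((\<lambda>x. A x $ i $ j) ` closure \<Omega>)"
      using bounded_\<Omega> by (intro compact_imp_bounded compact_continuous_image) auto
    then show "\<exists>B. \<forall>x\<in>\<Omega>. \<bar>A x $ i $ j\<bar> \<le> B"
      using closure_subset[of \<Omega>] unfolding bounded_iff by fastforce
  qed
  then obtain B where B: "\<And>i j x. x \<in> \<Omega> \<Longrightarrow> \<bar>A x $ i $ j\<bar> \<le> B i j" by metis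
  define \<Lambda> where "\<Lambda> = 1 + (\<Sum>i\<in>UNIV. \<Sum>j\<in>UNIV. \<bar>B i j\<bar>)"
  have "normsq_A A x v \<le> \<Lambda> * (norm v)\<^sup>2" if x: "x \<in> \<Omega>" for x v
  proof -
    have "normsq_A A x v = (\<Sum>i\<in>UNIV. \<Sum>j\<in>UNIV. A x $ i $ j * v $ j * v $ i)"
      by (simp add: normsq_A_def inner_vec_def matrix_vector_mult_def sum_distrib_right)
    also have "\<dots> \<le> (\<Sum>i\<in>UNIV. \<Sum>j\<in>UNIV. \<bar>B i j\<bar> * (norm v)\<^sup>2)"
    proof (intro sum_mono)
      fix i j
      have "\<bar>A x $ i $ j\<bar> * (\<bar>v $ j\<bar> * \<bar>v $ i\<bar>) \<le> \<bar>B i j\<bar> * (norm v * norm v)"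
        by (intro mult_mono component_le_norm_cart) (use B[OF x, of i j] in auto)
      moreover have "A x $ i $ j * v $ j * v $ i \<le> \<bar>A x $ i $ j\<bar> * (\<bar>v $ j\<bar> * \<bar>v $ i\<bar>)"
        by (metis abs_ge_self abs_mult mult.assoc)
      ultimately show "A x $ i $ j * v $ j * v $ i \<le> \<bar>B i j\<bar> * (norm v)\<^sup>2"
        by (simp add: power2_eq_square)
    qed
    also have "\<dots> \<le> \<Lambda> * (norm v)\<^sup>2"
      by (simp add: \<Lambda>_def sum_distrib_right distrib_right)
    finally show ?thesis .
  qed
  moreover have "\<Lambda> > 0" unfolding \<Lambda>_def by (intro add_pos_nonneg sum_nonneg) auto
  moreover have "\<theta> * (norm v)\<^sup>2 \<le> normsq_A A x v" if "x \<in> \<Omega>" for x v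
    using \<theta>(2) that closure_subset[of \<Omega>] unfolding normsq_A_def by blast
  ultimately show ?thesis using that \<theta>(1) by blast
qed

lemma continuous_measurable_\<Omega>: "continuous_on \<Omega> g \<Longrightarrow> g \<in> borel_measurable (lebesgue_on \<Omega>)"
  for g :: "real^'n \<Rightarrow> real"
  by (rule continuous_imp_measurable_on_sets_lebesgue) (use open_\<Omega> in auto)

lemma measurable_normsq:
  assumes "\<And>i. (\<lambda>x. G x $ i) \<in> borel_measurable (lebesgue_on \<Omega>)"
  shows "(\<lambda>x. normsq_A A x (G x)) \<in> borel_measurable (lebesgue_on \<Omega>)"
proof -
  have "(\<lambda>x. A x $ i $ j) \<in> borel_measurable (lebesgue_on \<Omega>)" for i j
    by (rule continuous_measurable_\<Omega>) (use Ck_on_imp_continuous_on[OF Ck_A] in auto)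
  then show ?thesis unfolding normsq_A_def inner_vec_def matrix_vector_mult_def
    by (simp, intro borel_measurable_sum borel_measurable_times assms)
qed

lemma measurable_norm_vec:
  fixes G :: "'a \<Rightarrow> real^'m"
  assumes "\<And>i. (\<lambda>x. G x $ i) \<in> borel_measurable M"
  shows "(\<lambda>x. (norm (G x))\<^sup>2) \<in> borel_measurable M"
  unfolding power2_norm_eq_inner inner_vec_def
  by (simp, intro borel_measurable_sum borel_measurable_times assms)

lemma measurable_on_U:
  assumes "continuous_on V g" "open V" "V \<subseteq> \<Omega>"
  shows "(\<lambda>x. if x \<in> V then g x else (0::real)) \<in> borel_measurable (lebesgue_on \<Omega>)"
proof -
  have "(\<lambda>x. if x \<in> V then g x else 0) \<in> borel_measurable borel"
    using borel_measurable_continuous_on_if[of V g "\<lambda>_. 0"] assms by (simp cong: if_cong)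
  then have "(\<lambda>x. if x \<in> V then g x else 0) \<in> borel_measurable lebesgue"
    by (intro measurable_completion) simp
  then show ?thesis by (rule measurable_restrict_space1)
qed

text \<open>The weight may be unbounded, so the left side is not continuous under L^2 convergence.
  It is truncated at height N; then the limit in k costs only a factor (1 + \<delta>)^2 and an error
  proportional to \<open>d k\<close>. Letting k \<rightarrow> \<infinity>, \<delta> \<rightarrow> 0
  and finally N \<rightarrow> \<infinity> by Fatou gives the claim, even if the right side is
  infinite.\<close>

lemma hardy_closed:
  assumes w: "w \<in> borel_measurable (lebesgue_on \<Omega>)" "\<And>x. w x \<ge> 0"
    and u: "u \<in> borel_measurable (lebesgue_on \<Omega>)" "\<And>k::nat. v k \<in> borel_measurable (lebesgue_on \<Omega>)"
    and G: "\<And>i. (\<lambda>x. G x $ i) \<in> borel_measurable (lebesgue_on \<Omega>)"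
      "\<And>k i. (\<lambda>x. H k x $ i) \<in> borel_measurable (lebesgue_on \<Omega>)"
    and le: "\<And>k. (\<integral>\<^sup>+x. ennreal (w x * (v k x)\<^sup>2) \<partial>lebesgue_on \<Omega>) \<le>
        (\<integral>\<^sup>+x. ennreal (normsq_A A x (H k x)) \<partial>lebesgue_on \<Omega>)"
    and lim: "(\<lambda>k. \<integral>\<^sup>+x. ennreal ((v k x - u x)\<^sup>2 + (norm (H k x - G x))\<^sup>2) \<partial>lebesgue_on \<Omega>) \<longlonglongrightarrow> 0"
  shows "(\<integral>\<^sup>+x. ennreal (w x * (u x)\<^sup>2) \<partial>lebesgue_on \<Omega>) \<le> (\<integral>\<^sup>+x. ennreal (normsq_A A x (G x)) \<partial>lebesgue_on \<Omega>)"
    (is "_ \<le> ?B")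
proof -
  define M where "M = lebesgue_on \<Omega>"
  have sp: "x \<in> space M \<Longrightarrow> x \<in> \<Omega>" for x by (simp add: M_def)
  note [measurable] = w(1)[folded M_def] u[folded M_def]
  note [measurable] = measurable_normsq[OF G(1), folded M_def] measurable_normsq[OF G(2), folded M_def]
  define D where "D k x = (v k x - u x)\<^sup>2 + (norm (H k x - G x))\<^sup>2" for k x
  define d where "d k = (\<integral>\<^sup>+x. ennreal (D k x) \<partial>M)" for k
  have D0: "D k x \<ge> 0" for k x by (simp add: D_def)
  have [measurable]: "D k \<in> borel_measurable M" for k
    unfolding D_def
    by (intro borel_measurable_add measurable_norm_vec borel_measurable_power borel_measurable_diff)
      (use u G in \<open>auto simp: M_def\<close>)
  have d: "d \<longlonglongrightarrow> 0" using lim unfolding d_def D_def M_def .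
  obtain \<Lambda> where \<Lambda>: "\<Lambda> > 0" "\<And>x v. x \<in> \<Omega> \<Longrightarrow> normsq_A A x v \<le> \<Lambda> * (norm v)\<^sup>2"
    using normsq_bounds by metis
  have trunc: "(\<integral>\<^sup>+x. ennreal (min (w x) (real N) * (u x)\<^sup>2) \<partial>M) \<le> ?B" for N :: nat
  proof (rule ennreal_le_of_factor)
    fix \<delta> :: real assume \<delta>: "\<delta> > 0"
    \<comment> \<open>The first summand is the error of exchanging u for \<open>v k\<close> under
      the truncated weight; the second is the error of exchanging the gradients, enlarged by the
      factor 1 + \<delta> of the first exchange.\<close>
    define C where "C = (1 + 1 / \<delta>) * real N + (1 + \<delta>) * ((1 + 1 / \<delta>) * \<Lambda>)"
    show "(\<integral>\<^sup>+x. ennreal (min (w x) (real N) * (u x)\<^sup>2) \<partial>M) \<le> ennreal ((1 + \<delta>)\<^sup>2) * ?B"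
    proof (rule ennreal_le_of_vanishing_error[OF _ d, of _ _ C])
      fix k
      have "(\<integral>\<^sup>+x. ennreal (min (w x) (real N) * (u x)\<^sup>2) \<partial>M) \<le>
          (\<integral>\<^sup>+x. ennreal (1 + \<delta>) * ennreal (w x * (v k x)\<^sup>2) + ennreal ((1 + 1 / \<delta>) * real N) * ennreal (D k x) \<partial>M)"
      proof (rule nn_integral_mono)
        fix x
        have "min (w x) (real N) * (u x)\<^sup>2 \<le>
            min (w x) (real N) * ((1 + \<delta>) * (v k x)\<^sup>2 + (1 + 1 / \<delta>) * (v k x - u x)\<^sup>2)"
          using w(2)[of x] by (intro mult_left_mono square_young \<delta>) auto
        also have "\<dots> = (1 + \<delta>) * (min (w x) (real N) * (v k x)\<^sup>2) +
            (1 + 1 / \<delta>) * (min (w x) (real N) * (v k x - u x)\<^sup>2)"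
          by (simp add: algebra_simps)
        also have "\<dots> \<le> (1 + \<delta>) * (w x * (v k x)\<^sup>2) + (1 + 1 / \<delta>) * (real N * D k x)"
          using \<delta> w(2)[of x] by (intro add_mono mult_left_mono mult_mono) (auto simp: D_def)
        finally have "ennreal (min (w x) (real N) * (u x)\<^sup>2) \<le>
            ennreal ((1 + \<delta>) * (w x * (v k x)\<^sup>2) + (1 + 1 / \<delta>) * real N * D k x)"
          by (intro ennreal_leI) (simp add: mult.assoc)
        then show "ennreal (min (w x) (real N) * (u x)\<^sup>2) \<le>
            ennreal (1 + \<delta>) * ennreal (w x * (v k x)\<^sup>2) + ennreal ((1 + 1 / \<delta>) * real N) * ennreal (D k x)"
          using \<delta> w(2)[of x] D0[of k x] by (simp flip: ennreal_mult' ennreal_plus)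
      qed
      also have "\<dots> = ennreal (1 + \<delta>) * (\<integral>\<^sup>+x. ennreal (w x * (v k x)\<^sup>2) \<partial>M) + ennreal ((1 + 1 / \<delta>) * real N) * d k"
        unfolding d_def by (simp add: nn_integral_add nn_integral_cmult)
      finally have 1: "(\<integral>\<^sup>+x. ennreal (min (w x) (real N) * (u x)\<^sup>2) \<partial>M) \<le> \<dots>" .
      have "(\<integral>\<^sup>+x. ennreal (w x * (v k x)\<^sup>2) \<partial>M) \<le> (\<integral>\<^sup>+x. ennreal (normsq_A A x (H k x)) \<partial>M)"
        using le unfolding M_def .
      also have "\<dots> \<le> (\<integral>\<^sup>+x. ennreal (1 + \<delta>) * ennreal (normsq_A A x (G x)) + ennreal ((1 + 1 / \<delta>) * \<Lambda>) * ennreal (D k x) \<partial>M)"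
      proof (rule nn_integral_mono)
        fix x assume "x \<in> space M"
        then have x: "x \<in> \<Omega>" by (rule sp)
        have "normsq_A A x (H k x) \<le> (1 + \<delta>) * normsq_A A x (G x) + (1 + 1 / \<delta>) * normsq_A A x (H k x - G x)"
          by (rule normsq_add_le[OF x \<delta>])
        moreover have "normsq_A A x (H k x - G x) \<le> \<Lambda> * D k x"
          using \<Lambda>(2)[OF x, of "H k x - G x"] mult_nonneg_nonneg[of \<Lambda> "(v k x - u x)\<^sup>2"] \<Lambda>(1)
          by (simp add: D_def distrib_left add_increasing)
        then have "(1 + 1 / \<delta>) * normsq_A A x (H k x - G x) \<le> (1 + 1 / \<delta>) * (\<Lambda> * D k x)"
          using \<delta> by (intro mult_left_mono) auto
        ultimately have "ennreal (normsq_A A x (H k x)) \<le>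
            ennreal ((1 + \<delta>) * normsq_A A x (G x) + (1 + 1 / \<delta>) * \<Lambda> * D k x)"
          unfolding mult.assoc by (intro ennreal_leI) (meson add_left_mono order_trans)
        then show "ennreal (normsq_A A x (H k x)) \<le>
            ennreal (1 + \<delta>) * ennreal (normsq_A A x (G x)) + ennreal ((1 + 1 / \<delta>) * \<Lambda>) * ennreal (D k x)"
          using \<delta> \<Lambda>(1) normsq_nonneg[OF x] D0[of k x] by (simp flip: ennreal_mult' ennreal_plus)
      qed
      also have "\<dots> = ennreal (1 + \<delta>) * ?B + ennreal ((1 + 1 / \<delta>) * \<Lambda>) * d k"
        unfolding d_def M_def[symmetric] by (simp add: nn_integral_add nn_integral_cmult)
      finally have 2: "(\<integral>\<^sup>+x. ennreal (w x * (v k x)\<^sup>2) \<partial>M) \<le> \<dots>" .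
      have "(\<integral>\<^sup>+x. ennreal (min (w x) (real N) * (u x)\<^sup>2) \<partial>M) \<le>
          ennreal (1 + \<delta>) * (ennreal (1 + \<delta>) * ?B + ennreal ((1 + 1 / \<delta>) * \<Lambda>) * d k) + ennreal ((1 + 1 / \<delta>) * real N) * d k"
        by (rule order_trans[OF 1 add_right_mono[OF mult_left_mono[OF 2]]]) simp
      also have "\<dots> = ennreal ((1 + \<delta>)\<^sup>2) * ?B + ennreal C * d k"
        unfolding C_def using \<delta> \<Lambda>(1) by (intro ennreal_combine) auto
      finally show "(\<integral>\<^sup>+x. ennreal (min (w x) (real N) * (u x)\<^sup>2) \<partial>M) \<le> ennreal ((1 + \<delta>)\<^sup>2) * ?B + ennreal C * d k" .
    qed
  qed
  have "(\<integral>\<^sup>+x. ennreal (w x * (u x)\<^sup>2) \<partial>M) \<le> ?B"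
  proof (rule nn_integral_fatou_bound[OF _ _ trunc])
    show "AE x in M. (\<lambda>N. ennreal (min (w x) (real N) * (u x)\<^sup>2)) \<longlonglongrightarrow> ennreal (w x * (u x)\<^sup>2)"
    proof (intro AE_I2 tendsto_eventually)
      fix x
      obtain N0 :: nat where "w x \<le> real N0" using real_arch_simple by blast
      then have "min (w x) (real N) = w x" if "N \<ge> N0" for N using that by auto
      then show "\<forall>\<^sub>F N in sequentially. ennreal (min (w x) (real N) * (u x)\<^sup>2) = ennreal (w x * (u x)\<^sup>2)"
        by (auto simp: eventually_sequentially intro!: exI[of _ N0])
    qed
  qed measurable
  then show ?thesis unfolding M_def .
qed

lemma hardy_compact_support:
  assumes r: "Ck_on 1 {\<gamma><..} r" and W: "continuous_on {\<gamma><..} W" "\<And>t. t > \<gamma> \<Longrightarrow> W t \<ge> 0"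
    and ric: "\<And>t. t > \<gamma> \<Longrightarrow> deriv r t + W t + (r t)\<^sup>2 \<le> 0" and \<epsilon>: "\<epsilon> > 0"
    and \<psi>: "Ck_on 1 U \<psi>" and R: "compact R" "R \<subseteq> U" "\<And>x. x \<notin> R \<Longrightarrow> \<psi> x = 0"
  shows "(\<integral>\<^sup>+x. ennreal ((if x \<in> U then W (e x + \<epsilon>) * Q x else 0) * (\<psi> x)\<^sup>2) \<partial>lebesgue_on \<Omega>) \<le>
    (\<integral>\<^sup>+x. ennreal (normsq_A A x (grad \<psi> x)) \<partial>lebesgue_on \<Omega>)"
proof -
  have R\<Omega>: "R \<subseteq> \<Omega>" using R U_sub by blast
  have cR: "closed R" using R(1) compact_imp_closed by blast
  have gt: "e x + \<epsilon> > \<gamma>" if "x \<in> U" for x using E_ge_boundary[OF that] \<epsilon> by linarith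
  have Ce: "Ck_on k U (\<lambda>x. e x + \<epsilon>)" for k by (intro Ck_on_add open_U Ck_e) auto
  have gr0: "grad \<psi> x = 0" if "x \<notin> R" for x
    using frechet_derivative_eq_0_outside[OF cR R(3) that] by (simp add: grad_def vec_eq_iff)
  define Y where "Y x = (if x \<in> U then W (e x + \<epsilon>) * Q x else 0) * (\<psi> x)\<^sup>2" for x
  define P where "P x = normsq_A A x (grad \<psi> x)" for x
  have Y0: "Y x = 0" if "x \<notin> R" for x using R(3)[OF that] by (simp add: Y_def)
  have P0: "P x = 0" if "x \<notin> R" for x using gr0[OF that] by (simp add: P_def normsq_A_def)
  have "Ck_on 0 U (\<lambda>x. W (e x + \<epsilon>) * Q x * (\<psi> x)\<^sup>2)"
    using Ck_on_imp_continuous_on[OF \<psi>] W(1) gt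
    by (intro Ck_on_mult Ck_on_power Ck_on_compose[OF open_U _ Ce] open_U Ck_Q) (auto simp: Ck_on_0)
  then have "Ck_on 0 U Y" by (rule Ck_on_cong[OF open_U, rotated]) (auto simp: Y_def)
  then have cY: "continuous_on UNIV Y"
    unfolding Ck_on_0[symmetric] using Ck_on_extend_zero[where f = Y, OF open_U _ cR R(2) Y0] by blast
  have "Ck_on 0 U P" unfolding P_def normsq_A_def inner_vec_def
    by (simp, intro Ck_on_sum Ck_on_mult Ck_on_matrix_vector Ck_on_grad Ck_A_U open_U) (use \<psi> in auto)
  then have cP: "continuous_on UNIV P"
    unfolding Ck_on_0[symmetric] using Ck_on_extend_zero[where f = P, OF open_U _ cR R(2) P0] by blast
  have z: "x \<notin> \<Omega> \<Longrightarrow> Y x = 0" "x \<notin> \<Omega> \<Longrightarrow> P x = 0" for x using Y0 P0 R\<Omega> by auto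
  have iY: "integrable (lebesgue_on \<Omega>) Y" and iP: "integrable (lebesgue_on \<Omega>) P"
    using integral_lebesgue_on_eq_lborel(2)[OF borel_measurable_continuous_onI meas_\<Omega>] z cY cP
      integrable_compact_support[OF cY R(1) Y0] integrable_compact_support[OF cP R(1) P0] by auto
  define u where "u = (\<lambda>x. \<psi> x * \<psi> x * r (e x + \<epsilon>))"
  define X where "X = (\<lambda>x. u x *\<^sub>R (A x *v grad e x))"
  have CAe: "Ck_on k U (\<lambda>x. (A x *v grad e x) $ i)" for k i
    by (intro Ck_on_matrix_vector open_U Ck_A_U Ck_on_grad Ck_e)
  have Cr: "Ck_on 1 U (\<lambda>x. r (e x + \<epsilon>))"
    by (rule Ck_on_compose[OF open_U r Ce]) (use gt in auto)
  have Cu: "Ck_on 1 U u" unfolding u_def by (intro Ck_on_mult open_U \<psi> Cr)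
  have CX: "Ck_on 1 U (\<lambda>x. X x $ i)" for i unfolding X_def
    by (simp, intro Ck_on_mult open_U) (use Cu CAe in auto)
  have X0: "X x = 0" if "x \<notin> R" for x using R(3)[OF that] by (simp add: X_def u_def)
  note div = integral_divergence_eq_0[OF open_U CX R(1,2) X0 meas_\<Omega> R\<Omega>]
  have AEd: "AE x in lebesgue_on \<Omega>. x \<in> U \<longrightarrow> divergence (\<lambda>y. A y *v grad e y) x = 0"
  proof -
    have "AE x in lebesgue. x \<in> U \<longrightarrow> divergence (\<lambda>y. A y *v grad e y) x = 0"
      using divergence_E_0 open_U by (simp add: AE_restrict_space_iff)
    then show ?thesis using meas_\<Omega> by (auto simp: AE_restrict_space_iff elim: eventually_mono)
  qed
  have "AE x in lebesgue_on \<Omega>. divergence X x + Y x \<le> P x"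
    using AEd
  proof eventually_elim
    case (elim x)
    show ?case
    proof (cases "x \<in> U")
      case False
      then have n: "x \<notin> R" using R(2) by blast
      then show ?thesis using divergence_eq_0_outside[OF cR X0 n] Y0[OF n] P0[OF n] by simp
    next
      case True
      let ?t = "e x + \<epsilon>"
      have x\<Omega>: "x \<in> \<Omega>" using True U_sub by blast
      have d: "\<psi> differentiable (at x)" "e differentiable (at x)" "(\<lambda>x. \<psi> x * \<psi> x) differentiable (at x)"
        "(\<lambda>x. r (e x + \<epsilon>)) differentiable (at x)" "(\<lambda>x. e x + \<epsilon>) differentiable (at x)"
        using True \<psi> Cr Ck_e[of 1] by (auto simp: Ck_on_Suc intro!: derivative_intros)
      have "grad (\<lambda>x. r (e x + \<epsilon>)) x = deriv r ?t *\<^sub>R grad (\<lambda>x. e x + \<epsilon>) x"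
        using Ck_on_SucD_real(1)[of "{\<gamma><..}" 0 r] r gt[OF True]
        by (intro grad_compose_real d) auto
      moreover have "grad (\<lambda>x. e x + \<epsilon>) x = grad e x"
        using frechet_derivative_add[OF d(2), of "\<lambda>_. \<epsilon>"] by (simp add: grad_def vec_eq_iff)
      ultimately have "grad u x = (\<psi> x * \<psi> x) *\<^sub>R (deriv r ?t *\<^sub>R grad e x) + r ?t *\<^sub>R ((2 * \<psi> x) *\<^sub>R grad \<psi> x)"
        unfolding u_def grad_mult[OF d(3,4)] grad_mult[OF d(1,1)] by (simp add: scaleR_left_distrib[symmetric])
      then have "divergence X x = \<psi> x * \<psi> x * deriv r ?t * Q x + 2 * (\<psi> x * r ?t) * (grad \<psi> x \<bullet> (A x *v grad e x))"
        using divergence_scaleR[OF open_U Cu CAe True, folded X_def] elim True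
        by (simp add: inner_add_left Q_def normsq_A_def inner_commute algebra_simps)
      also have "2 * (\<psi> x * r ?t) * (grad \<psi> x \<bullet> (A x *v grad e x)) = 2 * ((A x *v ((\<psi> x * r ?t) *\<^sub>R grad e x)) \<bullet> grad \<psi> x)"
        by (simp add: matrix_vector_scaleR inner_commute)
      \<comment> \<open>Young's inequality with parameter 1 completes the square: it leaves
        |\<nabla>\<psi>|^2 with coefficient exactly 1 and creates the term r^2 of the Riccati
        inequality.\<close>
      also have "\<dots> \<le> 1 * normsq_A A x ((\<psi> x * r ?t) *\<^sub>R grad e x) + P x / 1"
        unfolding P_def by (rule normsq_young[OF x\<Omega>]) simp
      also have "normsq_A A x ((\<psi> x * r ?t) *\<^sub>R grad e x) = (\<psi> x * r ?t)\<^sup>2 * Q x"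
        unfolding normsq_scale Q_def ..
      finally have "divergence X x + Y x \<le> (\<psi> x)\<^sup>2 * Q x * (deriv r ?t + W ?t + (r ?t)\<^sup>2) + P x"
        using True by (simp add: Y_def algebra_simps power2_eq_square)
      moreover have "(\<psi> x)\<^sup>2 * Q x * (deriv r ?t + W ?t + (r ?t)\<^sup>2) \<le> 0"
        using Q_nonneg[OF True] ric[OF gt[OF True]] by (intro mult_nonneg_nonpos) auto
      ultimately show ?thesis by linarith
    qed
  qed
  then have "(LINT x|lebesgue_on \<Omega>. divergence X x + Y x) \<le> (LINT x|lebesgue_on \<Omega>. P x)"
    using div iY iP by (intro integral_mono_AE) auto
  then have le: "(LINT x|lebesgue_on \<Omega>. Y x) \<le> (LINT x|lebesgue_on \<Omega>. P x)"
    using div iY by simp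
  have "Y x \<ge> 0" for x using W(2)[OF gt] Q_nonneg by (auto simp: Y_def)
  moreover have "AE x in lebesgue_on \<Omega>. P x \<ge> 0"
    using normsq_nonneg meas_\<Omega> by (intro AE_I2) (auto simp: P_def)
  ultimately show ?thesis
    using le iY iP unfolding Y_def[symmetric] P_def[symmetric]
    by (simp add: nn_integral_eq_integral ennreal_leI)
qed

end

section \<open>Removing the singular set \<open>K\<close>\<close>

lemma deriv_smooth_step_bound:
  obtains C where "C \<ge> 0" "\<And>x. \<bar>deriv smooth_step x\<bar> \<le> C" "\<And>x. x \<notin> {0..1} \<Longrightarrow> deriv smooth_step x = 0"
    "\<And>k. Ck_on k UNIV (deriv smooth_step)" "\<And>x. (smooth_step has_real_derivative deriv smooth_step x) (at x)"
proof -
  note D = Ck_on_SucD_real[OF open_UNIV Ck_on_smooth_step]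
  have z: "deriv smooth_step x = 0" if "x \<notin> {0..1}" for x
  proof -
    have "(smooth_step has_real_derivative 0) (at x)"
    proof (cases "x < 0")
      case True
      have "((\<lambda>_. 0) has_real_derivative 0) (at x)" by simp
      then show ?thesis
        by (rule has_field_derivative_transform_within_open[of _ _ _ "{..<0}"])
          (use True in \<open>auto simp: smooth_step_simps\<close>)
    next
      case False
      have "((\<lambda>_. 1) has_real_derivative 0) (at x)" by simp
      then show ?thesis
        by (rule has_field_derivative_transform_within_open[of _ _ _ "{1<..}"])
          (use False that in \<open>auto simp: smooth_step_simps\<close>)
    qed
    then show ?thesis by (rule DERIV_imp_deriv)
  qed
  have "continuous_on UNIV (deriv smooth_step)" using D(2)[of 0] by (simp add: Ck_on_0)
  then obtain C where "C \<ge> 0" "\<And>x. \<bar>deriv smooth_step x\<bar> \<le> C"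
    using bounded_compact_support[of "deriv smooth_step" "{0..1}"] z compact_Icc by metis
  then show ?thesis using that z D by blast
qed

lemma test_fun_props:
  assumes "test_fun \<Omega> \<phi>"
  obtains S where "compact S" "S \<subseteq> \<Omega>" "\<And>x. x \<notin> S \<Longrightarrow> \<phi> x = 0" "\<And>x. x \<notin> S \<Longrightarrow> grad \<phi> x = 0"
    "\<And>k. Ck_on k UNIV \<phi>" "\<And>k i. Ck_on k UNIV (\<lambda>x. grad \<phi> x $ i)"
proof -
  define S where "S = closure {x. \<phi> x \<noteq> 0}"
  have S: "compact S" "S \<subseteq> \<Omega>" and C: "\<And>k. Ck_on k UNIV \<phi>" and \<phi>0: "\<And>x. x \<notin> S \<Longrightarrow> \<phi> x = 0"
    using assms closure_subset[of "{x. \<phi> x \<noteq> 0}"] by (auto simp: test_fun_def S_def smooth_on_def)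
  have g0: "grad \<phi> x = 0" if "x \<notin> S" for x
    using frechet_derivative_eq_0_outside[OF compact_imp_closed[OF S(1)] \<phi>0 that]
    by (simp add: grad_def vec_eq_iff)
  show ?thesis by (rule that[OF S \<phi>0 g0 C Ck_on_grad[OF C]])
qed

lemma norm_add_square_le: "(norm (a + b :: 'a::real_inner))\<^sup>2 \<le> 2 * (norm a)\<^sup>2 + 2 * (norm b)\<^sup>2"
proof -
  have "(norm (a + b))\<^sup>2 \<le> (norm a + norm b)\<^sup>2" by (intro power_mono norm_triangle_ineq) simp
  also have "\<dots> \<le> 2 * (norm a)\<^sup>2 + 2 * (norm b)\<^sup>2"
    using zero_le_power2[of "norm a - norm b"] by (simp add: power2_eq_square algebra_simps)
  finally show ?thesis .
qed

context weighted_domain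
begin

text \<open>Such a point is an interior minimum of \<open>e\<close>. Hence W(E)|\<nabla>E|^2 may be
  set to 0 there, although \<open>W\<close> carries no information at \<gamma>.\<close>

lemma Q_eq_0_at_boundary_value:
  assumes "x \<in> U" "e x = \<gamma>"
  shows "Q x = 0"
proof -
  have d: "(e has_derivative frechet_derivative e (at x)) (at x)"
    using differentiable_e[OF assms(1)] by (simp add: frechet_derivative_works)
  have "frechet_derivative e (at x) = (\<lambda>v. 0)"
    by (rule differential_zero_maxmin[OF assms(1) open_U d]) (use E_ge_boundary assms in auto)
  then show ?thesis by (simp add: Q_def grad_def normsq_A_def inner_vec_def)
qed

lemma AE_U: "AE x in lebesgue_on \<Omega>. x \<in> U"
proof -
  have "AE x in lebesgue. x \<notin> K" by (rule AE_not_in[OF K_null])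
  then have "AE x in lebesgue. x \<in> \<Omega> \<longrightarrow> x \<in> U"
    by eventually_elim (use \<Omega>_eq in blast)
  then show ?thesis using meas_\<Omega> by (simp add: AE_restrict_space_iff)
qed

lemma continuous_compact_integrable_\<Omega>:
  assumes "continuous_on UNIV g" "compact S" "S \<subseteq> \<Omega>" "\<And>x. x \<notin> S \<Longrightarrow> g x = 0"
  shows "integrable (lebesgue_on \<Omega>) (g :: real^'n \<Rightarrow> real)"
  using integral_lebesgue_on_eq_lborel(2)[OF borel_measurable_continuous_onI[OF assms(1)] meas_\<Omega>]
    integrable_compact_support[OF assms(1,2,4)] assms(3,4) by blast

lemma continuous_UNIV_measurable_\<Omega>:
  "continuous_on UNIV g \<Longrightarrow> g \<in> borel_measurable (lebesgue_on \<Omega>)" for g :: "real^'n \<Rightarrow> real"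
  by (rule continuous_measurable_\<Omega>) (auto intro: continuous_on_subset)

text \<open>Cutting off near \<open>K\<close> by a function of \<open>E\<close>: by the coarea identity the energy of the
  cutoff between the levels \<open>k\<close> and \<open>2k\<close> is of order \<open>1/k\<close>.\<close>

lemma cutoff_near_K:
  assumes \<phi>: "test_fun \<Omega> \<phi>"
  obtains \<psi> :: "nat \<Rightarrow> real^'n \<Rightarrow> real" and R where "\<And>n. Ck_on 1 U (\<psi> n)" "\<And>n. compact (R n)" "\<And>n. R n \<subseteq> U"
    "\<And>n x. x \<notin> R n \<Longrightarrow> \<psi> n x = 0"
    "(\<lambda>n. \<integral>\<^sup>+x. ennreal ((\<psi> n x - \<phi> x)\<^sup>2 + (norm (grad (\<psi> n) x - grad \<phi> x))\<^sup>2) \<partial>lebesgue_on \<Omega>) \<longlonglongrightarrow> 0"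
proof -
  obtain C where C: "C \<ge> 0" "\<And>x. \<bar>deriv smooth_step x\<bar> \<le> C" "\<And>x. x \<notin> {0..1} \<Longrightarrow> deriv smooth_step x = 0"
    "\<And>k. Ck_on k UNIV (deriv smooth_step)" "\<And>x. (smooth_step has_real_derivative deriv smooth_step x) (at x)"
    using deriv_smooth_step_bound by metis
  obtain S where S: "compact S" "S \<subseteq> \<Omega>" "\<And>x. x \<notin> S \<Longrightarrow> \<phi> x = 0" "\<And>x. x \<notin> S \<Longrightarrow> grad \<phi> x = 0"
    "\<And>k. Ck_on k UNIV \<phi>" "\<And>k i. Ck_on k UNIV (\<lambda>x. grad \<phi> x $ i)"
    using test_fun_props[OF \<phi>] by metis
  obtain \<theta> where \<theta>: "\<theta> > 0" "\<And>x v. x \<in> \<Omega> \<Longrightarrow> \<theta> * (norm v)\<^sup>2 \<le> normsq_A A x v"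
    using normsq_bounds by metis
  have c\<phi>: "continuous_on UNIV \<phi>" using Ck_on_imp_continuous_on[OF S(5)[of 0]] .
  obtain B where B: "B \<ge> 0" "\<And>x. \<bar>\<phi> x\<bar> \<le> B" using bounded_compact_support[OF c\<phi> S(1,3)] by metis
  obtain N0 :: nat where N0: "real N0 \<ge> \<bar>\<gamma>\<bar>" using real_arch_simple by blast
  \<comment> \<open>The shift makes every level positive and larger than \<gamma>, as the coarea
    identity requires.\<close>
  define k where "k n = real (n + N0 + 1)" for n
  have k: "k n > 0" "k n > \<gamma>" "k n \<ge> real n" for n using N0 by (auto simp: k_def)
  \<comment> \<open>\<sigma> rises from 0 at level k to 1 at level 2k, so \<psi> agrees with \<phi>
    on the part of \<open>U\<close> below level k and vanishes above level 2k.\<close>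
  define \<sigma> where "\<sigma> n s = smooth_step (s / k n - 1)" for n s
  define \<psi> where "\<psi> n x = (if x \<in> U then \<phi> x * (1 - \<sigma> n (e x)) else 0)" for n x
  define R where "R n = S \<inter> (closure \<Omega> \<inter> E -` {..ereal (2 * k n)})" for n
  define \<sigma>' where "\<sigma>' n s = deriv smooth_step (s / k n - 1) / k n" for n s
  have C\<sigma>: "Ck_on m UNIV (\<sigma> n)" "Ck_on m UNIV (\<sigma>' n)" for m n
    unfolding \<sigma>_def \<sigma>'_def using k(1)[of n]
    by (auto intro!: Ck_on_divide Ck_on_compose[OF _ Ck_on_smooth_step] Ck_on_compose[OF _ C(4)] Ck_on_diff Ck_on_id)
  have D\<sigma>: "(\<sigma> n has_real_derivative \<sigma>' n s) (at s)" for n s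
  proof -
    have "((\<lambda>s. s / k n - 1) has_real_derivative 1 / k n) (at s)" using k(1)[of n] by (auto intro!: derivative_eq_intros)
    from DERIV_chain2[OF C(5) this] show ?thesis by (simp add: \<sigma>_def[abs_def] \<sigma>'_def)
  qed
  have 1: "Ck_on 1 U (\<psi> n)" for n
  proof (rule Ck_on_cong[OF open_U])
    show "Ck_on 1 U (\<lambda>x. \<phi> x * (1 - \<sigma> n (e x)))"
      by (intro Ck_on_mult Ck_on_diff open_U Ck_on_compose[OF open_U C\<sigma>(1) Ck_e] Ck_on_subset[OF S(5)]) auto
  qed (simp add: \<psi>_def)
  have "closed (closure \<Omega> \<inter> E -` {..ereal (2 * k n)})" for n
    by (rule continuous_closed_preimage) (use cont_E in auto)
  then have 2: "compact (R n)" for n unfolding R_def using S(1) by (intro compact_Int_closed)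
  have 3: "R n \<subseteq> U" for n using S(2) E_K by (auto simp: R_def U_def)
  have 4: "\<psi> n x = 0" if "x \<notin> R n" for n x
  proof (cases "x \<in> U \<and> x \<in> S")
    case True
    then have "e x > 2 * k n" using that E_eq_U[of x] U_sub closure_subset[of \<Omega>] by (auto simp: R_def)
    then have "\<sigma> n (e x) = 1" unfolding \<sigma>_def using k(1)[of n]
      by (intro smooth_step_simps(2)) (simp add: field_simps)
    then show ?thesis by (simp add: \<psi>_def)
  qed (use S(3) in \<open>auto simp: \<psi>_def\<close>)
  define F where "F x = (\<phi> x)\<^sup>2 + 2 * (norm (grad \<phi> x))\<^sup>2" for x
  have cF: "continuous_on UNIV F" unfolding F_def power2_norm_eq_inner inner_vec_def inner_real_def
    by (intro continuous_on_add continuous_on_power continuous_on_mult continuous_on_sum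
        continuous_on_const c\<phi> Ck_on_imp_continuous_on[OF S(6)])
  have iF: "integrable (lebesgue_on \<Omega>) F"
    by (rule continuous_compact_integrable_\<Omega>[OF cF S(1,2)]) (use S(3,4) in \<open>auto simp: F_def\<close>)
  have F0: "F x \<ge> 0" for x by (simp add: F_def)
  \<comment> \<open>\<open>a\<close> collects the errors carrying the factor \<sigma>: they are
    dominated by \<open>F\<close> and vanish at each point once the level exceeds E there.
    \<open>b\<close> is the energy of the cutoff itself.\<close>
  define a where "a n x = (if x \<in> U then (\<sigma> n (e x))\<^sup>2 * F x else 0)" for n x
  define b where "b n x = (if x \<in> U then (\<sigma>' n (e x))\<^sup>2 * Q x else 0)" for n x
  have am: "a n \<in> borel_measurable (lebesgue_on \<Omega>)" for n
    unfolding a_def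
  proof (rule measurable_on_U[OF _ open_U U_sub])
    have "Ck_on 0 U (\<lambda>x. \<sigma> n (e x))" by (rule Ck_on_compose[OF open_U C\<sigma>(1) Ck_e]) simp
    then show "continuous_on U (\<lambda>x. (\<sigma> n (e x))\<^sup>2 * F x)"
      using cF by (auto intro!: continuous_intros intro: continuous_on_subset simp: Ck_on_0)
  qed
  have a0: "a n x \<ge> 0" "a n x \<le> F x" for n x
    using F0[of x] smooth_step_bounds[of "e x / k n - 1"]
    by (auto simp: a_def \<sigma>_def intro!: mult_left_le_one_le power_le_one)
  have lima: "(\<lambda>n. \<integral>\<^sup>+x. ennreal (a n x) \<partial>lebesgue_on \<Omega>) \<longlonglongrightarrow> 0"
  proof -
    have "(\<lambda>n. \<integral>\<^sup>+x. ennreal (a n x) \<partial>lebesgue_on \<Omega>) \<longlonglongrightarrow> (\<integral>\<^sup>+x. 0 \<partial>lebesgue_on \<Omega>)"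
    proof (rule nn_integral_dominated_convergence[where w = "\<lambda>x. ennreal (F x)"])
      show "(\<integral>\<^sup>+x. ennreal (F x) \<partial>lebesgue_on \<Omega>) < \<infinity>"
        using iF F0 by (simp add: nn_integral_eq_integral)
      show "AE x in lebesgue_on \<Omega>. ennreal (a n x) \<le> ennreal (F x)" for n
        by (intro AE_I2 ennreal_leI a0)
      show "AE x in lebesgue_on \<Omega>. (\<lambda>n. ennreal (a n x)) \<longlonglongrightarrow> 0"
      proof (intro AE_I2 tendsto_eventually)
        fix x
        obtain m :: nat where m: "e x \<le> real m" using real_arch_simple by blast
        have "a n x = 0" if "n \<ge> m" for n
        proof -
          have "e x \<le> k n" using m that k(3)[of n] by linarith
          then have "\<sigma> n (e x) = 0" unfolding \<sigma>_def using k(1)[of n]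
            by (intro smooth_step_simps(1)) (simp add: field_simps)
          then show ?thesis by (simp add: a_def)
        qed
        then show "\<forall>\<^sub>F n in sequentially. ennreal (a n x) = 0"
          by (auto simp: eventually_sequentially intro!: exI[of _ m])
      qed
    qed (use am iF in auto)
    then show ?thesis by simp
  qed
  have b0: "b n x \<ge> 0" for n x using Q_nonneg by (auto simp: b_def)
  have supp: "(\<sigma>' n s)\<^sup>2 = 0" if "s \<notin> {k n..2 * k n}" for n s
  proof -
    have "s / k n - 1 \<notin> {0..1}" using that k(1)[of n] by (auto simp: field_simps)
    then show ?thesis using C(3) by (simp add: \<sigma>'_def)
  qed
  have gk: "Ck_on m UNIV (\<lambda>s. (\<sigma>' n s)\<^sup>2)" for m n by (intro Ck_on_power C\<sigma>) auto
  note co = coarea_identity[OF gk supp k(2)]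
  have ib: "integrable (lebesgue_on \<Omega>) (b n)" for n unfolding b_def by (rule co(1))
  have b_integral: "(LINT x|lebesgue_on \<Omega>. b n x) = c * (LINT s|lborel. (\<sigma>' n s)\<^sup>2)" for n
    unfolding b_def by (rule co(2))
  have bb: "(\<integral>\<^sup>+x. ennreal (b n x) \<partial>lebesgue_on \<Omega>) \<le> ennreal (c * (C\<^sup>2 / k n))" for n
  proof -
    have cc: "continuous_on UNIV (\<lambda>s. (\<sigma>' n s)\<^sup>2)" using Ck_on_imp_continuous_on[OF gk[of 0]] .
    \<comment> \<open>The slope is at most C/k on an interval of length k, which gives
      C^2/k.\<close>
    have "(LINT s|lborel. (\<sigma>' n s)\<^sup>2) \<le> (LINT s|lborel. (C / k n)\<^sup>2 * indicator {k n..2 * k n} s)"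
    proof (rule integral_mono)
      show "integrable lborel (\<lambda>s. (\<sigma>' n s)\<^sup>2)"
        by (rule integrable_compact_support[OF cc compact_Icc supp])
      show "integrable lborel (\<lambda>s. (C / k n)\<^sup>2 * indicator {k n..2 * k n} s)"
        using emeasure_compact_finite[OF compact_Icc, of "k n" "2 * k n"]
        by (intro integrable_mult_right integrable_real_indicator) simp_all
      fix s
      have "(\<sigma>' n s)\<^sup>2 \<le> (C / k n)\<^sup>2"
        using C(1) C(2)[of "s / k n - 1"] k(1)[of n]
        by (intro abs_le_square_iff[THEN iffD1]) (simp add: \<sigma>'_def divide_right_mono)
      then show "(\<sigma>' n s)\<^sup>2 \<le> (C / k n)\<^sup>2 * indicator {k n..2 * k n} s"
        using supp[of s n] by (auto simp: indicator_def)
    qed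
    also have "\<dots> = C\<^sup>2 / k n"
      using k(1)[of n] by (simp add: power2_eq_square)
    finally have "(LINT x|lebesgue_on \<Omega>. b n x) \<le> c * (C\<^sup>2 / k n)"
      unfolding b_integral using c_pos by (intro mult_left_mono) auto
    then show ?thesis using nn_integral_eq_integral[OF ib] b0 by (simp add: ennreal_leI)
  qed
  \<comment> \<open>The 2 comes from the square of a sum, B bounds \<phi>, and \<theta> converts the
    Euclidean norm of \<nabla>E into the norm of \<open>A\<close>.\<close>
  let ?H = "2 * B\<^sup>2 / \<theta>"
  let ?d = "\<lambda>n. \<integral>\<^sup>+x. ennreal ((\<psi> n x - \<phi> x)\<^sup>2 + (norm (grad (\<psi> n) x - grad \<phi> x))\<^sup>2) \<partial>lebesgue_on \<Omega>"
  have pt: "(\<psi> n x - \<phi> x)\<^sup>2 + (norm (grad (\<psi> n) x - grad \<phi> x))\<^sup>2 \<le> a n x + ?H * b n x" if x: "x \<in> U" for n x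
  proof -
    let ?s = "\<sigma> n (e x)"
    have d: "\<phi> differentiable (at x)" "(\<lambda>x. 1 - \<sigma> n (e x)) differentiable (at x)"
    proof -
      show "\<phi> differentiable (at x)" using S(5)[of 1] by (simp add: Ck_on_Suc)
      have "Ck_on 1 U (\<lambda>x. 1 - \<sigma> n (e x))"
        by (intro Ck_on_diff open_U Ck_on_compose[OF open_U C\<sigma>(1) Ck_e]) auto
      then show "(\<lambda>x. 1 - \<sigma> n (e x)) differentiable (at x)" using x by (simp add: Ck_on_Suc)
    qed
    have "grad (\<lambda>x. 1 - \<sigma> n (e x)) x = (- \<sigma>' n (e x)) *\<^sub>R grad e x"
    proof -
      have "((\<lambda>s. 1 - \<sigma> n s) has_real_derivative (- \<sigma>' n (e x))) (at (e x))"
        using D\<sigma>[of n "e x"] by (auto intro!: derivative_eq_intros)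
      from grad_compose_real[OF this differentiable_e[OF x]] show ?thesis .
    qed
    then have "grad (\<psi> n) x = \<phi> x *\<^sub>R ((- \<sigma>' n (e x)) *\<^sub>R grad e x) + (1 - ?s) *\<^sub>R grad \<phi> x"
      using grad_cong_open[OF open_U _ x, of "\<psi> n" "\<lambda>x. \<phi> x * (1 - \<sigma> n (e x))"] grad_mult[OF d]
      by (simp add: \<psi>_def)
    then have "grad (\<psi> n) x - grad \<phi> x = (- \<phi> x * \<sigma>' n (e x)) *\<^sub>R grad e x + (- ?s) *\<^sub>R grad \<phi> x"
      by (simp add: algebra_simps)
    then have "(norm (grad (\<psi> n) x - grad \<phi> x))\<^sup>2 \<le>
        2 * (norm ((- \<phi> x * \<sigma>' n (e x)) *\<^sub>R grad e x))\<^sup>2 + 2 * (norm ((- ?s) *\<^sub>R grad \<phi> x))\<^sup>2"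
      by (simp only: norm_add_square_le)
    also have "\<dots> = 2 * ((\<phi> x)\<^sup>2 * ((\<sigma>' n (e x))\<^sup>2 * (norm (grad e x))\<^sup>2)) + ?s\<^sup>2 * (2 * (norm (grad \<phi> x))\<^sup>2)"
      by (simp add: power_mult_distrib)
    also have "(\<phi> x)\<^sup>2 * ((\<sigma>' n (e x))\<^sup>2 * (norm (grad e x))\<^sup>2) \<le> B\<^sup>2 * ((\<sigma>' n (e x))\<^sup>2 * (Q x / \<theta>))"
    proof (intro mult_mono)
      show "(\<phi> x)\<^sup>2 \<le> B\<^sup>2" using B by (simp add: abs_le_square_iff[symmetric])
      show "(norm (grad e x))\<^sup>2 \<le> Q x / \<theta>"
        using \<theta> \<theta>(2)[of x "grad e x"] x U_sub by (auto simp: Q_def field_simps)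
    qed auto
    finally have "(norm (grad (\<psi> n) x - grad \<phi> x))\<^sup>2 \<le>
        2 * (B\<^sup>2 * ((\<sigma>' n (e x))\<^sup>2 * (Q x / \<theta>))) + ?s\<^sup>2 * (2 * (norm (grad \<phi> x))\<^sup>2)" by simp
    moreover have "(\<psi> n x - \<phi> x)\<^sup>2 = ?s\<^sup>2 * (\<phi> x)\<^sup>2"
      using x by (simp add: \<psi>_def algebra_simps power2_eq_square)
    ultimately show ?thesis using x by (simp add: a_def b_def F_def algebra_simps)
  qed
  have H0: "?H \<ge> 0" using \<theta>(1) by simp
  have "?d n \<le> (\<integral>\<^sup>+x. ennreal (a n x) \<partial>lebesgue_on \<Omega>) + ennreal ?H * ennreal (c * (C\<^sup>2 / k n))" for n
  proof -
    have "?d n \<le> (\<integral>\<^sup>+x. ennreal (a n x) + ennreal ?H * ennreal (b n x) \<partial>lebesgue_on \<Omega>)"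
    proof (rule nn_integral_mono_AE, use AE_U in eventually_elim)
      case (elim x)
      have "ennreal (a n x) + ennreal ?H * ennreal (b n x) = ennreal (a n x + ?H * b n x)"
        by (simp only: ennreal_plus[OF a0(1) mult_nonneg_nonneg[OF H0 b0]] ennreal_mult[OF H0 b0])
      then show ?case using pt[OF elim, of n] by (simp only: ennreal_leI)
    qed
    also have "\<dots> = (\<integral>\<^sup>+x. ennreal (a n x) \<partial>lebesgue_on \<Omega>) + ennreal ?H * (\<integral>\<^sup>+x. ennreal (b n x) \<partial>lebesgue_on \<Omega>)"
      using am[of n] borel_measurable_integrable[OF ib[of n]]
      by (subst nn_integral_add) (auto simp: nn_integral_cmult)
    also have "\<dots> \<le> (\<integral>\<^sup>+x. ennreal (a n x) \<partial>lebesgue_on \<Omega>) + ennreal ?H * ennreal (c * (C\<^sup>2 / k n))"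
      by (intro add_left_mono mult_left_mono bb) simp
    finally show ?thesis .
  qed
  moreover have "(\<lambda>n. (\<integral>\<^sup>+x. ennreal (a n x) \<partial>lebesgue_on \<Omega>) + ennreal ?H * ennreal (c * (C\<^sup>2 / k n))) \<longlonglongrightarrow> 0 + ennreal ?H * 0"
  proof (intro tendsto_add lima ennreal_tendsto_cmult)
    have "(\<lambda>n. c * (C\<^sup>2 / k n)) \<longlonglongrightarrow> c * 0"
    proof (intro tendsto_mult tendsto_const tendsto_divide_0[OF tendsto_const])
      show "filterlim k at_infinity sequentially"
        by (rule filterlim_at_infinity_conv_norm_at_top[THEN iffD2],
            rule filterlim_at_top_mono[OF filterlim_real_sequentially])
          (use k in \<open>auto intro!: always_eventually order_trans[OF _ abs_ge_self]\<close>)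
    qed
    then show "(\<lambda>n. ennreal (c * (C\<^sup>2 / k n))) \<longlonglongrightarrow> 0"
      using tendsto_ennrealI by fastforce
  qed simp
  ultimately have "?d \<longlonglongrightarrow> 0"
    by (intro tendsto_sandwich[OF _ _ tendsto_const[of 0], of ?d _ "\<lambda>n. (\<integral>\<^sup>+x. ennreal (a n x) \<partial>lebesgue_on \<Omega>) + ennreal ?H * ennreal (c * (C\<^sup>2 / k n))"])
      auto
  from that[OF 1 2 3 4 this] show ?thesis .
qed

text \<open>The limits are taken one after the other: at a fixed shift 1/(n + 1) the cutoffs near
  \<open>K\<close> are removed by \<open>hardy_closed\<close>, and only then does the shift tend to
  0, by Fatou. Where E = \<gamma> the shifted weights vanish together with |\<nabla>E|, so the
  pointwise limit is the right one.\<close>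

lemma hardy_test:
  assumes r: "Ck_on 1 {\<gamma><..} r" and W: "continuous_on {\<gamma><..} W" "\<And>t. t > \<gamma> \<Longrightarrow> W t \<ge> 0"
    and ric: "\<And>t. t > \<gamma> \<Longrightarrow> deriv r t + W t + (r t)\<^sup>2 \<le> 0"
    and \<phi>: "test_fun \<Omega> \<phi>"
  shows "(\<integral>\<^sup>+x. ennreal ((if x \<in> U \<and> e x > \<gamma> then W (e x) * Q x else 0) * (\<phi> x)\<^sup>2) \<partial>lebesgue_on \<Omega>) \<le>
    (\<integral>\<^sup>+x. ennreal (normsq_A A x (grad \<phi> x)) \<partial>lebesgue_on \<Omega>)"
proof -
  define w where "w n x = (if x \<in> U then W (e x + 1 / real (Suc n)) * Q x else 0)" for n :: nat and x
  have gt: "e x + 1 / real (Suc n) > \<gamma>" if "x \<in> U" for x n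
    using E_ge_boundary[OF that] by (simp add: add_strict_increasing2 add.commute pos_add_strict le_less_trans less_add_same_cancel1)
  have wm: "w n \<in> borel_measurable (lebesgue_on \<Omega>)" for n unfolding w_def
  proof (rule measurable_on_U[OF _ open_U U_sub])
    have "Ck_on 0 U (\<lambda>x. W (e x + 1 / real (Suc n)) * Q x)"
      using W(1) gt by (intro Ck_on_mult open_U Ck_Q Ck_on_compose[of U 0 "{\<gamma><..}" W] Ck_on_add Ck_e) (auto simp: Ck_on_0)
    then show "continuous_on U (\<lambda>x. W (e x + 1 / real (Suc n)) * Q x)" by (simp add: Ck_on_0)
  qed
  have w0: "w n x \<ge> 0" for n x using W(2)[OF gt] Q_nonneg by (auto simp: w_def)
  obtain S where S: "compact S" "S \<subseteq> \<Omega>" "\<And>k. Ck_on k UNIV \<phi>" "\<And>k i. Ck_on k UNIV (\<lambda>x. grad \<phi> x $ i)"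
    using test_fun_props[OF \<phi>] by metis
  have \<phi>m: "\<phi> \<in> borel_measurable (lebesgue_on \<Omega>)" "(\<lambda>x. grad \<phi> x $ i) \<in> borel_measurable (lebesgue_on \<Omega>)" for i
    using S(3,4) Ck_on_imp_continuous_on by (blast intro: continuous_UNIV_measurable_\<Omega>)+
  obtain \<psi> :: "nat \<Rightarrow> real^'n \<Rightarrow> real" and R where \<psi>: "\<And>n. Ck_on 1 U (\<psi> n)" "\<And>n. compact (R n)" "\<And>n. R n \<subseteq> U"
    "\<And>n x. x \<notin> R n \<Longrightarrow> \<psi> n x = 0"
    "(\<lambda>n. \<integral>\<^sup>+x. ennreal ((\<psi> n x - \<phi> x)\<^sup>2 + (norm (grad (\<psi> n) x - grad \<phi> x))\<^sup>2) \<partial>lebesgue_on \<Omega>) \<longlonglongrightarrow> 0"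
    using cutoff_near_K[OF \<phi>] by blast
  have C\<psi>: "Ck_on 1 UNIV (\<psi> n)" for n
    by (rule Ck_on_extend_zero[OF open_U \<psi>(1) compact_imp_closed[OF \<psi>(2)] \<psi>(3,4)])
  have \<psi>m: "\<psi> n \<in> borel_measurable (lebesgue_on \<Omega>)" "(\<lambda>x. grad (\<psi> n) x $ i) \<in> borel_measurable (lebesgue_on \<Omega>)" for n i
    using C\<psi>[of n] Ck_on_grad[of 0 UNIV "\<psi> n" i] Ck_on_imp_continuous_on
    by (auto intro!: continuous_UNIV_measurable_\<Omega>)
  have le: "(\<integral>\<^sup>+x. ennreal (w n x * (\<phi> x)\<^sup>2) \<partial>lebesgue_on \<Omega>) \<le> (\<integral>\<^sup>+x. ennreal (normsq_A A x (grad \<phi> x)) \<partial>lebesgue_on \<Omega>)" for n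
  proof (rule hardy_closed[OF wm w0 \<phi>m(1) \<psi>m(1) \<phi>m(2) \<psi>m(2) _ \<psi>(5)])
    show "(\<integral>\<^sup>+x. ennreal (w n x * (\<psi> m x)\<^sup>2) \<partial>lebesgue_on \<Omega>) \<le> (\<integral>\<^sup>+x. ennreal (normsq_A A x (grad (\<psi> m) x)) \<partial>lebesgue_on \<Omega>)" for m
      unfolding w_def by (rule hardy_compact_support[OF r W ric _ \<psi>(1,2,3,4)]) auto
  qed
  show ?thesis
  proof (rule nn_integral_fatou_bound[OF _ _ le])
    show "(\<lambda>x. ennreal (w n x * (\<phi> x)\<^sup>2)) \<in> borel_measurable (lebesgue_on \<Omega>)" for n
      using wm \<phi>m by (auto intro!: borel_measurable_times borel_measurable_power measurable_compose[OF _ measurable_ennreal])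
    show "AE x in lebesgue_on \<Omega>. (\<lambda>n. ennreal (w n x * (\<phi> x)\<^sup>2)) \<longlonglongrightarrow>
        ennreal ((if x \<in> U \<and> e x > \<gamma> then W (e x) * Q x else 0) * (\<phi> x)\<^sup>2)"
    proof (rule AE_I2, intro tendsto_ennrealI tendsto_mult tendsto_const)
      fix x
      show "(\<lambda>n. w n x) \<longlonglongrightarrow> (if x \<in> U \<and> e x > \<gamma> then W (e x) * Q x else 0)"
      proof (cases "x \<in> U \<and> e x > \<gamma>")
        case True
        have "isCont W (e x)" using W(1) True by (simp add: continuous_on_eq_continuous_at)
        moreover have "(\<lambda>n. e x + 1 / real (Suc n)) \<longlonglongrightarrow> e x + 0"
          by (intro tendsto_add tendsto_const LIMSEQ_Suc lim_1_over_n)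
        ultimately have "(\<lambda>n. W (e x + 1 / real (Suc n))) \<longlonglongrightarrow> W (e x)"
          using isCont_tendsto_compose by fastforce
        then show ?thesis using True by (auto simp: w_def intro!: tendsto_mult)
      next
        case False
        then have "w n x = 0" for n
          using Q_eq_0_at_boundary_value[of x] E_ge_boundary[of x] by (force simp: w_def)
        then show ?thesis using False by auto
      qed
    qed
  qed
qed

section \<open>From test functions to the Sobolev space\<close>

lemma weak_grad_unique:
  assumes "weak_grad \<Omega> u G" "weak_grad \<Omega> u H"
  shows "AE x in lebesgue_on \<Omega>. G x = H x"
proof -
  have "AE x in lebesgue_on \<Omega>. G x $ i - H x $ i = 0" for i
  proof (rule AE_0_of_test_integrals[OF open_\<Omega>])
    have l: "loc_integrable \<Omega> (\<lambda>x. G x $ i)" "loc_integrable \<Omega> (\<lambda>x. H x $ i)"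
      using assms by (auto simp: weak_grad_def)
    then show "loc_integrable \<Omega> (\<lambda>x. G x $ i - H x $ i)" by (auto simp: loc_integrable_def)
    fix \<phi> assume \<phi>: "test_fun \<Omega> \<phi>"
    obtain S where S: "compact S" "S \<subseteq> \<Omega>" "\<And>x. x \<notin> S \<Longrightarrow> \<phi> x = 0" "\<And>k. Ck_on k UNIV \<phi>"
      using test_fun_props[OF \<phi>] by metis
    have c\<phi>: "continuous_on UNIV \<phi>" using Ck_on_imp_continuous_on[OF S(4)[of 0]] .
    obtain B where B: "\<And>x. \<bar>\<phi> x\<bar> \<le> B" using bounded_compact_support[OF c\<phi> S(1,3)] by metis
    have i: "integrable (lebesgue_on \<Omega>) (\<lambda>x. D x * \<phi> x)" if "loc_integrable \<Omega> D" for D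
    proof -
      have "integrable lebesgue (\<lambda>x. D x * \<phi> x)"
        by (rule loc_integrable_times_bounded[OF that S(1,2) borel_measurable_continuous_onI[OF c\<phi>] B S(3)])
      moreover have "(\<lambda>x. indicator \<Omega> x * (D x * \<phi> x)) = (\<lambda>x. D x * \<phi> x)"
        using S(2,3) by (auto simp: indicator_def fun_eq_iff)
      ultimately show ?thesis using meas_\<Omega> by (simp add: integrable_restrict_space)
    qed
    have "(LINT x|lebesgue_on \<Omega>. G x $ i * \<phi> x) = (LINT x|lebesgue_on \<Omega>. H x $ i * \<phi> x)"
    proof -
      have "(LINT x|lebesgue_on \<Omega>. u x * grad \<phi> x $ i) = - (LINT x|lebesgue_on \<Omega>. G x $ i * \<phi> x)"
        "(LINT x|lebesgue_on \<Omega>. u x * grad \<phi> x $ i) = - (LINT x|lebesgue_on \<Omega>. H x $ i * \<phi> x)"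
        using assms \<phi> unfolding weak_grad_def by blast+
      then show ?thesis by linarith
    qed
    then show "(LINT x|lebesgue_on \<Omega>. (G x $ i - H x $ i) * \<phi> x) = 0"
      using i[OF l(1)] i[OF l(2)] by (simp add: left_diff_distrib)
  qed
  then have "AE x in lebesgue_on \<Omega>. \<forall>i\<in>UNIV. G x $ i - H x $ i = 0"
    by (subst AE_ball_countable) auto
  then show ?thesis by eventually_elim (simp add: vec_eq_iff)
qed

lemma L2_diff_square:
  assumes "L2 \<Omega> a" "L2 \<Omega> b"
  shows "integrable (lebesgue_on \<Omega>) (\<lambda>x. (a x - b x)\<^sup>2)"
proof (rule Bochner_Integration.integrable_bound)
  show "integrable (lebesgue_on \<Omega>) (\<lambda>x. 2 * (a x)\<^sup>2 + 2 * (b x)\<^sup>2)"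
    using assms by (auto simp: L2_def)
  show "AE x in lebesgue_on \<Omega>. norm ((a x - b x)\<^sup>2) \<le> norm (2 * (a x)\<^sup>2 + 2 * (b x)\<^sup>2)"
  proof (rule AE_I2)
    fix x
    have "(a x - b x)\<^sup>2 \<le> 2 * (a x)\<^sup>2 + 2 * (b x)\<^sup>2"
      using norm_add_square_le[of "a x" "- b x"] by simp
    then show "norm ((a x - b x)\<^sup>2) \<le> norm (2 * (a x)\<^sup>2 + 2 * (b x)\<^sup>2)" by simp
  qed
qed (use assms in \<open>auto simp: L2_def\<close>)

lemma test_fun_L2:
  assumes "test_fun \<Omega> \<phi>"
  shows "L2 \<Omega> \<phi>" "L2 \<Omega> (\<lambda>x. grad \<phi> x $ i)"
proof -
  obtain S where S: "compact S" "S \<subseteq> \<Omega>" "\<And>x. x \<notin> S \<Longrightarrow> \<phi> x = 0" "\<And>x. x \<notin> S \<Longrightarrow> grad \<phi> x = 0"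
    "\<And>k. Ck_on k UNIV \<phi>" "\<And>k i. Ck_on k UNIV (\<lambda>x. grad \<phi> x $ i)"
    using test_fun_props[OF assms] by metis
  have L: "L2 \<Omega> g" if "Ck_on 0 UNIV g" "\<And>x. x \<notin> S \<Longrightarrow> g x = 0" for g
    using that unfolding L2_def Ck_on_0
    by (auto intro!: continuous_UNIV_measurable_\<Omega> continuous_compact_integrable_\<Omega>[OF _ S(1,2)] continuous_intros)
  show "L2 \<Omega> \<phi>" "L2 \<Omega> (\<lambda>x. grad \<phi> x $ i)" using L S by auto
qed

lemma measurable_weight:
  assumes W: "continuous_on {\<gamma><..} W"
  shows "(\<lambda>x. if x \<in> U \<and> e x > \<gamma> then W (e x) * Q x else 0) \<in> borel_measurable (lebesgue_on \<Omega>)"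
proof -
  have oV: "open {x\<in>U. e x > \<gamma>}"
  proof -
    have "continuous_on U e" using Ck_on_imp_continuous_on[OF Ck_e[of 0]] .
    then have "open (e -` {\<gamma><..} \<inter> U)"
      using continuous_on_open_vimage[OF open_U, of e] open_greaterThan[of \<gamma>] by blast
    then show ?thesis by (simp add: vimage_def Collect_conj_eq Int_commute)
  qed
  have "Ck_on 0 {x\<in>U. e x > \<gamma>} (\<lambda>x. W (e x))"
    by (rule Ck_on_compose[OF oV, of 0 "{\<gamma><..}" W])
      (use W in \<open>auto simp: Ck_on_0 intro: Ck_on_imp_continuous_on[OF Ck_on_subset[OF Ck_e[of 0]]]\<close>)
  moreover have "Ck_on 0 {x\<in>U. e x > \<gamma>} Q" by (rule Ck_on_subset[OF Ck_Q]) auto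
  ultimately have "continuous_on {x\<in>U. e x > \<gamma>} (\<lambda>x. W (e x) * Q x)"
    using Ck_on_mult[OF oV, of 0] by (simp add: Ck_on_0)
  with oV show ?thesis
    using measurable_on_U[of "{x\<in>U. e x > \<gamma>}" "\<lambda>x. W (e x) * Q x"] U_sub by auto
qed

text \<open>The finiteness of the energy is recorded as well, since it is what later permits a
  subtraction in the extended reals.\<close>

lemma hardy_H1_0:
  assumes r: "Ck_on 1 {\<gamma><..} r" and W: "continuous_on {\<gamma><..} W" "\<And>t. t > \<gamma> \<Longrightarrow> W t \<ge> 0"
    and ric: "\<And>t. t > \<gamma> \<Longrightarrow> deriv r t + W t + (r t)\<^sup>2 \<le> 0"
    and u: "u \<in> H1_0 \<Omega>" and G: "weak_grad \<Omega> u G"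
  shows "(\<integral>\<^sup>+x. ennreal ((if x \<in> U \<and> e x > \<gamma> then W (e x) * Q x else 0) * (u x)\<^sup>2) \<partial>lebesgue_on \<Omega>) \<le>
      (\<integral>\<^sup>+x. ennreal (normsq_A A x (G x)) \<partial>lebesgue_on \<Omega>)"
    and "(\<integral>\<^sup>+x. ennreal (normsq_A A x (G x)) \<partial>lebesgue_on \<Omega>) < \<infinity>"
proof -
  obtain H \<phi> where uL: "L2 \<Omega> u" and H: "weak_grad \<Omega> u H" "\<And>i. L2 \<Omega> (\<lambda>x. H x $ i)"
    and \<phi>: "\<And>k::nat. test_fun \<Omega> (\<phi> k)"
    and lim: "(\<lambda>k. LINT x|lebesgue_on \<Omega>. (\<phi> k x - u x)\<^sup>2 + (norm (grad (\<phi> k) x - H x))\<^sup>2) \<longlonglongrightarrow> 0"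
    using u unfolding H1_0_def by blast
  \<comment> \<open>Membership in \<open>H1_0\<close> provides one weak gradient approximated by
    test functions, whereas the inequality is claimed for an arbitrary one; uniqueness identifies
    them almost everywhere.\<close>
  have GH: "(\<integral>\<^sup>+x. ennreal (normsq_A A x (G x)) \<partial>lebesgue_on \<Omega>) = (\<integral>\<^sup>+x. ennreal (normsq_A A x (H x)) \<partial>lebesgue_on \<Omega>)"
    by (rule nn_integral_cong_AE, use weak_grad_unique[OF G H(1)] in eventually_elim) simp
  define w where "w x = (if x \<in> U \<and> e x > \<gamma> then W (e x) * Q x else 0)" for x
  have wm: "w \<in> borel_measurable (lebesgue_on \<Omega>)" unfolding w_def[abs_def] by (rule measurable_weight[OF W(1)])
  have w0: "w x \<ge> 0" for x using W(2) Q_nonneg by (auto simp: w_def)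
  define D where "D k x = (\<phi> k x - u x)\<^sup>2 + (norm (grad (\<phi> k) x - H x))\<^sup>2" for k x
  \<comment> \<open>The Bochner integral of a non-integrable function is 0 by default, so
    convergence of the integrals in \<open>H1_0\<close> carries information only once integrability
    is established.\<close>
  have iD: "integrable (lebesgue_on \<Omega>) (D k)" for k
  proof -
    have "D k = (\<lambda>x. (\<phi> k x - u x)\<^sup>2 + (\<Sum>i\<in>UNIV. (grad (\<phi> k) x $ i - H x $ i)\<^sup>2))"
      unfolding D_def[abs_def] power2_norm_eq_inner inner_vec_def by (simp add: power2_eq_square)
    then show ?thesis
      using L2_diff_square[OF test_fun_L2(1)[OF \<phi>] uL] L2_diff_square[OF test_fun_L2(2)[OF \<phi>] H(2)] by simp
  qed
  have "(\<integral>\<^sup>+x. ennreal (D k x) \<partial>lebesgue_on \<Omega>) = ennreal (LINT x|lebesgue_on \<Omega>. D k x)" for k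
    by (rule nn_integral_eq_integral[OF iD]) (simp add: D_def)
  then have lim': "(\<lambda>k. \<integral>\<^sup>+x. ennreal (D k x) \<partial>lebesgue_on \<Omega>) \<longlonglongrightarrow> 0"
    using tendsto_ennrealI[OF lim[folded D_def]] by simp
  have "(\<integral>\<^sup>+x. ennreal (w x * (u x)\<^sup>2) \<partial>lebesgue_on \<Omega>) \<le> (\<integral>\<^sup>+x. ennreal (normsq_A A x (H x)) \<partial>lebesgue_on \<Omega>)"
  proof (rule hardy_closed[OF wm w0 _ _ _ _ _ lim'[unfolded D_def]])
    show "(\<integral>\<^sup>+x. ennreal (w x * (\<phi> k x)\<^sup>2) \<partial>lebesgue_on \<Omega>) \<le> (\<integral>\<^sup>+x. ennreal (normsq_A A x (grad (\<phi> k) x)) \<partial>lebesgue_on \<Omega>)" for k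
      unfolding w_def by (rule hardy_test[OF r W ric \<phi>])
  qed (use uL H test_fun_L2[OF \<phi>] in \<open>auto simp: L2_def\<close>)
  then show "(\<integral>\<^sup>+x. ennreal ((if x \<in> U \<and> e x > \<gamma> then W (e x) * Q x else 0) * (u x)\<^sup>2) \<partial>lebesgue_on \<Omega>) \<le>
      (\<integral>\<^sup>+x. ennreal (normsq_A A x (G x)) \<partial>lebesgue_on \<Omega>)"
    unfolding GH w_def .
  obtain \<Lambda> where \<Lambda>: "\<Lambda> > 0" "\<And>x v. x \<in> \<Omega> \<Longrightarrow> normsq_A A x v \<le> \<Lambda> * (norm v)\<^sup>2"
    using normsq_bounds by metis
  have iH: "integrable (lebesgue_on \<Omega>) (\<lambda>x. \<Lambda> * (norm (H x))\<^sup>2)"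
    unfolding power2_norm_eq_inner inner_vec_def
    using H(2) by (simp add: L2_def power2_eq_square)
  have "(\<integral>\<^sup>+x. ennreal (normsq_A A x (H x)) \<partial>lebesgue_on \<Omega>) \<le> (\<integral>\<^sup>+x. ennreal (\<Lambda> * (norm (H x))\<^sup>2) \<partial>lebesgue_on \<Omega>)"
    by (rule nn_integral_mono) (use \<Lambda> in \<open>auto intro!: ennreal_leI\<close>)
  also have "\<dots> < \<infinity>" using nn_integral_eq_integral[OF iH] \<Lambda>(1) by simp
  finally show "(\<integral>\<^sup>+x. ennreal (normsq_A A x (G x)) \<partial>lebesgue_on \<Omega>) < \<infinity>" unfolding GH .
qed

end

section \<open>The quadratic form on the half-line\<close>

text \<open>Nonnegativity of the second variation, the form \<integral> g'^2 - V g^2, on functions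
  with compact support in (\<gamma>, \<infinity>). Smoothness of \<open>g\<close> is imposed because
  g \<circ> E is to be a test function on \<Omega>.\<close>

definition jacobi_nonneg :: "real \<Rightarrow> (real \<Rightarrow> real) \<Rightarrow> bool" where
  "jacobi_nonneg \<gamma> V \<longleftrightarrow> (\<forall>g a b. (\<forall>k. Ck_on k UNIV g) \<longrightarrow> \<gamma> < a \<longrightarrow> (\<forall>s. s \<notin> {a..b} \<longrightarrow> g s = 0) \<longrightarrow>
     (LINT s|lborel. V s * (g s)\<^sup>2) \<le> (LINT s|lborel. (deriv g s)\<^sup>2))"

lemma integrable_Icc_const: "integrable lborel (\<lambda>s::real. C * indicator {a..b} s :: real)"
  using emeasure_compact_finite[OF compact_Icc, of a b]
  by (intro integrable_mult_right integrable_real_indicator) simp_all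

lemma jacobi_nonneg_limit:
  fixes G G' :: "nat \<Rightarrow> real \<Rightarrow> real"
  assumes V: "continuous_on {\<gamma><..} V" and a: "\<gamma> < a"
    and le: "\<And>n. (LINT s|lborel. V s * (G n s)\<^sup>2) \<le> (LINT s|lborel. (G' n s)\<^sup>2)"
    and m: "\<And>n. G n \<in> borel_measurable borel" "\<And>n. G' n \<in> borel_measurable borel"
      "g \<in> borel_measurable borel" "g' \<in> borel_measurable borel"
    and b: "\<And>n s. \<bar>G n s\<bar> \<le> B" "\<And>n s. \<bar>G' n s\<bar> \<le> B"
    and supp: "\<And>n s. s \<notin> {a..b} \<Longrightarrow> G n s = 0" "\<And>n s. s \<notin> {a..b} \<Longrightarrow> G' n s = 0"
    and lim: "\<And>s. (\<lambda>n. G n s) \<longlonglongrightarrow> g s" "AE s in lborel. (\<lambda>n. G' n s) \<longlonglongrightarrow> g' s"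
  shows "(LINT s|lborel. V s * (g s)\<^sup>2) \<le> (LINT s|lborel. (g' s)\<^sup>2)"
proof -
  have "bounded (V ` {a..b})"
    by (intro compact_imp_bounded compact_continuous_image continuous_on_subset[OF V]) (use a in auto)
  then obtain C where "\<forall>x\<in>V ` {a..b}. norm x \<le> C" unfolding bounded_iff by blast
  then have C: "\<bar>V s\<bar> \<le> C" if "s \<in> {a..b}" for s using that by auto
  \<comment> \<open>\<open>V\<close> is controlled only on (\<gamma>, \<infinity>); cutting it off
    to the common support makes it bounded and Borel without changing the integrands.\<close>
  define V' where "V' s = indicator {a..b} s * V s" for s
  have V'm: "V' \<in> borel_measurable borel"
  proof -
    have "(\<lambda>s. indicator {a..b} s *\<^sub>R V s) \<in> borel_measurable borel"
      by (rule borel_measurable_continuous_on_indicator) (use a in \<open>auto intro: continuous_on_subset[OF V]\<close>)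
    then show ?thesis by (simp add: V'_def[abs_def])
  qed
  have g0: "g s = 0" if "s \<notin> {a..b}" for s
    using lim(1)[of s] supp(1)[OF that] by (simp add: LIMSEQ_const_iff)
  have e: "V s * (G n s)\<^sup>2 = V' s * (G n s)\<^sup>2" "V s * (g s)\<^sup>2 = V' s * (g s)\<^sup>2" for n s
    using supp(1)[of s n] g0[of s] by (auto simp: V'_def indicator_def)
  have sq: "(x::real)\<^sup>2 \<le> B\<^sup>2" if "\<bar>x\<bar> \<le> B" for x
    using that abs_le_square_iff[of x B] by linarith
  have 1: "(\<lambda>n. LINT s|lborel. V' s * (G n s)\<^sup>2) \<longlonglongrightarrow> (LINT s|lborel. V' s * (g s)\<^sup>2)"
  proof (rule integral_dominated_convergence[where w = "\<lambda>s. (C * B\<^sup>2) * indicator {a..b} s"])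
    show "AE s in lborel. (\<lambda>n. V' s * (G n s)\<^sup>2) \<longlonglongrightarrow> V' s * (g s)\<^sup>2"
      by (intro AE_I2 tendsto_intros lim)
    show "AE s in lborel. norm (V' s * (G n s)\<^sup>2) \<le> (C * B\<^sup>2) * indicator {a..b} s" for n
      using C sq[OF b(1)] by (intro AE_I2) (auto simp: V'_def indicator_def abs_mult intro!: mult_mono order_trans[OF abs_ge_zero C])
    show "integrable lborel (\<lambda>s. (C * B\<^sup>2) * indicator {a..b} s)" by (rule integrable_Icc_const)
  qed (use V'm m in auto)
  have 2: "(\<lambda>n. LINT s|lborel. (G' n s)\<^sup>2) \<longlonglongrightarrow> (LINT s|lborel. (g' s)\<^sup>2)"
  proof (rule integral_dominated_convergence[where w = "\<lambda>s. B\<^sup>2 * indicator {a..b} s"])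
    show "AE s in lborel. (\<lambda>n. (G' n s)\<^sup>2) \<longlonglongrightarrow> (g' s)\<^sup>2"
      using lim(2) by eventually_elim (intro tendsto_intros)
    show "AE s in lborel. norm ((G' n s)\<^sup>2) \<le> B\<^sup>2 * indicator {a..b} s" for n
      using supp(2)[of _ n] sq[OF b(2)] by (intro AE_I2) (auto simp: indicator_def)
    show "integrable lborel (\<lambda>s. B\<^sup>2 * indicator {a..b} s)" by (rule integrable_Icc_const)
  qed (use m in auto)
  show ?thesis unfolding e by (rule LIMSEQ_le[OF 1 2]) (use le in \<open>auto simp: e\<close>)
qed

text \<open>Smoothing without convolution: g' is approximated uniformly by Weierstrass polynomials,
  these are cut off smoothly and integrated, and the antiderivatives are cut off again.\<close>

lemma jacobi_nonneg_C1:
  assumes J: "jacobi_nonneg \<gamma> V" and V: "continuous_on {\<gamma><..} V" and a: "\<gamma> < a"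
    and g': "continuous_on UNIV g'" and D: "\<And>s. (g has_real_derivative g' s) (at s)"
    and supp: "\<And>s. s \<notin> {a..b} \<Longrightarrow> g s = 0" "\<And>s. s \<notin> {a..b} \<Longrightarrow> g' s = 0"
  shows "(LINT s|lborel. V s * (g s)\<^sup>2) \<le> (LINT s|lborel. (g' s)\<^sup>2)"
proof -
  \<comment> \<open>The midpoint leaves room for a cutoff strictly between \<gamma> and the support;
    the maximum covers the case of an empty interval \<open>{a..b}\<close>.\<close>
  define a' b' where "a' = (\<gamma> + a) / 2" and "b' = max a b + 1"
  have ab: "\<gamma> < a'" "a' < a" "a \<le> max a b" "max a b < b'" using a by (auto simp: a'_def b'_def)
  obtain \<chi>' where \<chi>: "\<And>k. Ck_on k UNIV \<chi>'" "\<And>x. 0 \<le> \<chi>' x" "\<And>x. \<chi>' x \<le> 1"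
    "\<And>x. x \<in> {a..max a b} \<Longrightarrow> \<chi>' x = 1" "\<And>x. x \<notin> {a'..b'} \<Longrightarrow> \<chi>' x = 0"
    using smooth_plateau[OF ab(2-4)] by metis
  note \<chi>D = Ck_on_SucD_real[OF open_UNIV \<chi>(1)]
  have \<chi>1: "\<chi>' s = 1" if "s \<in> {a..b}" for s by (rule \<chi>(4)) (use that in auto)
  have \<chi>g: "\<chi>' s * g s = g s" "\<chi>' s * g' s = g' s" for s
  proof -
    show "\<chi>' s * g s = g s" using \<chi>1[of s] supp(1)[of s] by (cases "s \<in> {a..b}") simp_all
    show "\<chi>' s * g' s = g' s" using \<chi>1[of s] supp(2)[of s] by (cases "s \<in> {a..b}") simp_all
  qed
  have gc: "continuous_on UNIV g" by (rule DERIV_continuous_on[OF D])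
  have "\<exists>p. real_polynomial_function p \<and> (\<forall>x\<in>{a'..b'}. \<bar>g' x - p x\<bar> < 1 / real (Suc n))" for n
  proof -
    have "0 < 1 / real (Suc n)" by simp
    from Stone_Weierstrass_real_polynomial_function[OF compact_Icc continuous_on_subset[OF g' subset_UNIV] this]
    obtain p where "real_polynomial_function p" "\<And>x. x \<in> {a'..b'} \<Longrightarrow> \<bar>g' x - p x\<bar> < 1 / real (Suc n)"
      by blast
    then show ?thesis by blast
  qed
  then obtain p where p: "\<And>n. real_polynomial_function (p n)"
    "\<And>n x. x \<in> {a'..b'} \<Longrightarrow> \<bar>g' x - p n x\<bar> < 1 / real (Suc n)" by metis
  define q where "q n s = \<chi>' s * p n s" for n s
  have q: "Ck_on k UNIV (q n)" for k n
    unfolding q_def by (intro Ck_on_mult \<chi> Ck_on_real_polynomial_function p) auto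
  have q0: "q n s = 0" if "s \<notin> {a'..b'}" for n s using \<chi>(5)[OF that] by (simp add: q_def)
  have qg: "\<bar>q n s - g' s\<bar> \<le> 1 / real (Suc n)" for n s
  proof (cases "s \<in> {a'..b'}")
    case True
    have "q n s - g' s = \<chi>' s * (p n s - g' s)" by (simp add: q_def right_diff_distrib \<chi>g)
    then have "\<bar>q n s - g' s\<bar> = \<chi>' s * \<bar>g' s - p n s\<bar>" using \<chi>(2)[of s] by (simp add: abs_mult abs_minus_commute)
    also have "\<dots> \<le> 1 * (1 / real (Suc n))"
      using \<chi>(2,3)[of s] p(2)[OF True, of n] by (intro mult_mono) auto
    finally show ?thesis by simp
  next
    case False
    have "g' s = 0" using \<chi>g(2)[of s] \<chi>(5)[OF False] by simp
    then show ?thesis using q0[OF False] by simp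
  qed
  have "\<exists>T. (\<forall>k. Ck_on k UNIV T) \<and> (\<forall>s. (T has_real_derivative q n s) (at s)) \<and> (\<forall>s\<le>a'. T s = 0)" for n
    using smooth_antiderivative[of "q n" a' b'] q q0 by metis
  then obtain T where T: "\<And>n k. Ck_on k UNIV (T n)" "\<And>n s. (T n has_real_derivative q n s) (at s)"
    "\<And>n s. s \<le> a' \<Longrightarrow> T n s = 0" by metis
  define l where "l = b' - a'"
  have l: "l \<ge> 0" using ab by (simp add: l_def)
  have Tg: "\<bar>T n s - g s\<bar> \<le> l / real (Suc n)" if s: "s \<in> {a'..b'}" for n s
  proof (cases "s = a'")
    case True
    have "g a' = 0" using supp(1)[of a'] ab by auto
    then show ?thesis using T(3)[of a' n] True l by simp
  next
    case False
    then have as: "a' < s" using s by auto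
    have "((\<lambda>s. T n s - g s) has_real_derivative q n x - g' x) (at x)" for x
      by (intro DERIV_diff T D)
    then obtain z where "T n s - g s - (T n a' - g a') = (s - a') * (q n z - g' z)"
      using MVT2[OF as, of "\<lambda>s. T n s - g s" "\<lambda>x. q n x - g' x"] by blast
    moreover have "g a' = 0" using supp(1)[of a'] ab by auto
    ultimately have "\<bar>T n s - g s\<bar> = (s - a') * \<bar>q n z - g' z\<bar>"
      using T(3)[of a' n] as by (simp add: abs_mult)
    also have "\<dots> \<le> l * (1 / real (Suc n))"
      using as s qg[of n z] l by (intro mult_mono) (auto simp: l_def)
    finally show ?thesis by simp
  qed
  \<comment> \<open>The integral of \<open>q n\<close> is close to that of g', which is 0, but need
    not vanish. So \<open>T n\<close> may end at a nonzero constant and a second cutoff is required;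
    its contribution to the derivative is small because \<chi>' has derivative 0 wherever
    \<open>g\<close> is nonzero.\<close>
  define G where "G n s = \<chi>' s * T n s" for n s
  define G' where "G' n s = \<chi>' s * q n s + deriv \<chi>' s * T n s" for n s
  have d\<chi>0: "deriv \<chi>' s = 0" if "s \<notin> {a'..b'}" for s
    by (rule deriv_eq_0_outside[OF closed_atLeastAtMost \<chi>(5) that])
  have "continuous_on UNIV (deriv \<chi>')" using \<chi>D(2)[of 0] by (simp add: Ck_on_0)
  then obtain C where C: "C \<ge> 0" "\<And>s. \<bar>deriv \<chi>' s\<bar> \<le> C"
    using bounded_compact_support[OF _ compact_Icc, of "deriv \<chi>'" a' b'] d\<chi>0 by metis
  have DG: "(G n has_real_derivative G' n s) (at s)" for n s
    unfolding G_def[abs_def] G'_def using DERIV_mult[OF \<chi>D(1)[of s] T(2)[of n s]] by (simp add: algebra_simps)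
  have CG: "Ck_on k UNIV (G n)" for k n unfolding G_def by (intro Ck_on_mult \<chi> T) auto
  have dG: "deriv (G n) = G' n" for n using DG DERIV_imp_deriv by blast
  have CG': "Ck_on 0 UNIV (G' n)" for n
    using Ck_on_SucD_real(2)[OF open_UNIV CG[of "Suc 0" n]] unfolding dG .
  have G0: "G n s = 0" "G' n s = 0" if "s \<notin> {a'..b'}" for n s
    using \<chi>(5)[OF that] d\<chi>0[OF that] by (auto simp: G_def G'_def)
  have g0: "g s = 0" "g' s = 0" if "s \<notin> {a'..b'}" for s
    using \<chi>g[of s] \<chi>(5)[OF that] by auto
  have Gg: "\<bar>G n s - g s\<bar> \<le> l / real (Suc n)" for n s
  proof (cases "s \<in> {a'..b'}")
    case True
    have "G n s - g s = \<chi>' s * (T n s - g s)" by (simp add: G_def right_diff_distrib \<chi>g)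
    then have "\<bar>G n s - g s\<bar> = \<chi>' s * \<bar>T n s - g s\<bar>" using \<chi>(2)[of s] by (simp add: abs_mult)
    also have "\<dots> \<le> 1 * (l / real (Suc n))" using \<chi>(2,3)[of s] Tg[OF True, of n] by (intro mult_mono) auto
    finally show ?thesis by simp
  qed (use G0 g0 l in auto)
  \<comment> \<open>Obtained by differentiating the identity \<chi>' g = g.\<close>
  have d\<chi>g: "deriv \<chi>' s * g s = 0" for s
  proof -
    have "((\<lambda>s. \<chi>' s * g s) has_real_derivative deriv \<chi>' s * g s + g' s * \<chi>' s) (at s)"
      by (intro DERIV_mult \<chi>D D UNIV_I)
    then have "(g has_real_derivative deriv \<chi>' s * g s + g' s) (at s)"
      using \<chi>g by (simp add: mult.commute)
    then show ?thesis using DERIV_unique[OF D[of s]] by fastforce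
  qed
  have Gg': "\<bar>G' n s - g' s\<bar> \<le> (1 + C * l) / real (Suc n)" for n s
  proof (cases "s \<in> {a'..b'}")
    case True
    have "G' n s - g' s = \<chi>' s * (q n s - g' s) + deriv \<chi>' s * (T n s - g s)"
      using d\<chi>g[of s] by (simp add: G'_def right_diff_distrib \<chi>g)
    then have "\<bar>G' n s - g' s\<bar> \<le> \<chi>' s * \<bar>q n s - g' s\<bar> + \<bar>deriv \<chi>' s\<bar> * \<bar>T n s - g s\<bar>"
      using \<chi>(2)[of s] by (metis abs_mult abs_of_nonneg abs_triangle_ineq)
    also have "\<dots> \<le> 1 * (1 / real (Suc n)) + C * (l / real (Suc n))"
      using \<chi>(2,3)[of s] qg[of n s] C(2)[of s] Tg[OF True, of n] C(1) l by (intro add_mono mult_mono) auto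
    finally show ?thesis by (simp add: add_divide_distrib)
  qed (use G0 g0 l C(1) in auto)
  have lim: "x \<longlonglongrightarrow> y" if "\<And>n. \<bar>x n - y\<bar> \<le> K / real (Suc n)" for x :: "nat \<Rightarrow> real" and y K
  proof -
    have "(\<lambda>n. K / real (Suc n)) \<longlonglongrightarrow> 0" by (intro LIMSEQ_Suc lim_const_over_n)
    then have "(\<lambda>n. x n - y) \<longlonglongrightarrow> 0"
      by (rule Lim_null_comparison[rotated]) (use that in \<open>auto intro: always_eventually\<close>)
    then show ?thesis by (simp add: LIM_zero_iff)
  qed
  obtain B1 where B1: "B1 \<ge> 0" "\<And>s. \<bar>g s\<bar> \<le> B1"
    using bounded_compact_support[OF gc compact_Icc, of a' b'] g0 by metis
  obtain B2 where B2: "B2 \<ge> 0" "\<And>s. \<bar>g' s\<bar> \<le> B2"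
    using bounded_compact_support[OF g' compact_Icc, of a' b'] g0 by metis
  define B where "B = B1 + B2 + l + (1 + C * l)"
  have Kn: "K / real (Suc n) \<le> K" if "K \<ge> 0" for K n
    using that by (simp add: divide_le_eq mult_le_cancel_left1)
  show ?thesis
  proof (rule jacobi_nonneg_limit[OF V ab(1), of G G' g g' B b'])
    show "(LINT s|lborel. V s * (G n s)\<^sup>2) \<le> (LINT s|lborel. (G' n s)\<^sup>2)" for n
      using J CG G0(1) ab(1) unfolding jacobi_nonneg_def dG[symmetric] by blast
    show "G n \<in> borel_measurable borel" "G' n \<in> borel_measurable borel" for n
      using Ck_on_imp_continuous_on[OF CG] Ck_on_imp_continuous_on[OF CG'] by (auto intro: borel_measurable_continuous_onI)
    show "g \<in> borel_measurable borel" "g' \<in> borel_measurable borel"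
      using gc g' by (auto intro: borel_measurable_continuous_onI)
    have pos: "0 \<le> 1 + C * l" using C(1) l by simp
    show "\<bar>G n s\<bar> \<le> B" for n s
      using Gg[of n s] B1(2)[of s] B2(1) Kn[OF l, of n] pos unfolding B_def by linarith
    show "\<bar>G' n s\<bar> \<le> B" for n s
      using Gg'[of n s] B2(2)[of s] B1(1) Kn[OF pos, of n] l unfolding B_def by linarith
    show "(\<lambda>n. G n s) \<longlonglongrightarrow> g s" for s by (rule lim, rule Gg)
    show "AE s in lborel. (\<lambda>n. G' n s) \<longlonglongrightarrow> g' s" by (rule AE_I2, rule lim, rule Gg')
  qed (use G0 in auto)
qed

text \<open>Steklov averages of \<open>g\<close> are \<open>C\<^sup>1\<close> and converge to \<open>g\<close> together with their derivatives.\<close>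

lemma jacobi_nonneg_Lipschitz:
  assumes J: "jacobi_nonneg \<gamma> V" and V: "continuous_on {\<gamma><..} V" and a: "\<gamma> < a"
    and g: "continuous_on UNIV g" and F: "finite F"
    and D: "\<And>s. s \<notin> F \<Longrightarrow> (g has_real_derivative g' s) (at s)"
    and M: "\<And>s. \<bar>g' s\<bar> \<le> M" and m: "g' \<in> borel_measurable borel"
    and supp: "\<And>s. s \<notin> {a..b} \<Longrightarrow> g s = 0"
  shows "(LINT s|lborel. V s * (g s)\<^sup>2) \<le> (LINT s|lborel. (g' s)\<^sup>2)"
proof -
  have M0: "M \<ge> 0" using M[of 0] by linarith
  \<comment> \<open>The fundamental theorem holds across the finite exceptional set, so the bound on
    g' becomes a Lipschitz constant, which in turn bounds the derivatives of all averages.\<close>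
  have lip: "\<bar>g t - g s\<bar> \<le> M * \<bar>t - s\<bar>" for s t
  proof -
    have *: "\<bar>g t - g s\<bar> \<le> M * (t - s)" if "s \<le> t" for s t
    proof -
      have "(g' has_integral (g t - g s)) {s..t}"
        by (rule fundamental_theorem_of_calculus_interior_strong[OF F that])
          (use D g in \<open>auto simp: has_real_derivative_iff_has_vector_derivative intro: continuous_on_subset\<close>)
      then show ?thesis
        using has_integral_bound[of M g' "g t - g s" s t] M M0 that by auto
    qed
    show ?thesis using *[of s t] *[of t s] by (cases "s \<le> t") (auto simp: abs_minus_commute)
  qed
  obtain N0 :: nat where N0: "1 / (a - \<gamma>) < real N0" using reals_Archimedean2 by blast
  \<comment> \<open>Averaging forward over a length h enlarges the support to the left by h; the
    shift by N0 keeps even the first enlargement inside (\<gamma>, \<infinity>).\<close>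
  define e where "e n = 1 / real (n + N0 + 1)" for n
  have e: "0 < e n" "e n \<le> 1" "e n \<le> e 0" for n
    by (auto simp: e_def divide_simps)
  have e0: "a - e 0 > \<gamma>"
  proof -
    have "0 < a - \<gamma>" using a by simp
    then have "1 < real N0 * (a - \<gamma>)" using N0 by (simp add: divide_less_eq)
    then have "1 < (real N0 + 1) * (a - \<gamma>)" using \<open>0 < a - \<gamma>\<close> by (simp add: algebra_simps)
    then have "e 0 < a - \<gamma>" using \<open>0 < a - \<gamma>\<close> by (simp add: e_def divide_less_eq mult.commute add.commute)
    then show ?thesis by simp
  qed
  obtain T where T: "\<And>s. (T has_real_derivative g s) (at s)"
    using continuous_antiderivative[OF g, of a b] supp by metis
  define G where "G n s = (T (s + e n) - T s) / e n" for n s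
  define G' where "G' n s = (g (s + e n) - g s) / e n" for n s
  have DG: "(G n has_real_derivative G' n s) (at s)" for n s
  proof -
    have "((\<lambda>s. T (s + e n)) has_real_derivative g (s + e n)) (at s)"
      using DERIV_shift[of T "g (s + e n)" s "e n"] T by (simp add: add.commute)
    then show ?thesis unfolding G_def[abs_def] G'_def by (intro DERIV_cdivide DERIV_diff T)
  qed
  have Gz: "\<exists>z. s < z \<and> z < s + e n \<and> G n s = g z" for n s
  proof -
    obtain z where "s < z" "z < s + e n" "T (s + e n) - T s = (s + e n - s) * g z"
      using MVT2[of s "s + e n" T g] T e(1)[of n] by auto
    then show ?thesis using e(1)[of n] by (auto simp: G_def)
  qed
  have Gg: "\<bar>G n s - g s\<bar> \<le> M * e n" for n s
  proof -
    obtain z where z: "s < z" "z < s + e n" "G n s = g z" using Gz by blast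
    have "\<bar>G n s - g s\<bar> \<le> M * \<bar>z - s\<bar>" unfolding z(3) by (rule lip)
    also have "\<dots> \<le> M * e n" using z M0 by (intro mult_left_mono) auto
    finally show ?thesis .
  qed
  have G'M: "\<bar>G' n s\<bar> \<le> M" for n s
    using lip[of "s + e n" s] e(1)[of n] by (simp add: G'_def divide_le_eq)
  have cG': "continuous_on UNIV (G' n)" for n unfolding G'_def
    using e(1)[of n] by (intro continuous_intros continuous_on_compose2[OF g]) auto
  have cG: "continuous_on UNIV (G n)" for n by (rule DERIV_continuous_on[OF DG])
  have G0: "G n s = 0" "G' n s = 0" if "s \<notin> {a - e 0..b}" for n s
  proof -
    have 1: "z \<notin> {a..b}" if "s \<le> z" "z \<le> s + e n" for z
      using \<open>s \<notin> {a - e 0..b}\<close> that e[of n] by auto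
    obtain z where "s < z" "z < s + e n" "G n s = g z" using Gz by blast
    then show "G n s = 0" using supp 1[of z] by simp
    show "G' n s = 0" using supp[OF 1[of s]] supp[OF 1[of "s + e n"]] e(1)[of n] by (simp add: G'_def)
  qed
  have elim: "e \<longlonglongrightarrow> 0"
    unfolding e_def using LIMSEQ_ignore_initial_segment[OF lim_1_over_n[where 'a = real], of "N0 + 1"] by (simp add: add.assoc)
  obtain B1 where B1: "B1 \<ge> 0" "\<And>s. \<bar>g s\<bar> \<le> B1"
    using bounded_compact_support[OF g compact_Icc, of a b] supp by metis
  show ?thesis
  proof (rule jacobi_nonneg_limit[OF V e0, of G G' g g' "B1 + M" b])
    show "(LINT s|lborel. V s * (G n s)\<^sup>2) \<le> (LINT s|lborel. (G' n s)\<^sup>2)" for n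
      by (rule jacobi_nonneg_C1[OF J V e0 cG' DG, of b]) (use G0 in auto)
    show "G n \<in> borel_measurable borel" "G' n \<in> borel_measurable borel" "g \<in> borel_measurable borel" for n
      using cG cG' g by (auto intro: borel_measurable_continuous_onI)
    show "g' \<in> borel_measurable borel" by (rule m)
    show "\<bar>G n s\<bar> \<le> B1 + M" for n s
      using Gg[of n s] B1(2)[of s] mult_left_mono[OF e(2)[of n] M0] by simp
    show "\<bar>G' n s\<bar> \<le> B1 + M" for n s using G'M[of n s] B1(1) by linarith
    show "(\<lambda>n. G n s) \<longlonglongrightarrow> g s" for s
    proof -
      have "(\<lambda>n. M * e n) \<longlonglongrightarrow> 0" using tendsto_mult_left[OF elim, of M] by simp
      then have "(\<lambda>n. G n s - g s) \<longlonglongrightarrow> 0"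
        by (rule Lim_null_comparison[rotated]) (use Gg in \<open>auto intro: always_eventually\<close>)
      then show ?thesis by (simp add: LIM_zero_iff)
    qed
    have "AE s in lborel. s \<notin> F"
      by (rule AE_not_in) (use F in \<open>auto intro: finite_imp_null_set_lborel\<close>)
    then show "AE s in lborel. (\<lambda>n. G' n s) \<longlonglongrightarrow> g' s"
    proof eventually_elim
      case (elim s)
      have "((\<lambda>h. (g (s + h) - g s) / h) \<longlongrightarrow> g' s) (at 0)"
        using D[OF elim] by (simp add: DERIV_def)
      moreover have "filterlim e (at 0) sequentially"
        unfolding filterlim_at using elim \<open>e \<longlonglongrightarrow> 0\<close> e(1) by (auto intro!: always_eventually less_imp_neq[symmetric] dest: less_imp_neq)
      ultimately show ?case unfolding G'_def by (rule filterlim_compose)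
    qed
  qed (use G0 in auto)
qed

section \<open>Positive solutions of the differential equation\<close>

text \<open>The equation u'' = - V u as a first-order system for the pair (u, u'). Derivatives
  within \<open>{p..}\<close> make the initial point itself part of the statement.\<close>

definition ode_solution :: "(real \<Rightarrow> real) \<Rightarrow> real \<Rightarrow> (real \<Rightarrow> real) \<Rightarrow> (real \<Rightarrow> real) \<Rightarrow> bool" where
  "ode_solution V p u u' \<longleftrightarrow> (\<forall>t\<ge>p. (u has_real_derivative u' t) (at t within {p..}) \<and>
     (u' has_real_derivative - (V t * u t)) (at t within {p..}))"

lemma at_within_atLeast: "p < t \<Longrightarrow> at t within {p..} = at (t::real)"
  by (rule at_within_interior) simp

lemma ode_solution_at:
  assumes "ode_solution V p u u'" "p < t"
  shows "(u has_real_derivative u' t) (at t)" "(u' has_real_derivative - (V t * u t)) (at t)"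
  using assms at_within_atLeast[of p t] unfolding ode_solution_def by (metis less_imp_le)+

lemma ode_solution_mono: "ode_solution V p u u' \<Longrightarrow> p \<le> q \<Longrightarrow> ode_solution V q u u'"
  unfolding ode_solution_def
proof (intro allI impI)
  fix t
  assume *: "\<forall>t\<ge>p. (u has_real_derivative u' t) (at t within {p..}) \<and>
      (u' has_real_derivative - (V t * u t)) (at t within {p..})" and "p \<le> q" "q \<le> t"
  then have "{q..} \<subseteq> {p..}" "t \<ge> p" by auto
  then show "(u has_real_derivative u' t) (at t within {q..}) \<and>
      (u' has_real_derivative - (V t * u t)) (at t within {q..})"
    using * has_field_derivative_subset by blast
qed

lemma ode_solution_continuous:
  assumes "ode_solution V p u u'"
  shows "continuous_on {p..} u" "continuous_on {p..} u'"
  using assms unfolding ode_solution_def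
  by (auto intro!: DERIV_continuous_on)

lemma ode_solution_comb:
  assumes "ode_solution V p u u'" "ode_solution V p v v'"
  shows "ode_solution V p (\<lambda>t. a * u t + b * v t) (\<lambda>t. a * u' t + b * v' t)"
proof -
  have "((\<lambda>t. a * u t + b * v t) has_real_derivative a * u' t + b * v' t) (at t within {p..})"
    "((\<lambda>t. a * u' t + b * v' t) has_real_derivative - (V t * (a * u t + b * v t))) (at t within {p..})" if "t \<ge> p" for t
  proof -
    have d: "(u has_real_derivative u' t) (at t within {p..})" "(u' has_real_derivative - (V t * u t)) (at t within {p..})"
      "(v has_real_derivative v' t) (at t within {p..})" "(v' has_real_derivative - (V t * v t)) (at t within {p..})"
      using assms that unfolding ode_solution_def by auto
    show "((\<lambda>t. a * u t + b * v t) has_real_derivative a * u' t + b * v' t) (at t within {p..})"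
      by (intro DERIV_add DERIV_cmult d)
    have "((\<lambda>t. a * u' t + b * v' t) has_real_derivative a * (- (V t * u t)) + b * (- (V t * v t))) (at t within {p..})"
      by (intro DERIV_add DERIV_cmult d)
    then show "((\<lambda>t. a * u' t + b * v' t) has_real_derivative - (V t * (a * u t + b * v t))) (at t within {p..})"
      by (simp add: algebra_simps)
  qed
  then show ?thesis unfolding ode_solution_def by blast
qed

lemma wronskian_const:
  assumes "ode_solution V p u u'" "ode_solution V p v v'" "t \<ge> p" "s \<ge> p"
  shows "u t * v' t - u' t * v t = u s * v' s - u' s * v s"
proof -
  have "((\<lambda>t. u t * v' t - u' t * v t) has_real_derivative 0) (at x within {p..})" if "x \<in> {p..}" for x
  proof -
    have d: "(u has_real_derivative u' x) (at x within {p..})" "(u' has_real_derivative - (V x * u x)) (at x within {p..})"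
      "(v has_real_derivative v' x) (at x within {p..})" "(v' has_real_derivative - (V x * v x)) (at x within {p..})"
      using assms that unfolding ode_solution_def by auto
    have "((\<lambda>t. u t * v' t - u' t * v t) has_real_derivative
        (u' x * v' x + (- (V x * v x)) * u x) - ((- (V x * u x)) * v x + v' x * u' x)) (at x within {p..})"
      by (intro DERIV_diff DERIV_mult d)
    then show ?thesis by (simp add: algebra_simps)
  qed
  then obtain k where "\<And>x. x \<in> {p..} \<Longrightarrow> u x * v' x - u' x * v x = k"
    using has_field_derivative_zero_constant[of "{p..}" "\<lambda>t. u t * v' t - u' t * v t"] by auto
  then show ?thesis using assms(3,4) by simp
qed

text \<open>Uniqueness from Wronskians instead of a Gronwall estimate: both Wronskians of
  \<open>u\<close> with the independent solutions \<open>v\<close> and \<open>w\<close> vanish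
  identically, and Cramer's rule returns u = u' = 0.\<close>

lemma ode_unique:
  assumes v: "ode_solution V p v v'" and w: "ode_solution V p w w'" and u: "ode_solution V p u u'"
    and \<tau>: "\<tau> \<ge> p" "u \<tau> = 0" "u' \<tau> = 0" and nz: "v \<tau> * w' \<tau> - v' \<tau> * w \<tau> \<noteq> 0" and t: "t \<ge> p"
  shows "u t = 0" "u' t = 0"
proof -
  have 1: "u t * v' t - u' t * v t = 0" "u t * w' t - u' t * w t = 0"
    using wronskian_const[OF u v t \<tau>(1)] wronskian_const[OF u w t \<tau>(1)] \<tau> by auto
  have 2: "v t * w' t - v' t * w t \<noteq> 0" using wronskian_const[OF v w t \<tau>(1)] nz by simp
  have 3: "u t * (v t * w' t - v' t * w t) = v t * (u t * w' t - u' t * w t) - w t * (u t * v' t - u' t * v t)"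
    "u' t * (v t * w' t - v' t * w t) = v' t * (u t * w' t - u' t * w t) - w' t * (u t * v' t - u' t * v t)"
    by (simp_all add: algebra_simps)
  show "u t = 0" "u' t = 0" using 3[unfolded 1] 2 by simp_all
qed

lemma primitive_has_derivative:
  fixes f :: "real \<Rightarrow> real"
  assumes "continuous_on {p..} f" "t \<ge> p"
  shows "((\<lambda>t. integral {p..t} f) has_real_derivative f t) (at t within {p..})"
proof -
  have "((\<lambda>t. integral {p..t} f) has_real_derivative f t) (at t within {p..t + 1})"
    by (rule integral_has_real_derivative) (use assms in \<open>auto intro: continuous_on_subset\<close>)
  moreover have "at t within {p..t + 1} = at t within {p..}"
    by (rule at_within_nhd[of _ "{..<t + 1}"]) (use assms in auto)
  ultimately show ?thesis by simp
qed

lemma primitive_bound: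
  fixes f :: "real \<Rightarrow> real"
  assumes f: "continuous_on {p..} f" and b: "\<And>s. s \<in> {p..R} \<Longrightarrow> \<bar>f s\<bar> \<le> C * (s - p) ^ m / fact m" and t: "t \<in> {p..R}"
  shows "\<bar>integral {p..t} f\<bar> \<le> C * (t - p) ^ Suc m / fact (Suc m)"
proof -
  have D: "((\<lambda>s. C * (s - p) ^ Suc m / fact (Suc m)) has_real_derivative C * (x - p) ^ m / fact m) (at x within {p..t})" for x
  proof -
    have "((\<lambda>s. C * (s - p) ^ Suc m / fact (Suc m)) has_real_derivative
        C * (real (Suc m) * (1 * (x - p) ^ m)) / fact (Suc m)) (at x within {p..t})"
      by (rule DERIV_cdivide DERIV_cmult DERIV_power_Suc DERIV_diff[where E = 0, simplified] DERIV_ident DERIV_const derivative_eq_intros refl | simp)+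
    then show ?thesis by (simp add: field_simps del: of_nat_Suc)
  qed
  have I: "((\<lambda>s. C * (s - p) ^ m / fact m) has_integral
      (C * (t - p) ^ Suc m / fact (Suc m) - C * (p - p) ^ Suc m / fact (Suc m))) {p..t}"
    by (rule fundamental_theorem_of_calculus)
      (use t D in \<open>auto simp: has_real_derivative_iff_has_vector_derivative[symmetric]\<close>)
  have "norm (integral {p..t} f) \<le> integral {p..t} (\<lambda>s. C * (s - p) ^ m / fact m)"
  proof (rule integral_norm_bound_integral)
    show "f integrable_on {p..t}"
      by (rule integrable_continuous_interval) (use f in \<open>auto intro: continuous_on_subset\<close>)
    show "(\<lambda>s. C * (s - p) ^ m / fact m) integrable_on {p..t}" using I by blast
  qed (use b t in auto)
  also have "\<dots> = C * (t - p) ^ Suc m / fact (Suc m)" using integral_unique[OF I] by simp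
  finally show ?thesis by simp
qed

text \<open>Picard iteration for \<open>u' = z\<close>, \<open>z' = - V u\<close>: the \<open>n\<close>-th term of \<open>z\<close>.\<close>

primrec picard_term :: "(real \<Rightarrow> real) \<Rightarrow> real \<Rightarrow> nat \<Rightarrow> real \<Rightarrow> real" where
  "picard_term V p 0 = (\<lambda>t. 1)"
| "picard_term V p (Suc n) = (\<lambda>t. integral {p..t} (\<lambda>s. - (V s * integral {p..s} (picard_term V p n))))"

text \<open>By linearity the Picard series is dominated on each compact interval by an exponential
  series, so the solution exists on the whole half-line at once.\<close>

lemma ode_exists:
  assumes V: "continuous_on {p..} V"
  obtains u u' where "ode_solution V p u u'" "u p = 0" "u' p = 1"
proof -
  define W where "W = picard_term V p"
  define Z where "Z n t = integral {p..t} (W n)" for n t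
  have W0: "W 0 = (\<lambda>t. 1)" and WS: "W (Suc n) = (\<lambda>t. integral {p..t} (\<lambda>s. - (V s * Z n s)))" for n
    by (simp_all add: W_def Z_def)
  have cP: "continuous_on {p..} (\<lambda>t. integral {p..t} f)" if "continuous_on {p..} f" for f :: "real \<Rightarrow> real"
    by (rule DERIV_continuous_on[OF primitive_has_derivative[OF that]]) simp
  have cW: "continuous_on {p..} (W n)" for n
  proof (induction n)
    case (Suc n)
    have "continuous_on {p..} (Z n)" unfolding Z_def by (rule cP[OF Suc])
    then show ?case unfolding WS by (intro cP continuous_intros V)
  qed (simp add: W0)
  have cZ: "continuous_on {p..} (Z n)" for n unfolding Z_def by (rule cP[OF cW])
  have DZ: "(Z n has_real_derivative W n t) (at t within {p..})" if "t \<ge> p" for n t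
    unfolding Z_def by (rule primitive_has_derivative[OF cW that])
  have DW: "(W (Suc n) has_real_derivative - (V t * Z n t)) (at t within {p..})" if "t \<ge> p" for n t
    unfolding WS by (rule primitive_has_derivative[OF _ that]) (intro continuous_intros V cZ)
  have Zp: "Z n p = 0" and Wp: "W (Suc n) p = 0" for n by (simp_all add: Z_def WS)
  define u where "u t = (\<Sum>n. Z n t)" for t
  define u' where "u' t = (\<Sum>n. W n t)" for t
  \<comment> \<open>\<open>V\<close> is bounded only on compact intervals, so the termwise
    differentiation is carried out on \<open>{p..R}\<close> with \<open>R\<close> arbitrary.\<close>
  have main: "(u has_real_derivative u' t) (at t within {p..R}) \<and> (u' has_real_derivative - (V t * u t)) (at t within {p..R})"
    if t: "t \<in> {p..R}" for t R
  proof -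
    have R: "p \<le> R" using t by auto
    have "bounded (V ` {p..R})"
      by (intro compact_imp_bounded compact_continuous_image continuous_on_subset[OF V]) auto
    then obtain M where "\<forall>x\<in>V ` {p..R}. norm x \<le> M" unfolding bounded_iff by blast
    then have M: "\<bar>V s\<bar> \<le> M" if "s \<in> {p..R}" for s using that by auto
    have M0: "M \<ge> 0" using M[of p] R by auto
    have bW: "\<bar>W n s\<bar> \<le> M ^ n * (s - p) ^ (2 * n) / fact (2 * n)"
      and bZ: "\<bar>Z n s\<bar> \<le> M ^ n * (s - p) ^ Suc (2 * n) / fact (Suc (2 * n))" if "s \<in> {p..R}" for n s
    proof -
      have *: "(\<forall>s\<in>{p..R}. \<bar>W n s\<bar> \<le> M ^ n * (s - p) ^ (2 * n) / fact (2 * n)) \<and>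
          (\<forall>s\<in>{p..R}. \<bar>Z n s\<bar> \<le> M ^ n * (s - p) ^ Suc (2 * n) / fact (Suc (2 * n)))"
      proof (induction n)
        case 0
        have "\<bar>W 0 s\<bar> \<le> M ^ 0 * (s - p) ^ (2 * 0) / fact (2 * 0)" for s by (simp add: W0)
        then show ?case unfolding Z_def using primitive_bound[OF cW, of R 0 "M ^ 0" "2 * 0"] by blast
      next
        case (Suc n)
        have "\<bar>- (V s * Z n s)\<bar> \<le> M ^ Suc n * (s - p) ^ Suc (2 * n) / fact (Suc (2 * n))" if "s \<in> {p..R}" for s
        proof -
          have "\<bar>- (V s * Z n s)\<bar> \<le> M * (M ^ n * (s - p) ^ Suc (2 * n) / fact (Suc (2 * n)))"
            unfolding abs_minus_cancel abs_mult using M[OF that] Suc that M0 by (intro mult_mono) auto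
          then show ?thesis by simp
        qed
        then have "\<bar>W (Suc n) s\<bar> \<le> M ^ Suc n * (s - p) ^ Suc (Suc (2 * n)) / fact (Suc (Suc (2 * n)))" if "s \<in> {p..R}" for s
          unfolding WS by (intro primitive_bound[OF _ _ that] continuous_intros V cZ)
        then have W: "\<bar>W (Suc n) s\<bar> \<le> M ^ Suc n * (s - p) ^ (2 * Suc n) / fact (2 * Suc n)" if "s \<in> {p..R}" for s
          using that by simp
        then show ?case unfolding Z_def using primitive_bound[OF cW W] by blast
      qed
      show "\<bar>W n s\<bar> \<le> M ^ n * (s - p) ^ (2 * n) / fact (2 * n)"
        "\<bar>Z n s\<bar> \<le> M ^ n * (s - p) ^ Suc (2 * n) / fact (Suc (2 * n))"
        using * that by blast+
    qed
    define L where "L = R - p + 1"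
    have L: "L \<ge> 1" using R by (simp add: L_def)
    \<comment> \<open>Since L \<ge> 1, both L^(2n) and L^(2n+1) are at most L^(2n+1), and both
      factorials are at least n!. One summable majorant thus serves the series for u and for
      u'.\<close>
    define X where "X n = L * (inverse (fact n) * (M * L\<^sup>2) ^ n)" for n
    have sX: "summable X" unfolding X_def by (intro summable_mult summable_exp)
    have bd: "M ^ n * (s - p) ^ k / fact k \<le> X n" if "s \<in> {p..R}" "k \<ge> n" "k \<le> Suc (2 * n)" for n k s
    proof -
      have "(s - p) ^ k \<le> L ^ k" using that L by (intro power_mono) (auto simp: L_def)
      also have "\<dots> \<le> L ^ Suc (2 * n)" by (rule power_increasing[OF that(3) L])
      finally have "M ^ n * (s - p) ^ k / fact k \<le> M ^ n * L ^ Suc (2 * n) / fact n"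
        using M0 L that(2) by (intro frac_le mult_left_mono fact_mono) auto
      also have "\<dots> = X n" by (simp add: X_def power_mult_distrib power_mult divide_inverse)
      finally show ?thesis .
    qed
    have ZX: "norm (Z n s) \<le> X n" and WX: "norm (W n s) \<le> X n" if "s \<in> {p..R}" for n s
      using order_trans[OF bZ[OF that] bd[OF that]] order_trans[OF bW[OF that] bd[OF that]] by auto
    have uW: "uniform_limit {p..R} (\<lambda>n x. \<Sum>i<n. W i x) u' sequentially"
      unfolding u'_def by (rule Weierstrass_m_test[OF WX sX])
    have VX: "norm (- (V s * Z n s)) \<le> M * X n" if "s \<in> {p..R}" for n s
      using mult_mono[OF M[OF that] ZX[OF that] M0 norm_ge_zero] by (simp add: abs_mult)
    have "uniform_limit {p..R} (\<lambda>n x. \<Sum>i<n. - (V x * Z i x)) (\<lambda>x. \<Sum>n. - (V x * Z n x)) sequentially"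
      by (rule Weierstrass_m_test[OF VX summable_mult[OF sX]])
    then have uV: "uniform_limit {p..R} (\<lambda>n x. \<Sum>i<n. - (V x * Z i x)) (\<lambda>x. - (V x * u x)) sequentially"
    proof (rule uniform_limit_cong'[THEN iffD1, rotated 2])
      fix x assume "x \<in> {p..R}"
      then have "summable (\<lambda>n. Z n x)" by (intro summable_comparison_test'[OF sX, of 0] ZX)
      then show "(\<Sum>n. - (V x * Z n x)) = - (V x * u x)"
        by (simp add: u_def suminf_mult suminf_minus summable_mult)
    qed simp
    have within: "(f has_real_derivative d) (at x within {p..R})" if "(f has_real_derivative d) (at x within {p..})" for f d x
      by (rule has_field_derivative_subset[OF that]) auto
    have pR: "p \<in> {p..R}" using R by simp
    have "\<exists>g. \<forall>x\<in>{p..R}. (\<lambda>n. Z n x) sums g x \<and> (g has_real_derivative u' x) (at x within {p..R})"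
    proof (rule has_field_derivative_series[OF _ _ uW pR])
      show "(Z n has_real_derivative W n x) (at x within {p..R})" if "x \<in> {p..R}" for n x
        by (rule within[OF DZ]) (use that in simp)
    qed (simp_all add: Zp)
    then obtain g1 where g1: "\<And>x. x \<in> {p..R} \<Longrightarrow> (\<lambda>n. Z n x) sums g1 x"
      "\<And>x. x \<in> {p..R} \<Longrightarrow> (g1 has_real_derivative u' x) (at x within {p..R})" by blast
    \<comment> \<open>The term \<open>W 0\<close> is the constant 1 and contributes nothing to the
      derivative, while the derivative of \<open>W (Suc n)\<close> involves \<open>Z n\<close>. The
      shifted series is therefore differentiated and the 1 added back.\<close>
    have "\<exists>g. \<forall>x\<in>{p..R}. (\<lambda>n. W (Suc n) x) sums g x \<and> (g has_real_derivative - (V x * u x)) (at x within {p..R})"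
    proof (rule has_field_derivative_series[OF _ _ uV pR])
      show "(W (Suc n) has_real_derivative - (V x * Z n x)) (at x within {p..R})" if "x \<in> {p..R}" for n x
        by (rule within[OF DW]) (use that in simp)
    qed (simp_all add: Wp)
    then obtain g2 where g2: "\<And>x. x \<in> {p..R} \<Longrightarrow> (\<lambda>n. W (Suc n) x) sums g2 x"
      "\<And>x. x \<in> {p..R} \<Longrightarrow> (g2 has_real_derivative - (V x * u x)) (at x within {p..R})" by blast
    have "u x = g1 x" if "x \<in> {p..R}" for x using g1(1)[OF that] by (simp add: u_def sums_iff)
    then have 1: "(u has_real_derivative u' t) (at t within {p..R})"
      by (intro has_field_derivative_transform_within[OF g1(2)[OF t] zero_less_one t]) auto
    have e2: "g2 x + 1 = u' x" if "x \<in> {p..R}" for x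
      using sums_Suc[OF g2(1)[OF that]] by (simp add: u'_def sums_iff W0)
    have "((\<lambda>x. g2 x + 1) has_real_derivative - (V t * u t) + 0) (at t within {p..R})"
      by (rule DERIV_add[OF g2(2)[OF t] DERIV_const])
    then have "((\<lambda>x. g2 x + 1) has_real_derivative - (V t * u t)) (at t within {p..R})"
      by (simp only: add_0_right)
    then have "(u' has_real_derivative - (V t * u t)) (at t within {p..R})"
      by (rule has_field_derivative_transform_within[OF _ zero_less_one t e2])
    with 1 show ?thesis by blast
  qed
  have "ode_solution V p u u'" unfolding ode_solution_def
  proof (intro allI impI)
    fix t assume t: "p \<le> t"
    have "at t within {p..t + 1} = at t within {p..}"
      by (rule at_within_nhd[of _ "{..<t + 1}"]) (use t in auto)
    then show "(u has_real_derivative u' t) (at t within {p..}) \<and> (u' has_real_derivative - (V t * u t)) (at t within {p..})"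
      using main[of t "t + 1"] t by simp
  qed
  moreover have "u p = 0" by (simp add: u_def Zp)
  moreover have "u' p = 1"
  proof -
    have "(\<lambda>n. W n p) sums (\<Sum>n\<in>{0}. W n p)"
      by (rule sums_finite) (use Wp in \<open>auto simp: gr0_conv_Suc\<close>)
    then show ?thesis by (simp add: u'_def sums_iff W0)
  qed
  ultimately show ?thesis by (rule that)
qed

section \<open>Conjugate points and positivity of solutions\<close>

lemma first_zero:
  fixes y :: "real \<Rightarrow> real"
  assumes c: "continuous_on {p..} y" and p: "y p = 0" "(y has_real_derivative l) (at p within {p..})" "l > 0"
    and t1: "t1 > p" "y t1 \<le> 0"
  obtains b where "b > p" "y b = 0" "\<And>t. p < t \<Longrightarrow> t < b \<Longrightarrow> y t > 0"
proof -
  obtain d where d: "d > 0" "\<And>h. h > 0 \<Longrightarrow> p + h \<in> {p..} \<Longrightarrow> h < d \<Longrightarrow> y p < y (p + h)"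
    using has_real_derivative_pos_inc_right[OF p(2,3)] by blast
  have pos: "y t > 0" if "p < t" "t < p + d" for t
    using d(2)[of "t - p"] that p(1) by simp
  \<comment> \<open>The zero at \<open>p\<close> itself must be avoided. The search starts at a
    point where \<open>y\<close> is already positive, so that the zeros in \<open>{q..t1}\<close>
    form a compact set with a least element.\<close>
  define q where "q = p + d / 2"
  have q: "p < q" "y q > 0" using d(1) pos[of q] by (auto simp: q_def)
  have qt: "q \<le> t1"
  proof (rule ccontr)
    assume "\<not> q \<le> t1"
    then have "t1 < p + d" using d(1) unfolding q_def by linarith
    then show False using pos[of t1] t1 by linarith
  qed
  define S where "S = {t\<in>{q..t1}. y t = 0}"
  have cq: "continuous_on {q..t1} y" using q by (intro continuous_on_subset[OF c]) auto
  have "compact S"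
  proof -
    have "closed ({q..t1} \<inter> y -` {0})" by (rule continuous_closed_preimage[OF cq]) auto
    moreover have "S = {q..t1} \<inter> ({q..t1} \<inter> y -` {0})" by (auto simp: S_def)
    ultimately show ?thesis by (metis compact_Icc compact_Int_closed)
  qed
  moreover have "S \<noteq> {}"
    using IVT2'[of y t1 0 q] q t1 qt cq by (force simp: S_def)
  ultimately obtain b where b: "b \<in> S" "\<And>t. t \<in> S \<Longrightarrow> b \<le> t" using compact_attains_inf by metis
  show ?thesis
  proof (rule that[of b])
    show "b > p" "y b = 0" using b(1) q by (auto simp: S_def)
    show "y t > 0" if t: "p < t" "t < b" for t
    proof (rule ccontr)
      assume n: "\<not> y t > 0"
      then have "q \<le> t" using pos[of t] t(1) d(1) unfolding q_def by force
      then have "continuous_on {q..t} y" using t b(1) by (intro continuous_on_subset[OF cq]) (auto simp: S_def)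
      then obtain z where "q \<le> z" "z \<le> t" "y z = 0"
        using IVT2'[of y t 0 q] q n \<open>q \<le> t\<close> by force
      then show False using b(2)[of z] b(1) t by (auto simp: S_def)
    qed
  qed
qed

text \<open>Jacobi's necessary condition: past a conjugate point \<open>b\<close> of \<open>p\<close>, replacing the solution by a
  chord that cuts off the corner at \<open>b\<close> makes the quadratic form negative.\<close>

lemma jacobi_positive:
  assumes J: "jacobi_nonneg \<gamma> V" and V: "continuous_on {\<gamma><..} V" and Vpos: "\<And>t. t > \<gamma> \<Longrightarrow> V t > 0"
    and p: "p > \<gamma>" and sol: "ode_solution V p y y'" and ic: "y p = 0" "y' p = 1" and t: "t > p"
  shows "y t > 0"
proof (rule ccontr)
  assume "\<not> y t > 0"
  note cy = ode_solution_continuous[OF sol]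
  have "(y has_real_derivative 1) (at p within {p..})"
    using sol ic unfolding ode_solution_def by (metis order_refl)
  then obtain b where b: "b > p" "y b = 0" "\<And>t. p < t \<Longrightarrow> t < b \<Longrightarrow> y t > 0"
    using first_zero[OF cy(1) ic(1) _ _ t] \<open>\<not> y t > 0\<close> by (metis not_less zero_less_one)
  \<comment> \<open>Rolle gives a critical point before \<open>b\<close>, and after it y'' = - V y
    is strictly negative because \<open>V\<close> and \<open>y\<close> are positive.\<close>
  have y'b: "y' b < 0"
  proof -
    have "continuous_on {p..b} y" by (rule continuous_on_subset[OF cy(1)]) auto
    moreover have "y differentiable (at x)" if "p < x" for x
      using ode_solution_at(1)[OF sol that] real_differentiable_def by blast
    ultimately obtain l m where m: "p < m" "m < b" "(y has_real_derivative l) (at m)" "y b - y p = (b - p) * l"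
      using MVT[OF b(1)] by blast
    then have "l = 0" using b ic by simp
    then have m: "p < m" "m < b" "y' m = 0"
      using m DERIV_unique[OF m(3) ode_solution_at(1)[OF sol m(1)]] by auto
    obtain z where z: "m < z" "z < b" "y' b - y' m = (b - m) * (- (V z * y z))"
      using MVT2[OF m(2), of y' "\<lambda>z. - (V z * y z)"] ode_solution_at(2)[OF sol] m(1) by force
    have "V z * y z > 0" using Vpos[of z] b(3)[of z] z m p by simp
    then show ?thesis using z m by (simp add: mult_pos_neg)
  qed
  define e where "e = b + 1"
  \<comment> \<open>As c tends to b this expression tends to y'(b) < 0, because y(b) = 0 and the
    right end \<open>e\<close> of the chord stays beyond \<open>b\<close>. It is the factor that
    decides the sign of the quadratic form at the end.\<close>
  obtain c where c: "p < c" "c < b" "y' c + y c / (e - c) < 0"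
  proof -
    have "continuous_on {p..b} (\<lambda>c. y' c + y c / (e - c))"
      by (intro continuous_intros continuous_on_subset[OF cy(1)] continuous_on_subset[OF cy(2)]) (auto simp: e_def)
    then have "((\<lambda>c. y' c + y c / (e - c)) \<longlongrightarrow> y' b + y b / (e - b)) (at b within {p..b})"
      using b(1) by (auto simp: continuous_on_def)
    then have "\<forall>\<^sub>F c in at b within {p..b}. y' c + y c / (e - c) < 0"
      using y'b b(2) by (intro order_tendstoD(2)) auto
    then obtain d where d: "d > 0" "\<And>c. c \<in> {p..b} \<Longrightarrow> c \<noteq> b \<Longrightarrow> dist c b < d \<Longrightarrow> y' c + y c / (e - c) < 0"
      unfolding eventually_at by blast
    define c where "c = max ((p + b) / 2) (b - d / 2)"
    have "p < c" "c < b" "dist c b < d" using b(1) d(1) by (auto simp: c_def dist_real_def max_def field_simps)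
    then show ?thesis using d(2)[of c] that by auto
  qed
  have ce: "c < e" "b < e" using c by (auto simp: e_def)
  have yc: "y c > 0" using b(3) c by auto
  \<comment> \<open>Minus the slope of the chord from (c, y(c)) to (e, 0).\<close>
  define \<kappa> where "\<kappa> = y c / (e - c)"
  have \<kappa>: "\<kappa> > 0" "\<kappa> * (e - c) = y c" using yc ce by (auto simp: \<kappa>_def)
  define g where "g s = (if s \<le> p then 0 else if s \<le> c then y s else if s \<le> e then \<kappa> * (e - s) else 0)" for s
  define g' where "g' s = indicator {p..c} s * y' s - \<kappa> * indicator {c..e} s" for s
  have "continuous_on UNIV (\<lambda>s. if s \<le> e then \<kappa> * (e - s) else 0)"
    by (rule continuous_on_cases_le) (auto intro!: continuous_intros)
  then have tail: "continuous_on X (\<lambda>s. if s \<le> e then \<kappa> * (e - s) else 0)" for X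
    by (rule continuous_on_subset) simp
  have mid: "continuous_on {p..} (\<lambda>s. if s \<le> c then y s else if s \<le> e then \<kappa> * (e - s) else 0)"
  proof (rule continuous_on_cases_le)
    show "continuous_on {t \<in> {p..}. t \<le> c} y" by (rule continuous_on_subset[OF cy(1)]) auto
  qed (use tail ce \<kappa> in \<open>simp_all del: if_split\<close>)
  have gc: "continuous_on UNIV g" unfolding g_def[abs_def]
  proof (rule continuous_on_cases_le)
    show "continuous_on {t \<in> UNIV. p \<le> t} (\<lambda>s. if s \<le> c then y s else if s \<le> e then \<kappa> * (e - s) else 0)"
      by (rule continuous_on_subset[OF mid]) auto
  qed (use c ic in \<open>simp_all del: if_split\<close>)
  have D: "(g has_real_derivative g' s) (at s)" if "s \<notin> {p, c, e}" for s
  proof -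
    have "s < p \<or> (p < s \<and> s < c) \<or> (c < s \<and> s < e) \<or> e < s" using that by auto
    then consider "s < p" | "p < s" "s < c" | "c < s" "s < e" | "e < s" by blast
    then show ?thesis
    proof cases
      case 1
      have "((\<lambda>_. 0) has_real_derivative 0) (at s)" by simp
      then have "(g has_real_derivative 0) (at s)"
        by (rule has_field_derivative_transform_within_open[of _ _ _ "{..<p}"]) (use 1 in \<open>auto simp: g_def\<close>)
      then show ?thesis using 1 c ce by (simp add: g'_def)
    next
      case 2
      have "(g has_real_derivative y' s) (at s)"
        by (rule has_field_derivative_transform_within_open[OF ode_solution_at(1)[OF sol 2(1)], of "{p<..<c}"])
          (use 2 in \<open>auto simp: g_def\<close>)
      then show ?thesis using 2 by (simp add: g'_def)
    next
      case 3
      have "((\<lambda>s. \<kappa> * (e - s)) has_real_derivative - \<kappa>) (at s)"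
        by (auto intro!: derivative_eq_intros)
      then have "(g has_real_derivative - \<kappa>) (at s)"
        by (rule has_field_derivative_transform_within_open[of _ _ _ "{c<..<e}"]) (use 3 c in \<open>auto simp: g_def\<close>)
      then show ?thesis using 3 by (simp add: g'_def)
    next
      case 4
      have "((\<lambda>_. 0) has_real_derivative 0) (at s)" by simp
      then have "(g has_real_derivative 0) (at s)"
        by (rule has_field_derivative_transform_within_open[of _ _ _ "{e<..}"]) (use 4 c ce in \<open>auto simp: g_def\<close>)
      then show ?thesis using 4 c ce by (simp add: g'_def)
    qed
  qed
  have "bounded (y' ` {p..c})"
    by (intro compact_imp_bounded compact_continuous_image continuous_on_subset[OF cy(2)]) auto
  then obtain M where "\<forall>x\<in>y' ` {p..c}. norm x \<le> M" unfolding bounded_iff by blast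
  then have M: "\<bar>y' s\<bar> \<le> M" if "s \<in> {p..c}" for s using that by auto
  have M0: "M \<ge> 0" using M[of p] c by auto
  have g'M: "\<bar>g' s\<bar> \<le> M + \<kappa>" for s
    using M[of s] M0 \<kappa>(1) by (auto simp: g'_def indicator_def)
  have y'm: "(\<lambda>s. indicator {p..c} s *\<^sub>R y' s) \<in> borel_measurable borel"
    by (rule borel_measurable_continuous_on_indicator) (auto intro: continuous_on_subset[OF cy(2)])
  have g'm: "g' \<in> borel_measurable borel" using y'm unfolding g'_def[abs_def] by simp
  have supp: "g s = 0" if "s \<notin> {p..e}" for s using that c ce by (auto simp: g_def)
  have le: "(LINT s|lborel. V s * (g s)\<^sup>2) \<le> (LINT s|lborel. (g' s)\<^sup>2)"
    by (rule jacobi_nonneg_Lipschitz[where F = "{p, c, e}", OF J V p gc _ D g'M g'm supp]) auto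
  have int: "integrable lborel (\<lambda>s. indicator {p..c} s * f s)"
    "(LINT s|lborel. indicator {p..c} s * f s) = integral {p..c} f" if "continuous_on {p..c} f" for f :: "real \<Rightarrow> real"
  proof -
    have *: "integrable lborel (\<lambda>s. indicator {p..c} s *\<^sub>R f s)"
      by (rule borel_integrable_compact) (use that in auto)
    then show "integrable lborel (\<lambda>s. indicator {p..c} s * f s)" by simp
    show "(LINT s|lborel. indicator {p..c} s * f s) = integral {p..c} f"
      using set_borel_integral_eq_integral(2)[of "{p..c}" f] * by (simp add: set_integrable_def set_lebesgue_integral_def)
  qed
  have cV: "continuous_on {p..c} V" by (rule continuous_on_subset[OF V]) (use p in auto)
  have cyc: "continuous_on {p..c} y" "continuous_on {p..c} y'" using cy by (auto intro: continuous_on_subset)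
  have c1: "continuous_on {p..c} (\<lambda>s. (y' s)\<^sup>2)" and c2: "continuous_on {p..c} (\<lambda>s. V s * (y s)\<^sup>2)"
    by (intro continuous_intros cV cyc)+
  \<comment> \<open>The contribution of the chord to \<integral> V g^2 is nonnegative and is
    dropped.\<close>
  have lower: "(LINT s|lborel. indicator {p..c} s * (V s * (y s)\<^sup>2)) \<le> (LINT s|lborel. V s * (g s)\<^sup>2)"
  proof (rule integral_mono[OF int(1)[OF c2]])
    have "Ck_on 0 UNIV (\<lambda>s. V s * (g s)\<^sup>2)"
      by (rule Ck_on_extend_zero[of "{\<gamma><..}" _ _ "{p..e}"])
        (use p supp V gc in \<open>auto simp: Ck_on_0 intro!: continuous_intros intro: continuous_on_subset\<close>)
    then show "integrable lborel (\<lambda>s. V s * (g s)\<^sup>2)"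
      by (intro integrable_compact_support[OF _ compact_Icc, of _ p e]) (use supp in \<open>auto simp: Ck_on_0\<close>)
    show "indicator {p..c} s * (V s * (y s)\<^sup>2) \<le> V s * (g s)\<^sup>2" for s
    proof (cases "s \<in> {p..c}")
      case True
      then show ?thesis using ic by (auto simp: g_def)
    next
      case False
      then show ?thesis using Vpos[of s] supp[of s] p by (cases "s \<in> {p..e}") auto
    qed
  qed
  have upper: "(LINT s|lborel. (g' s)\<^sup>2) = (LINT s|lborel. indicator {p..c} s * (y' s)\<^sup>2) + \<kappa>\<^sup>2 * (e - c)"
  proof -
    have "AE s in lborel. s \<notin> {c}" by (rule AE_not_in) (auto intro: finite_imp_null_set_lborel)
    then have ae: "AE s in lborel. (g' s)\<^sup>2 = indicator {p..c} s * (y' s)\<^sup>2 + \<kappa>\<^sup>2 * indicator {c..e} s"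
      by eventually_elim (auto simp: g'_def indicator_def)
    have "(LINT s|lborel. (g' s)\<^sup>2) = (LINT s|lborel. indicator {p..c} s * (y' s)\<^sup>2 + \<kappa>\<^sup>2 * indicator {c..e} s)"
      by (rule integral_cong_AE[OF _ _ ae])
        (use g'm borel_measurable_integrable[OF int(1)[OF c1]] in auto)
    also have "\<dots> = (LINT s|lborel. indicator {p..c} s * (y' s)\<^sup>2) + (LINT s|lborel. \<kappa>\<^sup>2 * indicator {c..e} s)"
      by (rule Bochner_Integration.integral_add[OF int(1)[OF c1] integrable_Icc_const])
    also have "(LINT s|lborel. \<kappa>\<^sup>2 * indicator {c..e} s) = \<kappa>\<^sup>2 * (e - c)" using ce by simp
    finally show ?thesis .
  qed
  have "integral {p..c} (\<lambda>s. V s * (y s)\<^sup>2) \<le> integral {p..c} (\<lambda>s. (y' s)\<^sup>2) + \<kappa>\<^sup>2 * (e - c)"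
    using lower le upper unfolding int(2)[OF c1] int(2)[OF c2] by linarith
  \<comment> \<open>The equation makes the integrand the derivative of y y', which vanishes at
    \<open>p\<close>.\<close>
  moreover have "integral {p..c} (\<lambda>s. (y' s)\<^sup>2) - integral {p..c} (\<lambda>s. V s * (y s)\<^sup>2) = y c * y' c"
  proof -
    have "((\<lambda>s. (y' s)\<^sup>2 - V s * (y s)\<^sup>2) has_integral (y c * y' c - y p * y' p)) {p..c}"
    proof (rule fundamental_theorem_of_calculus)
      show "((\<lambda>s. y s * y' s) has_vector_derivative (y' x)\<^sup>2 - V x * (y x)\<^sup>2) (at x within {p..c})" if "x \<in> {p..c}" for x
      proof -
        have d: "(y has_real_derivative y' x) (at x within {p..c})" "(y' has_real_derivative - (V x * y x)) (at x within {p..c})"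
          using sol that unfolding ode_solution_def by (auto intro: has_field_derivative_subset[where t = "{p..c}"])
        have "((\<lambda>s. y s * y' s) has_real_derivative y' x * y' x + (- (V x * y x)) * y x) (at x within {p..c})"
          by (rule DERIV_mult[OF d])
        then show ?thesis
          by (simp add: has_real_derivative_iff_has_vector_derivative power2_eq_square algebra_simps)
      qed
    qed (use c in simp)
    then have "integral {p..c} (\<lambda>s. (y' s)\<^sup>2 - V s * (y s)\<^sup>2) = y c * y' c" using ic by (simp add: integral_unique)
    then show ?thesis
      using integral_diff[OF integrable_continuous_interval[OF c1] integrable_continuous_interval[OF c2]] by simp
  qed
  ultimately have "0 \<le> y c * y' c + \<kappa>\<^sup>2 * (e - c)" by linarith
  \<comment> \<open>One factor \<kappa> is absorbed by the chord: \<kappa> (e - c) = y(c).\<close>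
  also have "\<dots> = y c * (y' c + \<kappa>)" using \<kappa>(2) by (simp add: power2_eq_square algebra_simps)
  also have "\<dots> < 0" using yc c(3) by (simp add: \<kappa>_def mult_pos_neg)
  finally show False by simp
qed

text \<open>Where \<open>u\<close> is positive it is concave, so a negative slope would push it
  below its tangent, which reaches zero at the finite point \<open>r\<close>.\<close>

lemma ode_solution_slope_nonneg:
  assumes sol: "ode_solution V p u u'" and V: "\<And>t. t > p \<Longrightarrow> V t \<ge> 0" and u: "\<And>t. t > p \<Longrightarrow> u t > 0" and t: "t > p"
  shows "u' t \<ge> 0"
proof (rule ccontr)
  assume "\<not> u' t \<ge> 0"
  then have n: "u' t < 0" by simp
  define r where "r = t + u t / (- u' t)"
  have r: "t < r" using u[OF t] n unfolding r_def by (simp add: divide_pos_neg)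
  obtain z where z: "t < z" "z < r" "u r - u t = (r - t) * u' z"
    using MVT2[OF r, of u u'] ode_solution_at(1)[OF sol] t by force
  obtain w where w: "t < w" "w < z" "u' z - u' t = (z - t) * (- (V w * u w))"
    using MVT2[OF z(1), of u' "\<lambda>w. - (V w * u w)"] ode_solution_at(2)[OF sol] t by force
  have "V w * u w \<ge> 0" using V[of w] u[of w] w t by (intro mult_nonneg_nonneg) auto
  then have "(z - t) * (- (V w * u w)) \<le> 0" using z(1) by (intro mult_nonneg_nonpos) auto
  then have "u' z \<le> u' t" using w(3) by linarith
  then have "(r - t) * u' z \<le> (r - t) * u' t" using r by (intro mult_left_mono) auto
  also have "\<dots> = - u t" using n by (simp add: r_def)
  finally have "u r \<le> 0" using z by linarith
  then show False using u[of r] r t by linarith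
qed

text \<open>The solutions starting at \<open>p n\<close> are normalised to value 1 at a common point
  \<open>t0\<close>. Then only their slopes there vary; these decrease and are bounded below by 0,
  hence converge. Since the solution space is two-dimensional, convergence of the two data at
  \<open>t0\<close> is convergence of the solutions.\<close>

lemma jacobi_positive_solution:
  assumes J: "jacobi_nonneg \<gamma> V" and V: "continuous_on {\<gamma><..} V" and Vpos: "\<And>t. t > \<gamma> \<Longrightarrow> V t > 0"
  obtains h where "Ck_on 2 {\<gamma><..} h" "\<And>t. t > \<gamma> \<Longrightarrow> h t > 0" "\<And>t. t > \<gamma> \<Longrightarrow> deriv (deriv h) t = - (V t * h t)"
proof -
  \<comment> \<open>The offset 2 places all starting points strictly below t0 = \<gamma> +
    1.\<close>
  define p where "p n = \<gamma> + 1 / real (n + 2)" for n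
  define t0 where "t0 = \<gamma> + 1"
  have p: "p n > \<gamma>" "p n < t0" for n by (auto simp: p_def t0_def)
  have pmono: "p n < p m" if "m < n" for m n using that by (simp add: p_def frac_less2)
  have "\<exists>u u'. ode_solution V (p n) u u' \<and> u (p n) = 0 \<and> u' (p n) = 1" for n
    using ode_exists[OF continuous_on_subset[OF V], of "p n"] p(1)[of n] by (metis atLeast_subset_iff greaterThan_iff subsetI atLeast_iff less_le_trans)
  then obtain Y Y' where Y: "\<And>n. ode_solution V (p n) (Y n) (Y' n)" "\<And>n. Y n (p n) = 0" "\<And>n. Y' n (p n) = 1"
    by metis
  have Ypos: "Y n t > 0" if "t > p n" for n t
    by (rule jacobi_positive[OF J V Vpos p(1) Y that])
  \<comment> \<open>The vanishing second summand only brings the scaled solution into the shape of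
    \<open>ode_solution_comb\<close>.\<close>
  define h h' where "h n t = (1 / Y n t0) * Y n t + 0 * Y n t" and "h' n t = (1 / Y n t0) * Y' n t + 0 * Y' n t" for n t
  have sol: "ode_solution V (p n) (h n) (h' n)" for n
    unfolding h_def h'_def by (rule ode_solution_comb[OF Y(1) Y(1)])
  have ht0: "h n t0 = 1" for n using Ypos[OF p(2), of n] by (simp add: h_def)
  have hpos: "h n t > 0" if "t > p n" for n t using Ypos[OF that] Ypos[OF p(2), of n] by (simp add: h_def)
  have hp: "h n (p n) = 0" "h' n (p n) > 0" for n using Ypos[OF p(2), of n] Y by (auto simp: h_def h'_def)
  define s where "s n = h' n t0" for n
  have s0: "s n \<ge> 0" for n unfolding s_def
    by (rule ode_solution_slope_nonneg[OF sol _ hpos p(2)]) (use Vpos p(1)[of n] in \<open>force intro: less_imp_le\<close>)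
  \<comment> \<open>The Wronskian of \<open>h n\<close> and \<open>h m\<close> is s(m) - s(n) at
    \<open>t0\<close>, where both values are 1. At \<open>p m\<close>, where \<open>h m\<close>
    starts from 0 with positive slope and \<open>h n\<close> is already positive, it is
    positive.\<close>
  have sdec: "s n < s m" if "m < n" for m n
  proof -
    have "h n (p m) * h' m (p m) - h' n (p m) * h m (p m) = h n t0 * h' m t0 - h' n t0 * h m t0"
      by (rule wronskian_const[OF ode_solution_mono[OF sol] sol]) (use pmono[OF that] p(2)[of m] in auto)
    moreover have "h n (p m) * h' m (p m) > 0" using hpos[OF pmono[OF that]] hp(2) by simp
    ultimately show ?thesis by (simp add: hp ht0 s_def)
  qed
  obtain S where S: "s \<longlonglongrightarrow> S"
  proof -
    have "decseq s" unfolding decseq_def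
    proof (intro allI impI)
      show "s n \<le> s m" if "m \<le> n" for m n using sdec[of m n] that by (cases "m = n") auto
    qed
    then show ?thesis using decseq_convergent[of s 0] s0 that by metis
  qed
  define D where "D m = s m - s (Suc m)" for m
  have D: "D m > 0" for m using sdec[of m "Suc m"] by (simp add: D_def)
  \<comment> \<open>The solution on \<open>{p m..}\<close> with value 1 and slope x at
    \<open>t0\<close>, written in the basis \<open>h m\<close>, \<open>h (Suc m)\<close>. Its
    coefficients are affine in x, so a limit of slopes passes through directly.\<close>
  define K where "K x m t = (x - s (Suc m)) / D m * h m t + (s m - x) / D m * h (Suc m) t" for x m t
  define K' where "K' x m t = (x - s (Suc m)) / D m * h' m t + (s m - x) / D m * h' (Suc m) t" for x m t
  have sol': "ode_solution V (p m) (h n) (h' n)" if "m \<le> n" for m n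
    using ode_solution_mono[OF sol[of n], of "p m"] pmono[of m n] that by (cases "m = n") auto
  have Ksol: "ode_solution V (p m) (K x m) (K' x m)" for x m
    unfolding K_def K'_def by (rule ode_solution_comb[OF sol' sol']) auto
  have Kt0: "K x m t0 = 1" "K' x m t0 = x" for x m
  proof -
    have "x - s (Suc m) + (s m - x) = D m" "(x - s (Suc m)) * s m + (s m - x) * s (Suc m) = x * D m"
      by (simp_all add: D_def algebra_simps)
    then show "K x m t0 = 1" "K' x m t0 = x"
      using D[of m] by (simp_all add: K_def K'_def ht0 s_def[symmetric] add_divide_distrib[symmetric])
  qed
  have nz: "h (Suc m) t * h' m t - h' (Suc m) t * h m t \<noteq> 0" if "t \<ge> p m" for m t
    using wronskian_const[OF sol'[of m "Suc m"] sol[of m] that, of t0] p(2)[of m] D[of m]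
    by (simp add: ht0 s_def[symmetric] D_def)
  have hK: "h n t = K (s n) m t" if "m \<le> n" "t \<ge> p m" for m n t
  proof -
    have "(1 * h n t + (-1) * K (s n) m t) = 0"
      by (rule ode_unique(1)[OF sol'[of m "Suc m"] sol[of m] ode_solution_comb[OF sol'[OF that(1)] Ksol], of t0])
        (use p(2)[of m] nz[of m t0] that in \<open>auto simp: ht0 Kt0 s_def[symmetric]\<close>)
    then show ?thesis by simp
  qed
  define H where "H t = lim (\<lambda>n. h n t)" for t
  have lim: "(\<lambda>n. h n t) \<longlonglongrightarrow> K S m t" if "t \<ge> p m" for m t
  proof (rule Lim_transform_eventually)
    show "(\<lambda>n. K (s n) m t) \<longlonglongrightarrow> K S m t"
      unfolding K_def using D[of m] by (intro tendsto_intros S) auto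
    show "\<forall>\<^sub>F n in sequentially. K (s n) m t = h n t"
      using hK[OF _ that] by (auto simp: eventually_sequentially intro!: exI[of _ m])
  qed
  have HK: "H t = K S m t" if "t \<ge> p m" for m t unfolding H_def using limI[OF lim[OF that]] .
  have ex: "\<exists>m. p m < t" if "t > \<gamma>" for t
  proof -
    obtain m :: nat where m: "1 / (t - \<gamma>) < real m" using reals_Archimedean2 by blast
    then have "1 < real m * (t - \<gamma>)" using that by (simp add: divide_less_eq)
    then have "1 < real (m + 2) * (t - \<gamma>)" using that by (simp add: algebra_simps)
    then have "1 / real (m + 2) < t - \<gamma>" by (simp add: divide_less_eq mult.commute)
    then show ?thesis by (intro exI[of _ m]) (simp add: p_def)
  qed
  have H0: "H t \<ge> 0" if t: "t > \<gamma>" for t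
  proof -
    obtain m where m: "p m < t" using ex[OF t] by blast
    have "\<forall>\<^sub>F n in sequentially. 0 \<le> h n t"
      using hpos[of _ t] m pmono by (auto simp: eventually_sequentially intro!: exI[of _ m] less_imp_le)
        (metis le_less less_trans)
    then show ?thesis using tendsto_lowerbound[OF lim[OF less_imp_le[OF m]]] HK[OF less_imp_le[OF m]] by simp
  qed
  have DH: "(H has_real_derivative K' S m t) (at t)" if "t > p m" for m t
    by (rule has_field_derivative_transform_within_open[OF ode_solution_at(1)[OF Ksol that], of "{p m<..}"])
      (use that HK[symmetric] in auto)
  \<comment> \<open>A zero of the nonnegative limit is a local minimum, so value and slope vanish
    there; uniqueness makes the solution zero, against its value 1 at \<open>t0\<close>.\<close>
  have Hpos: "H t > 0" if t: "t > \<gamma>" for t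
  proof (rule ccontr)
    assume "\<not> H t > 0"
    then have Ht: "H t = 0" using H0[OF t] by simp
    obtain m where m: "p m < t" using ex[OF t] by blast
    have "K' S m t = 0"
      by (rule DERIV_local_min[OF DH[OF m], of "t - p m"])
        (use m p(1)[of m] H0 Ht in \<open>auto simp: abs_less_iff\<close>)
    then have "K S m t0 = 0"
      using ode_unique(1)[OF sol'[of m "Suc m"] sol[of m] Ksol, of t S t0] m nz[of m t] Ht HK[of m t] p(2)[of m] by simp
    then show False using Kt0(1)[of S m] by simp
  qed
  have dH: "(H has_real_derivative deriv H t) (at t)" "(deriv H has_real_derivative - (V t * H t)) (at t)" if t: "t > \<gamma>" for t
  proof -
    obtain m where m: "p m < t" using ex[OF t] by blast
    have e: "deriv H x = K' S m x" if "x > p m" for x using DH[OF that] by (rule DERIV_imp_deriv)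
    show "(H has_real_derivative deriv H t) (at t)" using DH[OF m] e[OF m] by simp
    have "(K' S m has_real_derivative - (V t * H t)) (at t)"
      using ode_solution_at(2)[OF Ksol m] HK[of m t] m by simp
    then show "(deriv H has_real_derivative - (V t * H t)) (at t)"
      by (rule has_field_derivative_transform_within_open[of _ _ _ "{p m<..}"]) (use m e in auto)
  qed
  show ?thesis
  proof (rule that[of H])
    have "continuous_on {\<gamma><..} H"
      by (rule DERIV_continuous_on[of _ _ "deriv H"]) (use dH(1) in \<open>auto intro: has_field_derivative_at_within\<close>)
    then have "Ck_on 0 {\<gamma><..} (\<lambda>t. - (V t * H t))" using V by (auto simp: Ck_on_0 intro!: continuous_intros)
    then have "Ck_on (Suc 0) {\<gamma><..} (deriv H)" by (rule Ck_on_SucI_real[rotated 2]) (use dH(2) in auto)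
    then have "Ck_on (Suc (Suc 0)) {\<gamma><..} H" by (rule Ck_on_SucI_real[rotated 2]) (use dH(1) in auto)
    then show "Ck_on 2 {\<gamma><..} H" by (simp add: numeral_2_eq_2)
    show "deriv (deriv H) t = - (V t * H t)" if "t > \<gamma>" for t using dH(2)[OF that] by (rule DERIV_imp_deriv)
  qed (rule Hpos)
qed

section \<open>The equivalence\<close>

context weighted_domain
begin

lemma test_fun_H1_0:
  assumes "test_fun \<Omega> \<phi>"
  shows "\<phi> \<in> H1_0 \<Omega>" "weak_grad \<Omega> \<phi> (grad \<phi>)"
proof -
  obtain S where S: "compact S" "S \<subseteq> \<Omega>" "\<And>x. x \<notin> S \<Longrightarrow> \<phi> x = 0" "\<And>x. x \<notin> S \<Longrightarrow> grad \<phi> x = 0"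
    "\<And>k. Ck_on k UNIV \<phi>" "\<And>k i. Ck_on k UNIV (\<lambda>x. grad \<phi> x $ i)"
    using test_fun_props[OF assms] by metis
  have loc: "loc_integrable \<Omega> g" if "Ck_on 0 UNIV g" for g
    using that by (auto simp: Ck_on_0 intro!: continuous_on_imp_loc_integrable intro: continuous_on_subset)
  show w: "weak_grad \<Omega> \<phi> (grad \<phi>)"
    unfolding weak_grad_def
  proof (intro conjI allI impI)
    fix \<eta> i assume t: "test_fun \<Omega> \<eta>"
    have \<eta>: "Ck_on k UNIV \<eta>" "Ck_on k UNIV (\<lambda>x. grad \<eta> x $ i)" for k i
      by (rule test_fun_props[OF t], assumption)+
    have d: "\<phi> differentiable (at x)" "\<eta> differentiable (at x)" for x
      using S(5)[of 1] \<eta>(1)[of 1] by (auto simp: Ck_on_Suc)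
    have p: "frechet_derivative (\<lambda>x. \<phi> x * \<eta> x) (at x) (axis i 1) = \<phi> x * grad \<eta> x $ i + grad \<phi> x $ i * \<eta> x" for x
      using frechet_derivative_mult[OF d, of x "axis i 1"] by (simp add: grad_def)
    have "Ck_on 1 UNIV (\<lambda>x. \<phi> x * \<eta> x)" by (intro Ck_on_mult S \<eta>) auto
    moreover have "axis i 1 \<in> (Basis :: (real^'n) set)" by (auto simp: Basis_vec_def)
    ultimately have 0: "(LINT x|lborel. \<phi> x * grad \<eta> x $ i + grad \<phi> x $ i * \<eta> x) = 0"
      using integral_partial_derivative_eq_0(2)[of "\<lambda>x. \<phi> x * \<eta> x" S "axis i 1"] S(1,3)
      by (simp add: p)
    have c: "continuous_on UNIV (\<lambda>x. \<phi> x * grad \<eta> x $ i)" "continuous_on UNIV (\<lambda>x. grad \<phi> x $ i * \<eta> x)"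
      by (intro continuous_on_mult Ck_on_imp_continuous_on[OF S(5)] Ck_on_imp_continuous_on[OF S(6)]
          Ck_on_imp_continuous_on[OF \<eta>(1)] Ck_on_imp_continuous_on[OF \<eta>(2)])+
    have z: "\<phi> x * grad \<eta> x $ i = 0" "grad \<phi> x $ i * \<eta> x = 0" if "x \<notin> S" for x using S(3,4)[OF that] by auto
    have "(LINT x|lborel. \<phi> x * grad \<eta> x $ i) + (LINT x|lborel. grad \<phi> x $ i * \<eta> x) = 0"
      using 0 Bochner_Integration.integral_add[OF integrable_compact_support[OF c(1) S(1) z(1)]
          integrable_compact_support[OF c(2) S(1) z(2)]] by simp
    moreover have "(LINT x|lebesgue_on \<Omega>. \<phi> x * grad \<eta> x $ i) = (LINT x|lborel. \<phi> x * grad \<eta> x $ i)"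
      by (rule integral_lebesgue_on_eq_lborel(1)[OF borel_measurable_continuous_onI[OF c(1)] meas_\<Omega>])
        (use z(1) S(2) in blast)
    moreover have "(LINT x|lebesgue_on \<Omega>. grad \<phi> x $ i * \<eta> x) = (LINT x|lborel. grad \<phi> x $ i * \<eta> x)"
      by (rule integral_lebesgue_on_eq_lborel(1)[OF borel_measurable_continuous_onI[OF c(2)] meas_\<Omega>])
        (use z(2) S(2) in blast)
    ultimately show "(LINT x|lebesgue_on \<Omega>. \<phi> x * grad \<eta> x $ i) = - (LINT x|lebesgue_on \<Omega>. grad \<phi> x $ i * \<eta> x)"
      by linarith
  qed (rule loc, rule S)+
  show "\<phi> \<in> H1_0 \<Omega>" unfolding H1_0_def
    by (rule CollectI, intro conjI exI[of _ "grad \<phi>"] exI[of _ "\<lambda>_. \<phi>"] w allI test_fun_L2[OF assms] assms) simp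
qed

lemma nn_integral_coarea:
  assumes g: "\<And>k. Ck_on k UNIV g" and supp: "\<And>s. s \<notin> {a..M} \<Longrightarrow> g s = 0" and a: "a > \<gamma>"
    and pos: "\<And>s. g s \<ge> 0" and F: "\<And>x. x \<in> U \<Longrightarrow> F x = g (e x) * Q x"
  shows "enn2ereal (\<integral>\<^sup>+x. ennreal (F x) \<partial>lebesgue_on \<Omega>) = ereal (c * (LINT s|lborel. g s))"
proof -
  have i: "integrable (lebesgue_on \<Omega>) (\<lambda>x. if x \<in> U then g (e x) * Q x else 0)"
    by (rule coarea_identity(1)[OF g supp a])
  have "(\<integral>\<^sup>+x. ennreal (F x) \<partial>lebesgue_on \<Omega>) = (\<integral>\<^sup>+x. ennreal (if x \<in> U then g (e x) * Q x else 0) \<partial>lebesgue_on \<Omega>)"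
    by (rule nn_integral_cong_AE, use AE_U in eventually_elim) (simp add: F)
  also have "\<dots> = ennreal (LINT x|lebesgue_on \<Omega>. (if x \<in> U then g (e x) * Q x else 0))"
    by (rule nn_integral_eq_integral[OF i]) (use pos Q_nonneg in auto)
  also have "(LINT x|lebesgue_on \<Omega>. (if x \<in> U then g (e x) * Q x else 0)) = c * (LINT s|lborel. g s)"
    by (rule coarea_identity(2)[OF g supp a])
  finally show ?thesis using c_pos pos by (simp add: enn2ereal_ennreal)
qed

text \<open>For u = g \<circ> E the coarea identity turns each of the three integrals into the mass
  of \<mu> times an integral over the line, and the positive mass cancels.\<close>

lemma hardy_imp_jacobi_nonneg:
  assumes \<gamma>: "\<gamma> \<ge> 0" and f: "\<And>k. Ck_on k {\<gamma><..} f" "\<And>t. t > \<gamma> \<Longrightarrow> f t \<ge> 0"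
    and hardy: "\<And>u G. u \<in> H1_0 \<Omega> \<Longrightarrow> weak_grad \<Omega> u G \<Longrightarrow>
        enn2ereal (\<integral>\<^sup>+x. ennreal (normsq_A A x (G x)) \<partial>lebesgue_on \<Omega>)
        - ereal (1/4) * enn2ereal (\<integral>\<^sup>+x. ennreal (normsq_A A x (grad e x) / (e x)\<^sup>2 * (u x)\<^sup>2) \<partial>lebesgue_on \<Omega>)
        \<ge> enn2ereal (\<integral>\<^sup>+x. ennreal (f (e x) * normsq_A A x (grad e x) * (u x)\<^sup>2) \<partial>lebesgue_on \<Omega>)"
  shows "jacobi_nonneg \<gamma> (\<lambda>t. f t + 1 / (4 * t\<^sup>2))"
  unfolding jacobi_nonneg_def
proof (intro allI impI)
  fix g :: "real \<Rightarrow> real" and a b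
  assume g': "\<forall>k. Ck_on k UNIV g" and a: "\<gamma> < a" and supp': "\<forall>s. s \<notin> {a..b} \<longrightarrow> g s = 0"
  then have g: "\<And>k. Ck_on k UNIV g" and supp: "\<And>s. s \<notin> {a..b} \<Longrightarrow> g s = 0" by blast+
  note D = Ck_on_SucD_real[OF open_UNIV g]
  have dsupp: "deriv g s = 0" if "s \<notin> {a..b}" for s
    by (rule deriv_eq_0_outside[OF closed_atLeastAtMost supp that])
  let ?L = "{x\<in>\<Omega>. E x \<in> {ereal a..}}" and ?R = "{x\<in>\<Omega>. E x \<in> {ereal a..ereal b}}"
  let ?\<phi> = "\<lambda>x. if x \<in> K then 0 else if x \<in> \<Omega> then g (e x) else 0"
  \<comment> \<open>Here \<open>g\<close> itself plays the part of \<open>T\<close>, with value 0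
    near \<open>K\<close>. The threshold is b + 1 because the support hypothesis says nothing about
    the endpoint \<open>b\<close>.\<close>
  have 1: "?L \<subseteq> \<Omega>" "\<forall>x\<in>U - ?L. g (e x) = 0" "\<forall>s\<ge>b + 1. g s = 0" "\<forall>x\<in>U - ?R. deriv g (e x) = 0"
    using E_eq_U U_sub by (auto intro!: supp dsupp)
  note \<phi> = energy_identity(1,2)[OF g D(1)[OF UNIV_I] E_ge_level_compact(1)[OF a] 1(1,2,3)
      E_ge_level_compact(2,3)[OF a, of b] 1(4)]
  have \<phi>U: "?\<phi> x = g (e x)" if "x \<in> U" for x using that U_K U_sub by auto
  \<comment> \<open>The weights are smooth only on (\<gamma>, \<infinity>); the support of
    \<open>g\<close> stays away from \<gamma>, so the product extends by zero.\<close>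
  have ext: "Ck_on k UNIV (\<lambda>s. w s * (g s)\<^sup>2)" if "Ck_on k {\<gamma><..} w" for w k
    by (rule Ck_on_extend_zero[of "{\<gamma><..}" _ _ "{a..b}"])
      (use a supp g that in \<open>auto intro!: Ck_on_mult Ck_on_power intro: Ck_on_subset\<close>)
  have inv: "Ck_on k {\<gamma><..} (\<lambda>s. 1 / s\<^sup>2)" for k
    using \<gamma> by (intro Ck_on_divide Ck_on_power Ck_on_id) auto
  let ?I = "\<lambda>w. LINT s|lborel. w s * (g s)\<^sup>2"
  have A1: "enn2ereal (\<integral>\<^sup>+x. ennreal (normsq_A A x (grad ?\<phi> x)) \<partial>lebesgue_on \<Omega>) = ereal (c * (LINT s|lborel. (deriv g s)\<^sup>2))"
  proof (rule nn_integral_coarea[OF _ _ a])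
    show "Ck_on k UNIV (\<lambda>s. (deriv g s)\<^sup>2)" for k using D(2)[of k] by (intro Ck_on_power) auto
    show "normsq_A A x (grad ?\<phi> x) = (deriv g (e x))\<^sup>2 * Q x" if "x \<in> U" for x
      unfolding \<phi>(2)[OF that] normsq_scale Q_def ..
  qed (use dsupp in auto)
  have A2: "enn2ereal (\<integral>\<^sup>+x. ennreal (normsq_A A x (grad e x) / (e x)\<^sup>2 * (?\<phi> x)\<^sup>2) \<partial>lebesgue_on \<Omega>) = ereal (c * ?I (\<lambda>s. 1 / s\<^sup>2))"
    by (rule nn_integral_coarea[OF ext[OF inv] _ a]) (use supp \<phi>U in \<open>auto simp: Q_def simp del: if_not_P\<close>)
  have A3: "enn2ereal (\<integral>\<^sup>+x. ennreal (f (e x) * normsq_A A x (grad e x) * (?\<phi> x)\<^sup>2) \<partial>lebesgue_on \<Omega>) = ereal (c * ?I f)"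
  proof (rule nn_integral_coarea[OF ext[OF f(1)] _ a])
    show "f s * (g s)\<^sup>2 \<ge> 0" for s using f(2)[of s] supp[of s] a by (cases "s \<in> {a..b}") auto
    show "f (e x) * normsq_A A x (grad e x) * (?\<phi> x)\<^sup>2 = f (e x) * (g (e x))\<^sup>2 * Q x" if "x \<in> U" for x
      unfolding \<phi>U[OF that] Q_def by simp
  qed (use supp in auto)
  have "ereal (c * ?I f) \<le> ereal (c * (LINT s|lborel. (deriv g s)\<^sup>2)) - ereal (1/4) * ereal (c * ?I (\<lambda>s. 1 / s\<^sup>2))"
    using hardy[OF test_fun_H1_0[OF \<phi>(1)]] unfolding A1 A2 A3 .
  then have "c * ?I f \<le> c * (LINT s|lborel. (deriv g s)\<^sup>2) - 1/4 * (c * ?I (\<lambda>s. 1 / s\<^sup>2))" by simp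
  then have "c * (?I f + 1/4 * ?I (\<lambda>s. 1 / s\<^sup>2)) \<le> c * (LINT s|lborel. (deriv g s)\<^sup>2)"
    by (simp add: algebra_simps)
  then have le: "?I f + 1/4 * ?I (\<lambda>s. 1 / s\<^sup>2) \<le> (LINT s|lborel. (deriv g s)\<^sup>2)" using c_pos by simp
  have int: "integrable lborel (\<lambda>s. w s * (g s)\<^sup>2)" if "Ck_on 0 {\<gamma><..} w" for w
    by (rule integrable_compact_support[OF Ck_on_imp_continuous_on[OF ext[OF that]] compact_Icc, of a b]) (use supp in auto)
  have "(LINT s|lborel. (f s + 1 / (4 * s\<^sup>2)) * (g s)\<^sup>2) = (LINT s|lborel. f s * (g s)\<^sup>2 + 1/4 * (1 / s\<^sup>2 * (g s)\<^sup>2))"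
    by (rule Bochner_Integration.integral_cong) (auto simp: algebra_simps)
  also have "\<dots> = ?I f + 1/4 * ?I (\<lambda>s. 1 / s\<^sup>2)"
    by (simp only: Bochner_Integration.integral_add[OF int[OF f(1)] integrable_mult_right[OF int[OF inv]]]
        integral_mult_right_zero)
  finally show "(LINT s|lborel. (f s + 1 / (4 * s\<^sup>2)) * (g s)\<^sup>2) \<le> (LINT s|lborel. (deriv g s)\<^sup>2)" using le by simp
qed

text \<open>The logarithmic derivative of \<open>h\<close> converts the linear inequality into the
  Riccati inequality r' + V + r^2 \<le> 0 on which the divergence estimate rests.\<close>

lemma supersolution_imp_hardy:
  assumes \<gamma>: "\<gamma> \<ge> 0" and f: "continuous_on {\<gamma><..} f" "\<And>t. t > \<gamma> \<Longrightarrow> f t \<ge> 0"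
    and h: "Ck_on 2 {\<gamma><..} h" "\<And>t. t > \<gamma> \<Longrightarrow> h t > 0"
      "\<And>t. t > \<gamma> \<Longrightarrow> deriv (deriv h) t + (f t + 1 / (4 * t\<^sup>2)) * h t \<le> 0"
    and u: "u \<in> H1_0 \<Omega>" and G: "weak_grad \<Omega> u G"
  shows "enn2ereal (\<integral>\<^sup>+x. ennreal (normsq_A A x (G x)) \<partial>lebesgue_on \<Omega>)
      - ereal (1/4) * enn2ereal (\<integral>\<^sup>+x. ennreal (normsq_A A x (grad e x) / (e x)\<^sup>2 * (u x)\<^sup>2) \<partial>lebesgue_on \<Omega>)
      \<ge> enn2ereal (\<integral>\<^sup>+x. ennreal (f (e x) * normsq_A A x (grad e x) * (u x)\<^sup>2) \<partial>lebesgue_on \<Omega>)"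
proof -
  define M where "M = lebesgue_on \<Omega>"
  define V where "V t = f t + 1 / (4 * t\<^sup>2)" for t
  have inv: "continuous_on {\<gamma><..} (\<lambda>t. 1 / t\<^sup>2)" using \<gamma> by (intro continuous_intros) auto
  have V: "continuous_on {\<gamma><..} V" unfolding V_def using \<gamma> f(1) by (intro continuous_intros) auto
  have V0: "V t \<ge> 0" if "t > \<gamma>" for t using f(2)[OF that] by (simp add: V_def)
  note D1 = Ck_on_SucD_real[OF open_greaterThan h(1)[unfolded numeral_2_eq_2]]
  note D2 = Ck_on_SucD_real[OF open_greaterThan D1(2)]
  define r where "r t = deriv h t / h t" for t
  have r: "Ck_on 1 {\<gamma><..} r" unfolding r_def
    by (intro Ck_on_divide) (use D1(2) Ck_on_le[OF h(1), of 1] h(2) in \<open>auto simp: less_imp_neq[symmetric]\<close>)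
  have ric: "deriv r t + V t + (r t)\<^sup>2 \<le> 0" if t: "t > \<gamma>" for t
  proof -
    have "(r has_real_derivative (deriv (deriv h) t * h t - deriv h t * deriv h t) / (h t * h t)) (at t)"
      unfolding r_def[abs_def] using h(2)[OF t] by (intro DERIV_divide D1(1) D2(1)) (use t in auto)
    then have d: "deriv r t = (deriv (deriv h) t * h t - deriv h t * deriv h t) / (h t * h t)"
      by (rule DERIV_imp_deriv)
    have "deriv r t + V t + (r t)\<^sup>2 = (deriv (deriv h) t + V t * h t) / h t"
      unfolding d r_def using h(2)[OF t] by (simp add: field_simps power2_eq_square)
    also have "\<dots> \<le> 0" using h(2,3)[OF t] by (intro divide_nonpos_pos) (auto simp: V_def)
    finally show ?thesis .
  qed
  define w where "w W x = (if x \<in> U \<and> e x > \<gamma> then W (e x) * Q x else 0)" for W x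
  have um: "u \<in> borel_measurable M" using u by (auto simp: H1_0_def L2_def M_def)
  have wm: "(\<lambda>x. ennreal (w W x * (u x)\<^sup>2)) \<in> borel_measurable M" if "continuous_on {\<gamma><..} W" for W
    using measurable_weight[OF that] um unfolding w_def[symmetric] M_def
    by (intro measurable_compose[OF _ measurable_ennreal] borel_measurable_times borel_measurable_power)
  define a b d where "a = (\<integral>\<^sup>+x. ennreal (normsq_A A x (G x)) \<partial>M)"
    and "b = (\<integral>\<^sup>+x. ennreal (normsq_A A x (grad e x) / (e x)\<^sup>2 * (u x)\<^sup>2) \<partial>M)"
    and "d = (\<integral>\<^sup>+x. ennreal (f (e x) * normsq_A A x (grad e x) * (u x)\<^sup>2) \<partial>M)"
  have AEU: "AE x in M. x \<in> U" unfolding M_def by (rule AE_U)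
  \<comment> \<open>Restricting the weight to E > \<gamma> loses nothing, as |\<nabla>E| vanishes at
    the remaining points of \<open>U\<close>.\<close>
  have wQ: "W (e x) * Q x = w W x" if "x \<in> U" for W x
    using E_ge_boundary[OF that] Q_eq_0_at_boundary_value[OF that] that by (cases "e x = \<gamma>") (auto simp: w_def)
  have b: "b = (\<integral>\<^sup>+x. ennreal (w (\<lambda>t. 1 / t\<^sup>2) x * (u x)\<^sup>2) \<partial>M)"
    unfolding b_def
  proof (rule nn_integral_cong_AE, use AEU in eventually_elim)
    case (elim x)
    show ?case using wQ[OF elim, of "\<lambda>t. 1 / t\<^sup>2"] by (simp add: Q_def)
  qed
  have d: "d = (\<integral>\<^sup>+x. ennreal (w f x * (u x)\<^sup>2) \<partial>M)"
    unfolding d_def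
  proof (rule nn_integral_cong_AE, use AEU in eventually_elim)
    case (elim x)
    show ?case using wQ[OF elim, of f] by (simp add: Q_def)
  qed
  have "ennreal (1/4) * b + d = (\<integral>\<^sup>+x. ennreal (1/4) * ennreal (w (\<lambda>t. 1 / t\<^sup>2) x * (u x)\<^sup>2) + ennreal (w f x * (u x)\<^sup>2) \<partial>M)"
    unfolding b d using wm[OF inv] wm[OF f(1)] by (subst nn_integral_add) (auto simp: nn_integral_cmult)
  also have "\<dots> = (\<integral>\<^sup>+x. ennreal (w V x * (u x)\<^sup>2) \<partial>M)"
  proof (rule nn_integral_cong)
    fix x
    have p: "0 \<le> w (\<lambda>t. 1 / t\<^sup>2) x * (u x)\<^sup>2" "0 \<le> w f x * (u x)\<^sup>2"
      using Q_nonneg[of x] f(2)[of "e x"] by (auto simp: w_def)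
    have "w V x * (u x)\<^sup>2 = 1/4 * (w (\<lambda>t. 1 / t\<^sup>2) x * (u x)\<^sup>2) + w f x * (u x)\<^sup>2"
      by (simp add: w_def V_def algebra_simps)
    then show "ennreal (1/4) * ennreal (w (\<lambda>t. 1 / t\<^sup>2) x * (u x)\<^sup>2) + ennreal (w f x * (u x)\<^sup>2) = ennreal (w V x * (u x)\<^sup>2)"
      using ennreal_plus[of "1/4 * (w (\<lambda>t. 1 / t\<^sup>2) x * (u x)\<^sup>2)" "w f x * (u x)\<^sup>2"]
        ennreal_mult[of "1/4" "w (\<lambda>t. 1 / t\<^sup>2) x * (u x)\<^sup>2"] p by simp
  qed
  also have "\<dots> \<le> a" unfolding a_def M_def w_def by (rule hardy_H1_0(1)[OF r V V0 ric u G])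
  finally have le: "ennreal (1/4) * b + d \<le> a" .
  \<comment> \<open>With finite energy all three terms are real numbers, so the sum inequality may
    be rearranged into the difference form without meeting \<infinity> - \<infinity>.\<close>
  have a: "a < \<infinity>" unfolding a_def M_def by (rule hardy_H1_0(2)[OF r V V0 ric u G])
  obtain a' where a': "a = ennreal a'" "a' \<ge> 0" using a by (cases a) auto
  have bd: "ennreal (1/4) * b < \<infinity>" "d < \<infinity>" using le a by (auto simp: less_top[symmetric] top_unique)
  have "b \<noteq> \<infinity>" using bd(1) by (auto simp: ennreal_mult_top)
  then obtain b' where b': "b = ennreal b'" "b' \<ge> 0" by (cases b) auto
  obtain d' where d': "d = ennreal d'" "d' \<ge> 0" using bd(2) by (cases d) auto
  have "ennreal (1/4 * b' + d') \<le> ennreal a'"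
  proof -
    have "ennreal (q * b' + d') = ennreal q * ennreal b' + ennreal d'" if "q \<ge> 0" for q
      using that b'(2) d'(2) by (simp add: ennreal_mult)
    from this[of "1/4"] show ?thesis using le unfolding a'(1) b'(1) d'(1) by simp
  qed
  then have "1/4 * b' + d' \<le> a'" using a'(2) by (simp add: ennreal_le_iff)
  then have "enn2ereal d \<le> enn2ereal a - ereal (1/4) * enn2ereal b"
    using a' b' d' by (simp add: enn2ereal_ennreal)
  then show ?thesis unfolding a_def b_def d_def M_def .
qed

end

theorem theorem2p9:
  fixes \<Omega> :: "(real^'n) set"
    and A :: "real^'n \<Rightarrow> real^'n^'n"
    and E :: "real^'n \<Rightarrow> ereal"
    and \<gamma> :: real
    and f :: "real \<Rightarrow> real"
  defines "E' \<equiv> real_of_ereal \<circ> E"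
  assumes "smooth_bounded_domain \<Omega>"
    and "elliptic_matrix \<Omega> A"
    and "interior_weight \<Omega> A E"
    and "\<gamma> \<ge> 0" and "\<forall>x\<in>frontier \<Omega>. E x = ereal \<gamma>"
    and "smooth_on {\<gamma><..} f" and "\<forall>t>\<gamma>. f t \<ge> 0"
    and "\<forall>\<^sub>F t in at_top. connected {x\<in>\<Omega>. ereal (\<gamma> + 1 / t) < E x \<and> E x < ereal t}"
  shows
    "(\<forall>u\<in>H1_0 \<Omega>. \<forall>G. weak_grad \<Omega> u G \<longrightarrow>
        enn2ereal (\<integral>\<^sup>+x. ennreal (normsq_A A x (G x)) \<partial>lebesgue_on \<Omega>)
        - ereal (1/4) * enn2ereal (\<integral>\<^sup>+x. ennreal (normsq_A A x (grad E' x) / (E' x)\<^sup>2 * (u x)\<^sup>2) \<partial>lebesgue_on \<Omega>)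
        \<ge> enn2ereal (\<integral>\<^sup>+x. ennreal (f (E' x) * normsq_A A x (grad E' x) * (u x)\<^sup>2) \<partial>lebesgue_on \<Omega>))
     \<longleftrightarrow>
     (\<exists>h :: real \<Rightarrow> real. Ck_on 2 {\<gamma><..} h \<and> (\<forall>t>\<gamma>. h t > 0) \<and>
        (\<forall>t>\<gamma>. deriv (deriv h) t + (f t + 1 / (4 * t\<^sup>2)) * h t \<le> 0))"
    (is "?hardy \<longleftrightarrow> ?super")
proof -
  obtain \<mu> K where iw: "sets \<mu> = sets (restrict_space borel \<Omega>)" "finite_measure \<mu>" "emeasure \<mu> \<Omega> \<noteq> 0"
    "distr_L_eq \<Omega> A (real_of_ereal \<circ> E) \<mu>" "K = supp_in \<Omega> \<mu>" "compact K"
    "\<forall>x\<in>closure \<Omega> - K. \<bar>E x\<bar> \<noteq> \<infinity>"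
    "smooth_upto (\<Omega> - K) (closure \<Omega> - K) (real_of_ereal \<circ> E)"
    "\<forall>x\<in>K. E x = \<infinity> \<and> (E \<longlongrightarrow> \<infinity>) (at x)"
    "\<exists>d. has_box_dim \<Omega> K d \<and> d < real CARD('n) - 2"
    using assms(4) unfolding interior_weight_def by auto
  interpret weighted_domain \<Omega> A E \<gamma> \<mu> K
    by (rule weighted_domain.intro) (fact assms iw)+
  have e: "e = E'" by (simp add: e_def E'_def)
  have f: "\<And>k. Ck_on k {\<gamma><..} f" "\<And>t. t > \<gamma> \<Longrightarrow> f t \<ge> 0" using assms(7,8) by (auto simp: smooth_on_def)
  have fc: "continuous_on {\<gamma><..} f" using f(1)[of 0] by (simp add: Ck_on_0)
  show ?thesis
  proof
    assume ?hardy
    then have J: "jacobi_nonneg \<gamma> (\<lambda>t. f t + 1 / (4 * t\<^sup>2))"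
      using hardy_imp_jacobi_nonneg[OF assms(5) f] unfolding e by blast
    have V: "continuous_on {\<gamma><..} (\<lambda>t. f t + 1 / (4 * t\<^sup>2))"
      using fc assms(5) by (intro continuous_intros) auto
    \<comment> \<open>Strictness comes from the Hardy term, as t > \<gamma> \<ge> 0.\<close>
    have Vpos: "f t + 1 / (4 * t\<^sup>2) > 0" if "t > \<gamma>" for t
      using f(2)[OF that] that assms(5) by (intro add_nonneg_pos) auto
    obtain h where "Ck_on 2 {\<gamma><..} h" "\<And>t. t > \<gamma> \<Longrightarrow> h t > 0"
      "\<And>t. t > \<gamma> \<Longrightarrow> deriv (deriv h) t = - ((f t + 1 / (4 * t\<^sup>2)) * h t)"
      using jacobi_positive_solution[OF J V Vpos] by metis
    then show ?super by (intro exI[of _ h]) auto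
  next
    assume ?super
    then obtain h where h: "Ck_on 2 {\<gamma><..} h" "\<And>t. t > \<gamma> \<Longrightarrow> h t > 0"
      "\<And>t. t > \<gamma> \<Longrightarrow> deriv (deriv h) t + (f t + 1 / (4 * t\<^sup>2)) * h t \<le> 0" by blast
    show ?hardy using supersolution_imp_hardy[OF assms(5) fc f(2) h] unfolding e by blast
  qed
qed

end
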